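(* Suppose $X=\varprojlim(X_j,r_{j+1,j})$ is a path connected, locally path connected inverse limit of nested retracts, where each $X_j$ is a locally path connected and semilocally simply connected metric space, and let $x_0\in X_1\subset X$. Then $\pi_1^{qtop}(X,x_0)$ is $T_1$ if and only if $X$ is $\pi_1$-shape injective.
   Context: $\Omega(X,x_0)$ denotes the space of loops $[0,1]\to X$ based at $x_0$ with the compact-open topology. $\pi_1^{qtop}(X,x_0)$ is $\pi_1(X,x_0)$ endowed with the quotient topology with respect to the map $\pi:\Omega(X,x_0)\to\pi_1(X,x_0)$, $\pi(\alpha)=[\alpha]$. Inverse limit of nested retracts: let $X_1\subseteq X_2\subseteq\cdots$ be a nested sequence of subspaces where $X_j$ is a closed retract of $X_{j+1}$, i.e. there is a continuous map $r_{j+1,j}:X_{j+1}\to X_j$ with $r_{j+1,j}\circ s_{j+1,j}=id_{X_j}$, where $s_{j+1,j}:X_j\to X_{j+1}$ is the inclusion. The inverse limit $X=\varprojlim(X_j,r_{j+1,j})$ is called the inverse limit of nested retracts. For $j<k$ let $r_{k,j}:X_k\to X_j$ and $s_{k,j}:X_j\to X_k$ be the composed retractions and inclusions. The projections $r_j:X\to X_j$ are retractions with sections $s_j:X_j\to X$, $s_j(x)=(r_{j,1}(x),\dots,r_{j,j-1}(x),x,s_{j+1,j}(x),s_{j+2,j}(x),\dots)$, by which $X_j$ is viewed as a subspace of $X$; the basepoint $x_0$ is taken in $X_1\subset X$. $\pi_1$-shape injectivity (for $X$ paracompact Hausdorff): let $cov(X)$ be the set, directed by refinement, of pairs $(\mathscr{U},U_0)$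 where $\mathscr{U}$ is a locally finite open cover of $X$ and $U_0\in\mathscr{U}$ is a distinguished element containing $x_0$ (a refinement $(\mathscr{V},V_0)$ of $(\mathscr{U},U_0)$ satisfies $V_0\subseteq U_0$). Let $N(\mathscr{U})$ be the nerve of $\mathscr{U}$: the vertex set is $\mathscr{U}$, and finitely many vertices span a simplex iff their intersection is non-empty; $|N(\mathscr{U})|$ is its geometric realization. If $(\mathscr{V},V_0)$ refines $(\mathscr{U},U_0)$, a simplicial map $p_{\mathscr{U}\mathscr{V}}:|N(\mathscr{V})|\to|N(\mathscr{U})|$ is obtained by sending each vertex $V$ to some $U\in\mathscr{U}$ with $V\subseteq U$ (with $V_0\mapsto U_0$) and extending linearly; the induced homomorphism $p_{\mathscr{U}\mathscr{V}*}:\pi_1(|N(\mathscr{V})|,V_0)\to\pi_1(|N(\mathscr{U})|,U_0)$ does not depend on choices. The first shape homotopy group is $\check{\pi}_1(X,x_0)=\varprojlim(\pi_1(|N(\mathscr{U})|,U_0),p_{\mathscr{U}\mathscr{V}*},cov(X))$. Given a partition of unity $\{\phi_U\}_{U\in\mathscr{U}}$ subordinated to $\mathscr{U}$ with $\phi_{U_0}(x_0)=1$, the map $p_{\mathscr{U}}:X\to|N(\mathscr{U})|$ sends $x$ to the point whose barycentric coordinate at $U$ is $\phi_U(x)$. The induced homomorphisms $p_{\mathscr{U}*}$ on $\pi_1$ are compatible with the bonding maps and induce a canonical homomorphism $\psi:\pi_1(X,x_0)\to\check{\pi}_1(X,x_0)$. $X$ is $\pi_1$-shape injective if $\psi$ is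 injective. *)

theory Defs
  imports "HOL-Analysis.Analysis" "HOL-Algebra.Group"
begin

section \<open>Quotient and compact-open topologies\<close>

definition quotient_topology :: "'a topology \<Rightarrow> ('a \<Rightarrow> 'b) \<Rightarrow> 'b topology" where
  "quotient_topology X f =
     topology (\<lambda>U. U \<subseteq> f ` topspace X \<and> openin X {x \<in> topspace X. f x \<in> U})"

lemma openin_quotient_topology:
  "openin (quotient_topology X f) U \<longleftrightarrow>
     U \<subseteq> f ` topspace X \<and> openin X {x \<in> topspace X. f x \<in> U}"
proof -
  have "istopology (\<lambda>U. U \<subseteq> f ` topspace X \<and> openin X {x \<in> topspace X. f x \<in> U})"
    unfolding istopology_def
  proof (intro conjI allI impI)
    fix S T
    assume S: "S \<subseteq> f ` topspace X \<and> openin X {x \<in> topspace X. f x \<in> S}"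
      and T: "T \<subseteq> f ` topspace X \<and> openin X {x \<in> topspace X. f x \<in> T}"
    have "openin X ({x \<in> topspace X. f x \<in> S} \<inter> {x \<in> topspace X. f x \<in> T})"
      using S T by (intro openin_Int) blast+
    moreover have "{x \<in> topspace X. f x \<in> S} \<inter> {x \<in> topspace X. f x \<in> T} =
        {x \<in> topspace X. f x \<in> S \<inter> T}" by blast
    ultimately show "openin X {x \<in> topspace X. f x \<in> S \<inter> T}" by (rule back_subst)
    show "S \<inter> T \<subseteq> f ` topspace X" using S by blast
  next
    fix \<K>
    assume K: "\<forall>K\<in>\<K>. K \<subseteq> f ` topspace X \<and> openin X {x \<in> topspace X. f x \<in> K}"
    have "openin X (\<Union>((\<lambda>K. {x \<in> topspace X. f x \<in> K}) ` \<K>))"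
      using K by (intro openin_Union) blast
    moreover have "\<Union>((\<lambda>K. {x \<in> topspace X. f x \<in> K}) ` \<K>) = {x \<in> topspace X. f x \<in> \<Union>\<K>}"
      by blast
    ultimately show "openin X {x \<in> topspace X. f x \<in> \<Union>\<K>}" by (rule back_subst)
    show "\<Union>\<K> \<subseteq> f ` topspace X" using K by blast
  qed
  then show ?thesis
    unfolding quotient_topology_def by (simp add: topology_inverse')
qed

lemma topspace_quotient_topology: "topspace (quotient_topology X f) = f ` topspace X"
proof
  show "topspace (quotient_topology X f) \<subseteq> f ` topspace X"
    by (metis openin_quotient_topology openin_topspace)
  have "{x \<in> topspace X. f x \<in> f ` topspace X} = topspace X" by auto
  then have "openin (quotient_topology X f) (f ` topspace X)"
    by (simp add: openin_quotient_topology)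
  then show "f ` topspace X \<subseteq> topspace (quotient_topology X f)"
    by (rule openin_subset)
qed

lemma quotient_map_quotient_topology: "quotient_map X (quotient_topology X f) f"
  unfolding quotient_map_def topspace_quotient_topology openin_quotient_topology by blast

definition compact_open_topology :: "'a topology \<Rightarrow> 'b topology \<Rightarrow> ('a \<Rightarrow> 'b) topology" where
  "compact_open_topology X Y = topology_generated_by
     {{f \<in> extensional (topspace X). continuous_map X Y f \<and> f ` K \<subseteq> U} | K U.
        compactin X K \<and> openin Y U}"


section \<open>The fundamental group of an abstract topological space\<close>

text \<open>Loops are represented by functions that are undefined outside the unit interval.\<close>

definition loops :: "'a topology \<Rightarrow> 'a \<Rightarrow> (real \<Rightarrow> 'a) set" where
  "loops X x = {\<alpha> \<in> extensional {0..1}. pathin X \<alpha> \<and> \<alpha> 0 = x \<and> \<alpha> 1 = x}"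

definition loop_space :: "'a topology \<Rightarrow> 'a \<Rightarrow> (real \<Rightarrow> 'a) topology" where
  "loop_space X x = subtopology (compact_open_topology (top_of_set {0..1}) X) (loops X x)"

definition loop_homotopy :: "'a topology \<Rightarrow> 'a \<Rightarrow> ((real \<Rightarrow> 'a) \<times> (real \<Rightarrow> 'a)) set" where
  "loop_homotopy X x = {(\<alpha>, \<beta>). \<alpha> \<in> loops X x \<and> \<beta> \<in> loops X x \<and>
     homotopic_with (\<lambda>\<gamma>. \<gamma> 0 = x \<and> \<gamma> 1 = x) (top_of_set {0..1}) X \<alpha> \<beta>}"

definition loop_class :: "'a topology \<Rightarrow> 'a \<Rightarrow> (real \<Rightarrow> 'a) \<Rightarrow> (real \<Rightarrow> 'a) set" where
  "loop_class X x \<alpha> = loop_homotopy X x `` {\<alpha>}"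

definition loop_join :: "(real \<Rightarrow> 'a) \<Rightarrow> (real \<Rightarrow> 'a) \<Rightarrow> real \<Rightarrow> 'a" where
  "loop_join \<alpha> \<beta> = (\<lambda>t\<in>{0..1}. if t \<le> 1/2 then \<alpha> (2 * t) else \<beta> (2 * t - 1))"

definition fundamental_group :: "'a topology \<Rightarrow> 'a \<Rightarrow> (real \<Rightarrow> 'a) set monoid" where
  "fundamental_group X x =
     \<lparr>carrier = loops X x // loop_homotopy X x,
      mult = (\<lambda>A B. \<Union>\<alpha>\<in>A. \<Union>\<beta>\<in>B. loop_class X x (loop_join \<alpha> \<beta>)),
      one = loop_class X x (\<lambda>t\<in>{0..1}. x)\<rparr>"

text \<open>The homomorphism induced by a map \<open>h\<close>, where \<open>y\<close> is the image of the basepoint; as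
  usual for functions on a quotient, all members of the union over a class \<open>A\<close> coincide.\<close>

definition induced_hom ::
  "'b topology \<Rightarrow> 'b \<Rightarrow> ('a \<Rightarrow> 'b) \<Rightarrow> (real \<Rightarrow> 'a) set \<Rightarrow> (real \<Rightarrow> 'b) set" where
  "induced_hom Y y h A = (\<Union>\<alpha>\<in>A. loop_class Y y (compose {0..1} h \<alpha>))"

definition pi1_qtop :: "'a topology \<Rightarrow> 'a \<Rightarrow> (real \<Rightarrow> 'a) set topology" where
  "pi1_qtop X x = quotient_topology (loop_space X x) (loop_class X x)"

definition semilocally_simply_connected_space :: "'a topology \<Rightarrow> bool" where
  "semilocally_simply_connected_space X \<longleftrightarrow>
     (\<forall>x\<in>topspace X. \<exists>U. openin X U \<and> x \<in> U \<and>
        (\<forall>\<alpha>\<in>loops (subtopology X U) x. (\<alpha>, \<lambda>t\<in>{0..1}. x) \<in> loop_homotopy X x))"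


section \<open>Nerves and their geometric realizations\<close>

definition nerve :: "'a set set \<Rightarrow> 'a set set set" where
  "nerve \<U> = {\<sigma>. finite \<sigma> \<and> \<sigma> \<noteq> {} \<and> \<sigma> \<subseteq> \<U> \<and> \<Inter>\<sigma> \<noteq> {}}"

text \<open>Points of a realization are given by their barycentric coordinates.\<close>

definition closed_simplex :: "'v set \<Rightarrow> ('v \<Rightarrow> real) set" where
  "closed_simplex \<sigma> = {t. (\<forall>v. 0 \<le> t v) \<and> (\<forall>v. v \<notin> \<sigma> \<longrightarrow> t v = 0) \<and> sum t \<sigma> = 1}"

text \<open>The realization of an abstract simplicial complex \<open>K\<close> (a set of finite sets) carries the
  weak topology with respect to its closed simplices, on each of which the topology of pointwise
  convergence of the coordinates is the Euclidean one.\<close>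

definition realization :: "'v set set \<Rightarrow> ('v \<Rightarrow> real) topology" where
  "realization K = topology (\<lambda>W. W \<subseteq> (\<Union>\<sigma>\<in>K. closed_simplex \<sigma>) \<and>
     (\<forall>\<sigma>\<in>K. openin (subtopology (powertop_real UNIV) (closed_simplex \<sigma>)) (W \<inter> closed_simplex \<sigma>)))"

lemma openin_realization:
  "openin (realization K) W \<longleftrightarrow> W \<subseteq> (\<Union>\<sigma>\<in>K. closed_simplex \<sigma>) \<and>
     (\<forall>\<sigma>\<in>K. openin (subtopology (powertop_real UNIV) (closed_simplex \<sigma>)) (W \<inter> closed_simplex \<sigma>))"
proof -
  define T where "T \<sigma> = subtopology (powertop_real UNIV) (closed_simplex \<sigma>)" for \<sigma> :: "'a set"
  define B where "B = (\<Union>\<sigma>\<in>K. closed_simplex \<sigma>)"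
  have "istopology (\<lambda>W. W \<subseteq> B \<and> (\<forall>\<sigma>\<in>K. openin (T \<sigma>) (W \<inter> closed_simplex \<sigma>)))"
    unfolding istopology_def
  proof (rule conjI; (intro allI impI conjI ballI))
    fix S S' \<sigma>
    assume S: "S \<subseteq> B \<and> (\<forall>\<sigma>\<in>K. openin (T \<sigma>) (S \<inter> closed_simplex \<sigma>))"
      and S': "S' \<subseteq> B \<and> (\<forall>\<sigma>\<in>K. openin (T \<sigma>) (S' \<inter> closed_simplex \<sigma>))"
    show "S \<inter> S' \<subseteq> B" using S by blast
    assume "\<sigma> \<in> K"
    then have "openin (T \<sigma>) ((S \<inter> closed_simplex \<sigma>) \<inter> (S' \<inter> closed_simplex \<sigma>))"
      using S S' by (intro openin_Int[of "T \<sigma>" "S \<inter> closed_simplex \<sigma>"]) blast+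
    moreover have "(S \<inter> closed_simplex \<sigma>) \<inter> (S' \<inter> closed_simplex \<sigma>) = S \<inter> S' \<inter> closed_simplex \<sigma>"
      by blast
    ultimately show "openin (T \<sigma>) (S \<inter> S' \<inter> closed_simplex \<sigma>)" by (rule back_subst)
  next
    fix \<K> \<sigma>
    assume K: "\<forall>S\<in>\<K>. S \<subseteq> B \<and> (\<forall>\<sigma>\<in>K. openin (T \<sigma>) (S \<inter> closed_simplex \<sigma>))"
    show "\<Union>\<K> \<subseteq> B" using K by blast
    assume "\<sigma> \<in> K"
    then have "openin (T \<sigma>) (\<Union>((\<lambda>S. S \<inter> closed_simplex \<sigma>) ` \<K>))"
      using K by (intro openin_Union) blast
    moreover have "\<Union>((\<lambda>S. S \<inter> closed_simplex \<sigma>) ` \<K>) = \<Union>\<K> \<inter> closed_simplex \<sigma>"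
      by blast
    ultimately show "openin (T \<sigma>) (\<Union>\<K> \<inter> closed_simplex \<sigma>)" by (rule back_subst)
  qed
  then have "openin (topology (\<lambda>W. W \<subseteq> B \<and> (\<forall>\<sigma>\<in>K. openin (T \<sigma>) (W \<inter> closed_simplex \<sigma>)))) W \<longleftrightarrow>
      W \<subseteq> B \<and> (\<forall>\<sigma>\<in>K. openin (T \<sigma>) (W \<inter> closed_simplex \<sigma>))"
    by (rule topology_inverse' [THEN fun_cong])
  then show ?thesis
    unfolding realization_def T_def B_def .
qed

definition vertex :: "'v \<Rightarrow> 'v \<Rightarrow> real" where
  "vertex v = (\<lambda>u. if u = v then 1 else 0)"

text \<open>The linear extension of a vertex map \<open>f\<close>.\<close>

definition linear_extension :: "('v \<Rightarrow> 'w) \<Rightarrow> ('v \<Rightarrow> real) \<Rightarrow> 'w \<Rightarrow> real" where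
  "linear_extension f t = (\<lambda>w. \<Sum>v | t v \<noteq> 0 \<and> f v = w. t v)"


section \<open>The first shape homotopy group\<close>

definition pointed_covers :: "'a topology \<Rightarrow> 'a \<Rightarrow> ('a set set \<times> 'a set) set" where
  "pointed_covers X x = {(\<U>, U0). locally_finite_in X \<U> \<and> (\<forall>U\<in>\<U>. openin X U) \<and>
     \<Union>\<U> = topspace X \<and> U0 \<in> \<U> \<and> x \<in> U0}"

definition refines :: "'a set set \<times> 'a set \<Rightarrow> 'a set set \<times> 'a set \<Rightarrow> bool" where
  "refines = (\<lambda>(\<V>, V0) (\<U>, U0). (\<forall>V\<in>\<V>. \<exists>U\<in>\<U>. V \<subseteq> U) \<and> V0 \<subseteq> U0)"

definition nerve_group :: "'a set set \<times> 'a set \<Rightarrow> (real \<Rightarrow> 'a set \<Rightarrow> real) set monoid" where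
  "nerve_group = (\<lambda>(\<U>, U0). fundamental_group (realization (nerve \<U>)) (vertex U0))"

definition refinement_projection ::
  "'a set set \<times> 'a set \<Rightarrow> 'a set set \<times> 'a set \<Rightarrow> ('a set \<Rightarrow> 'a set) \<Rightarrow> bool" where
  "refinement_projection = (\<lambda>(\<V>, V0) (\<U>, U0) f. (\<forall>V\<in>\<V>. f V \<in> \<U> \<and> V \<subseteq> f V) \<and> f V0 = U0)"

text \<open>The bonding homomorphism for a refinement \<open>d\<close> of \<open>c\<close>. It does not depend on the
  projection chosen, as any two choices are contiguous.\<close>

definition bonding_hom :: "'a set set \<times> 'a set \<Rightarrow> 'a set set \<times> 'a set \<Rightarrow>
    (real \<Rightarrow> 'a set \<Rightarrow> real) set \<Rightarrow> (real \<Rightarrow> 'a set \<Rightarrow> real) set" where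
  "bonding_hom c d = induced_hom (realization (nerve (fst c))) (vertex (snd c))
     (linear_extension (SOME f. refinement_projection d c f))"

definition shape_group ::
  "'a topology \<Rightarrow> 'a \<Rightarrow> ('a set set \<times> 'a set \<Rightarrow> (real \<Rightarrow> 'a set \<Rightarrow> real) set) monoid" where
  "shape_group X x =
     \<lparr>carrier = {g \<in> \<Pi>\<^sub>E c\<in>pointed_covers X x. carrier (nerve_group c).
        \<forall>c\<in>pointed_covers X x. \<forall>d\<in>pointed_covers X x. refines d c \<longrightarrow> bonding_hom c d (g d) = g c},
      mult = (\<lambda>g h. \<lambda>c\<in>pointed_covers X x. g c \<otimes>\<^bsub>nerve_group c\<^esub> h c),
      one = (\<lambda>c\<in>pointed_covers X x. \<one>\<^bsub>nerve_group c\<^esub>)\<rparr>"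

definition pointed_partition_of_unity ::
  "'a topology \<Rightarrow> 'a \<Rightarrow> 'a set set \<times> 'a set \<Rightarrow> ('a set \<Rightarrow> 'a \<Rightarrow> real) \<Rightarrow> bool" where
  "pointed_partition_of_unity X x = (\<lambda>(\<U>, U0) \<phi>.
     (\<forall>U\<in>\<U>. continuous_map X euclideanreal (\<phi> U) \<and> (\<forall>y\<in>topspace X. 0 \<le> \<phi> U y) \<and>
        Abstract_Topology.closure_of X {y \<in> topspace X. \<phi> U y \<noteq> 0} \<subseteq> U) \<and>
     (\<forall>y\<in>topspace X. (\<Sum>U\<in>{U \<in> \<U>. \<phi> U y \<noteq> 0}. \<phi> U y) = 1) \<and>
     \<phi> U0 x = 1)"

definition nerve_map :: "'a set set \<Rightarrow> ('a set \<Rightarrow> 'a \<Rightarrow> real) \<Rightarrow> 'a \<Rightarrow> 'a set \<Rightarrow> real" where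
  "nerve_map \<U> \<phi> y = (\<lambda>U. if U \<in> \<U> then \<phi> U y else 0)"

text \<open>On a paracompact Hausdorff space every pointed cover has a pointed partition of unity, and
  the homomorphism induced by the map into the nerve does not depend on it.\<close>

definition shape_hom :: "'a topology \<Rightarrow> 'a \<Rightarrow>
    (real \<Rightarrow> 'a) set \<Rightarrow> 'a set set \<times> 'a set \<Rightarrow> (real \<Rightarrow> 'a set \<Rightarrow> real) set" where
  "shape_hom X x A = (\<lambda>c\<in>pointed_covers X x.
     induced_hom (realization (nerve (fst c))) (vertex (snd c))
       (nerve_map (fst c) (SOME \<phi>. pointed_partition_of_unity X x c \<phi>)) A)"

definition pi1_shape_injective :: "'a topology \<Rightarrow> 'a \<Rightarrow> bool" where
  "pi1_shape_injective X x \<longleftrightarrow> shape_hom X x \<in> mon (fundamental_group X x) (shape_group X x)"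


section \<open>Inverse limits of nested retracts\<close>

text \<open>The sequences are indexed from 0, and \<open>r j\<close> retracts \<open>X (Suc j)\<close> onto \<open>X j\<close>.\<close>

definition nested_retracts :: "(nat \<Rightarrow> 'a topology) \<Rightarrow> (nat \<Rightarrow> 'a \<Rightarrow> 'a) \<Rightarrow> bool" where
  "nested_retracts X r \<longleftrightarrow>
     (\<forall>j. closedin (X (Suc j)) (topspace (X j)) \<and>
          X j = subtopology (X (Suc j)) (topspace (X j)) \<and>
          retraction_maps (X (Suc j)) (X j) (r j) id)"

definition inverse_limit :: "(nat \<Rightarrow> 'a topology) \<Rightarrow> (nat \<Rightarrow> 'a \<Rightarrow> 'a) \<Rightarrow> (nat \<Rightarrow> 'a) topology" where
  "inverse_limit X r = subtopology (product_topology X UNIV) {x. \<forall>j. r j (x (Suc j)) = x j}"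

text \<open>The section of the projection onto the \<open>j\<close>-th space: coordinates below \<open>j\<close> are obtained
  by retracting, the others by including.\<close>

definition limit_section :: "(nat \<Rightarrow> 'a \<Rightarrow> 'a) \<Rightarrow> nat \<Rightarrow> 'a \<Rightarrow> nat \<Rightarrow> 'a" where
  "limit_section r j x = (\<lambda>k. fold r (rev [k..<j]) x)"

end

theory Submission
  imports Defs
begin

text \<open>If \<open>\<gamma>\<close> is a loop in the limit all of whose projections \<open>\<pi>\<^sub>j \<circ> \<gamma>\<close> are null-homotopic, then so are
  the loops \<open>s\<^sub>j \<circ> \<pi>\<^sub>j \<circ> \<gamma>\<close>, which converge to \<open>\<gamma>\<close> in the compact-open topology; when points of the
  fundamental group are closed, \<open>\<gamma>\<close> is therefore null-homotopic. So an essential loop has an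
  essential projection to some \<open>X\<^sub>j\<close>. As \<open>X\<^sub>j\<close> is metrizable, locally path connected and
  semilocally simply connected, a null-homotopy in the nerve of the preimage of a fine cover of
  \<open>X\<^sub>j\<close> can be lifted to \<open>X\<^sub>j\<close>; hence such a nerve detects the loop. Conversely, the homotopy class of
  the image of a loop in a nerve is locally constant on the loop space, so that loops which are
  separated by the nerves represent classes that are closed points.\<close>

section \<open>Paths in abstract topological spaces\<close>

text \<open>Members of a cover of the limit need not be path connected, so a null-homotopy in the
  nerve offers no paths in the limit itself, only in some \<open>X j\<close>. There each member
  \<open>U\<close> gets three sets: a path connected \<open>P U\<close> containing the projection of
  \<open>U\<close>, a path connected \<open>C U\<close> containing \<open>P V\<close> whenever
  \<open>V\<close> meets \<open>U\<close>, and \<open>D U\<close>, which contains \<open>C V\<close>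
  for all such \<open>V\<close> and in which paths with common endpoints are homotopic. The two
  enlargements are two successive star refinements: the first lets points of consecutive rows of
  squares be joined, the second lets a joining path lie in both squares beside it. Star refinements,
  locally finite covers and partitions of unity are all built from a metric, which the limit has as
  a subspace of a countable product. In the weak topology of a nerve continuous coordinates alone do
  not make a map continuous; local finiteness makes up for this. As \<open>shape_hom\<close> uses an
  arbitrarily chosen partition of unity, detection of loops is proved for every partition.\<close>

definition path_homotopic :: "'a topology \<Rightarrow> (real \<Rightarrow> 'a) \<Rightarrow> (real \<Rightarrow> 'a) \<Rightarrow> bool" where
  "path_homotopic X p q \<longleftrightarrow>
     homotopic_with (\<lambda>\<gamma>. \<gamma> 0 = p 0 \<and> \<gamma> 1 = p 1) (top_of_set {0..1}) X p q"

text \<open>Unlike \<open>loop_join\<close> this is not restricted to the unit interval, which keeps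
  composition with maps simple. Values outside \<open>{0..1}\<close> are irrelevant by
  \<open>path_homotopic_cong\<close>; restriction enters only where membership in
  \<open>loops\<close> is wanted.\<close>

definition path_join :: "(real \<Rightarrow> 'a) \<Rightarrow> (real \<Rightarrow> 'a) \<Rightarrow> real \<Rightarrow> 'a" where
  "path_join p q = (\<lambda>t. if t \<le> 1/2 then p (2 * t) else q (2 * t - 1))"

definition path_rev :: "(real \<Rightarrow> 'a) \<Rightarrow> real \<Rightarrow> 'a" where
  "path_rev p = (\<lambda>t. p (1 - t))"

definition path_segment :: "real \<Rightarrow> real \<Rightarrow> (real \<Rightarrow> 'a) \<Rightarrow> real \<Rightarrow> 'a" where
  "path_segment a b p = (\<lambda>t. p (a + (b - a) * t))"

lemma path_join_endpoints [simp]: "path_join p q 0 = p 0" "path_join p q 1 = q 1"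
  by (auto simp: path_join_def)

lemma path_rev_endpoints [simp]: "path_rev p 0 = p 1" "path_rev p 1 = p 0"
  by (auto simp: path_rev_def)

lemma path_segment_endpoints [simp]: "path_segment a b p 0 = p a" "path_segment a b p 1 = p b"
  by (auto simp: path_segment_def)

section \<open>Homotopy of paths relative to the endpoints\<close>

lemma path_homotopic_iff:
  "path_homotopic X p q \<longleftrightarrow>
     (\<exists>h. continuous_map (top_of_set ({0..1::real} \<times> {0..1})) X h \<and>
        (\<forall>t\<in>{0..1}. h (0, t) = p t \<and> h (1, t) = q t) \<and>
        (\<forall>s\<in>{0..1}. h (s, 0) = p 0 \<and> h (s, 1) = p 1))"
  unfolding path_homotopic_def by (subst homotopic_with) (simp_all add: ball_conj_distrib conj_assoc)

lemma path_homotopic_imp_pathin: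
  assumes "path_homotopic X p q"
  shows "pathin X p" "pathin X q"
  using homotopic_with_imp_continuous_maps assms unfolding path_homotopic_def pathin_def by blast+

lemma path_homotopic_endpoints:
  assumes "path_homotopic X p q"
  shows "q 0 = p 0" "q 1 = p 1"
  using homotopic_with_imp_property assms unfolding path_homotopic_def by blast+

lemma path_homotopic_refl: "pathin X p \<Longrightarrow> path_homotopic X p p"
  by (simp add: path_homotopic_def pathin_def)

lemma path_homotopic_sym: "path_homotopic X p q \<Longrightarrow> path_homotopic X q p"
  using path_homotopic_endpoints[of X p q]
  by (simp add: path_homotopic_def homotopic_with_symD)

lemma path_homotopic_trans [trans]:
  "path_homotopic X p q \<Longrightarrow> path_homotopic X q u \<Longrightarrow> path_homotopic X p u"
  using path_homotopic_endpoints[of X p q]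
  by (auto simp: path_homotopic_def intro: homotopic_with_trans)

lemma path_homotopic_cong:
  assumes "\<And>t. t \<in> {0..1} \<Longrightarrow> p t = p' t" "\<And>t. t \<in> {0..1} \<Longrightarrow> q t = q' t"
  shows "path_homotopic X p q \<longleftrightarrow> path_homotopic X p' q'"
proof -
  have "p 0 = p' 0" "p 1 = p' 1" using assms(1) by auto
  with assms show ?thesis unfolding path_homotopic_iff by (simp del: atLeastAtMost_iff cong: conj_cong ball_cong)
qed

lemma path_homotopic_compose:
  assumes "path_homotopic X p q" "continuous_map X Y f"
  shows "path_homotopic Y (f \<circ> p) (f \<circ> q)"
  using homotopic_with_compose_continuous_map_left assms unfolding path_homotopic_def by fastforce

text \<open>Both paths factor through the same map \<open>g\<close>, and the straight-line homotopy
  between the parameters \<open>f\<close> and \<open>f'\<close> stays in the convex set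
  \<open>S\<close>. The associativity, unit, inverse and subdivision laws below are all
  instances.\<close>

lemma path_homotopic_reparam:
  fixes S :: "real set" and f f' :: "real \<Rightarrow> real"
  assumes g: "continuous_map (top_of_set S) X g" and S: "convex S"
    and cf: "continuous_on {0..1} f" "continuous_on {0..1} f'"
      "\<And>t. t \<in> {0..1} \<Longrightarrow> f t \<in> S" "\<And>t. t \<in> {0..1} \<Longrightarrow> f' t \<in> S"
    and ends: "f 0 = f' 0" "f 1 = f' 1"
    and eq: "\<And>t. t \<in> {0..1} \<Longrightarrow> p t = g (f t)" "\<And>t. t \<in> {0..1} \<Longrightarrow> q t = g (f' t)"
  shows "path_homotopic X p q"
proof -
  define k where "k = (\<lambda>(s, t). (1 - s) * f t + s * f' t)"
  have "continuous_on ({0..1} \<times> {0..1}) k"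
    unfolding k_def case_prod_unfold
    by (intro continuous_intros continuous_on_compose2[OF cf(1)] continuous_on_compose2[OF cf(2)]) auto
  moreover have "k ` ({0..1} \<times> {0..1}) \<subseteq> S"
    using convexD_alt[OF S, unfolded real_scaleR_def] cf(3,4) by (fastforce simp: k_def)
  ultimately have k: "continuous_map (top_of_set ({0..1} \<times> {0..1})) (top_of_set S) k"
    by (simp add: image_subset_iff_funcset)
  have "continuous_map (top_of_set ({0..1} \<times> {0..1})) X (g \<circ> k)"
    using continuous_map_compose[OF k g] .
  moreover have "(1 - s) * f' 0 + s * f' 0 = f' 0" "(1 - s) * f' 1 + s * f' 1 = f' 1" for s :: real
    by (simp_all add: algebra_simps)
  ultimately show ?thesis
    unfolding path_homotopic_iff
    by (intro exI[of _ "g \<circ> k"]) (auto simp: k_def eq ends)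
qed

lemma path_homotopic_join:
  assumes p: "path_homotopic X p p'" and q: "path_homotopic X q q'" and pq: "p 1 = q 0"
  shows "path_homotopic X (path_join p q) (path_join p' q')"
proof -
  let ?I = "{0..1::real} \<times> {0..1::real}"
  obtain h1 where h1: "continuous_map (top_of_set ?I) X h1"
    "\<forall>t\<in>{0..1}. h1 (0, t) = p t \<and> h1 (1, t) = p' t" "\<forall>s\<in>{0..1}. h1 (s, 0) = p 0 \<and> h1 (s, 1) = p 1"
    using p unfolding path_homotopic_iff by blast
  obtain h2 where h2: "continuous_map (top_of_set ?I) X h2"
    "\<forall>t\<in>{0..1}. h2 (0, t) = q t \<and> h2 (1, t) = q' t" "\<forall>s\<in>{0..1}. h2 (s, 0) = q 0 \<and> h2 (s, 1) = q 1"
    using q unfolding path_homotopic_iff by blast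
  define h where "h = (\<lambda>x. if snd x \<le> 1/2 then (h1 \<circ> (\<lambda>x. (fst x, 2 * snd x))) x
    else (h2 \<circ> (\<lambda>x. (fst x, 2 * snd x - 1))) x)"
  have 1: "continuous_map (subtopology (top_of_set ?I) {x \<in> topspace (top_of_set ?I). snd x \<le> 1/2}) X
      (h1 \<circ> (\<lambda>x. (fst x, 2 * snd x)))"
    by (rule continuous_map_compose[OF _ h1(1)])
      (auto simp: subtopology_subtopology intro!: continuous_intros)
  have 2: "continuous_map (subtopology (top_of_set ?I) {x \<in> topspace (top_of_set ?I). 1/2 \<le> snd x}) X
      (h2 \<circ> (\<lambda>x. (fst x, 2 * snd x - 1)))"
    by (rule continuous_map_compose[OF _ h2(1)])
      (auto simp: subtopology_subtopology intro!: continuous_intros)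
  have "continuous_map (top_of_set ?I) X h"
    unfolding h_def
  proof (rule continuous_map_cases_le[OF _ _ 1 2])
    fix x assume x: "x \<in> topspace (top_of_set ?I)" "snd x = 1/2"
    then have "2 * snd x = 1" "2 * snd x - 1 = 0" "fst x \<in> {0..1}" by auto
    then show "(h1 \<circ> (\<lambda>x. (fst x, 2 * snd x))) x = (h2 \<circ> (\<lambda>x. (fst x, 2 * snd x - 1))) x"
      using h1(3) h2(3) pq by simp
  qed (auto intro!: continuous_intros)
  moreover have "h (0, t) = path_join p q t \<and> h (1, t) = path_join p' q' t" if "t \<in> {0..1}" for t
    using that h1(2) h2(2) by (auto simp: h_def path_join_def)
  moreover have "h (s, 0) = path_join p q 0 \<and> h (s, 1) = path_join p q 1" if "s \<in> {0..1}" for s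
    using that h1(3) h2(3) by (auto simp: h_def path_join_def)
  ultimately show ?thesis
    unfolding path_homotopic_iff by blast
qed

text \<open>Continuity of the concatenation is a by-product of gluing homotopies: each path is
  homotopic to itself, and homotopic maps are continuous.\<close>

lemma pathin_join: "pathin X p \<Longrightarrow> pathin X q \<Longrightarrow> p 1 = q 0 \<Longrightarrow> pathin X (path_join p q)"
  by (meson path_homotopic_imp_pathin(1) path_homotopic_join path_homotopic_refl)

lemma pathin_reparam:
  assumes "pathin X p" "continuous_on {0..1} f" "\<And>t. t \<in> {0..1} \<Longrightarrow> f t \<in> {0..1}"
  shows "pathin X (p \<circ> f)"
proof -
  have "continuous_map (top_of_set {0..1}) (top_of_set {0..1}) f"
    using assms(2,3) by auto
  then show ?thesis
    using assms(1) unfolding pathin_def by (rule continuous_map_compose)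
qed

lemma pathin_rev: "pathin X p \<Longrightarrow> pathin X (path_rev p)"
  using pathin_reparam[of X p "\<lambda>t. 1 - t"] by (simp add: path_rev_def o_def continuous_intros)

lemma segment_parameter_bounds:
  fixes a b t :: real
  assumes "a \<in> {0..1}" "b \<in> {0..1}" "t \<in> {0..1}"
  shows "a + (b - a) * t \<in> {0..1}"
proof -
  have "(1 - t) *\<^sub>R a + t *\<^sub>R b \<in> {0..1}"
    using assms convexD_alt[of "{0..1::real}" a b t] by auto
  then show ?thesis by (simp add: algebra_simps)
qed

lemma pathin_segment:
  "pathin X p \<Longrightarrow> a \<in> {0..1} \<Longrightarrow> b \<in> {0..1} \<Longrightarrow> pathin X (path_segment a b p)"
  using pathin_reparam[of X p "\<lambda>t. a + (b - a) * t"] segment_parameter_bounds[of a b]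
  by (simp add: path_segment_def o_def continuous_intros)

lemma continuous_on_if_le:
  fixes f g :: "real \<Rightarrow> real"
  assumes "continuous_on UNIV f" "continuous_on UNIV g" "f c = g c"
  shows "continuous_on S (\<lambda>t. if t \<le> c then f t else g t)"
proof (rule continuous_on_subset)
  show "continuous_on UNIV (\<lambda>t. if t \<le> c then f t else g t)"
    by (rule continuous_on_cases_le)
      (use assms in \<open>auto intro: continuous_on_subset continuous_intros\<close>)
qed simp

section \<open>Groupoid laws up to homotopy\<close>

lemma path_homotopic_assoc:
  assumes "pathin X p" "pathin X q" "pathin X u" "p 1 = q 0" "q 1 = u 0"
  shows "path_homotopic X (path_join p (path_join q u)) (path_join (path_join p q) u)"
proof (rule path_homotopic_reparam)
  \<comment> \<open>The break points 1/2 and 3/4 of \<open>path_join p (path_join q u)\<close> are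
    sent to the break points 1/4 and 1/2 of \<open>path_join (path_join p q) u\<close>, linearly in
    between.\<close>
  define f :: "real \<Rightarrow> real"
    where "f = (\<lambda>t. if t \<le> 1/2 then t / 2 else if t \<le> 3/4 then t - 1/4 else 2 * t - 1)"
  show "continuous_map (top_of_set {0..1}) X (path_join (path_join p q) u)"
    using assms pathin_join[of X "path_join p q" u] pathin_join[of X p q] by (simp add: pathin_def)
  show "continuous_on {0..1} f" unfolding f_def
    by (intro continuous_on_if_le continuous_intros) (simp_all add: continuous_intros)
  show "\<And>t. t \<in> {0..1} \<Longrightarrow> f t \<in> {0..1}" "f 0 = id 0" "f 1 = id 1"
    by (auto simp: f_def)
  fix t :: real assume t: "t \<in> {0..1}"
  consider "t \<le> 1/2" | "1/2 < t" "t \<le> 3/4" | "3/4 < t" by linarith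
  then show "path_join p (path_join q u) t = path_join (path_join p q) u (f t)"
    by cases (auto simp: path_join_def f_def)
qed (auto intro: continuous_on_id)

lemma path_homotopic_join_const:
  assumes "pathin X p" "\<And>t. t \<in> {0..1} \<Longrightarrow> c t = p 1"
  shows "path_homotopic X (path_join p c) p"
proof (rule path_homotopic_reparam[where g = p and f = "\<lambda>t. min 1 (2 * t)" and f' = id])
  show "continuous_map (top_of_set {0..1}) X p" using assms by (simp add: pathin_def)
  show "\<And>t. t \<in> {0..1} \<Longrightarrow> path_join p c t = p (min 1 (2 * t))"
    using assms(2) by (auto simp: path_join_def min_def intro!: arg_cong[where f = p])
qed (auto intro!: continuous_intros continuous_on_id)

lemma path_homotopic_const_join:
  assumes "pathin X p" "\<And>t. t \<in> {0..1} \<Longrightarrow> c t = p 0"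
  shows "path_homotopic X (path_join c p) p"
proof (rule path_homotopic_reparam[where g = p and f = "\<lambda>t. max 0 (2 * t - 1)" and f' = id])
  show "continuous_map (top_of_set {0..1}) X p" using assms by (simp add: pathin_def)
  show "\<And>t. t \<in> {0..1} \<Longrightarrow> path_join c p t = p (max 0 (2 * t - 1))"
    using assms(2) by (auto simp: path_join_def max_def intro!: arg_cong[where f = p])
qed (auto intro!: continuous_intros continuous_on_id)

text \<open>Going out along \<open>p\<close> and back again factors through a tent function on the
  unit interval, and the tent is contracted to 0.\<close>

lemma path_homotopic_join_rev:
  assumes "pathin X p"
  shows "path_homotopic X (path_join p (path_rev p)) (\<lambda>t. p 0)"
proof (rule path_homotopic_reparam[where g = p and f = "\<lambda>t. min (2 * t) (2 - 2 * t)" and f' = "\<lambda>t. 0"])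
  show "continuous_map (top_of_set {0..1}) X p" using assms by (simp add: pathin_def)
  show "\<And>t. t \<in> {0..1} \<Longrightarrow> path_join p (path_rev p) t = p (min (2 * t) (2 - 2 * t))"
    by (auto simp: path_join_def path_rev_def min_def algebra_simps)
qed (auto intro!: continuous_intros)

lemma path_homotopic_rev_join:
  assumes "pathin X p"
  shows "path_homotopic X (path_join (path_rev p) p) (\<lambda>t. p 1)"
  using path_homotopic_join_rev[OF pathin_rev[OF assms]] by (simp add: path_rev_def)

lemma path_homotopic_cancel_left:
  assumes "pathin X k" "pathin X p" "k 1 = p 0"
  shows "path_homotopic X (path_join (path_rev k) (path_join k p)) p"
proof -
  have "path_homotopic X (path_join (path_rev k) (path_join k p)) (path_join (path_join (path_rev k) k) p)"
    using assms by (intro path_homotopic_assoc pathin_rev) auto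
  also have "path_homotopic X \<dots> (path_join (\<lambda>t. k 1) p)"
    using assms by (intro path_homotopic_join path_homotopic_rev_join path_homotopic_refl) auto
  also have "path_homotopic X \<dots> p"
    using assms by (intro path_homotopic_const_join) auto
  finally show ?thesis .
qed

text \<open>Insert \<open>path_join (path_rev q) q\<close> behind \<open>p\<close> and rebracket.
  This turns null-homotopies of loops into homotopies between two paths.\<close>

lemma path_homotopic_if_join_rev_null:
  assumes p: "pathin X p" and q: "pathin X q" and pq: "p 0 = q 0" "p 1 = q 1"
    and null: "path_homotopic X (path_join p (path_rev q)) (\<lambda>t. p 0)"
  shows "path_homotopic X p q"
proof -
  have "path_homotopic X p (path_join p (\<lambda>t. q 1))"
    using p pq by (intro path_homotopic_sym[OF path_homotopic_join_const]) auto
  also have "path_homotopic X \<dots> (path_join p (path_join (path_rev q) q))"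
    using p q pq
    by (intro path_homotopic_join path_homotopic_sym[OF path_homotopic_rev_join] path_homotopic_refl) auto
  also have "path_homotopic X \<dots> (path_join (path_join p (path_rev q)) q)"
    using p q pq by (intro path_homotopic_assoc pathin_rev) auto
  also have "path_homotopic X \<dots> (path_join (\<lambda>t. p 0) q)"
    using p q pq by (intro path_homotopic_join null path_homotopic_refl) auto
  also have "path_homotopic X \<dots> q"
    using q pq by (intro path_homotopic_const_join) auto
  finally show ?thesis .
qed

lemma path_homotopic_join_segments:
  assumes p: "pathin X p" and "a \<in> {0..1}" "b \<in> {0..1}" "c \<in> {0..1}"
  shows "path_homotopic X (path_join (path_segment a b p) (path_segment b c p)) (path_segment a c p)"
proof (rule path_homotopic_reparam)
  define f where "f = (\<lambda>t. if t \<le> 1/2 then a + (b - a) * (2 * t) else b + (c - b) * (2 * t - 1))"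
  show "continuous_map (top_of_set {0..1}) X p" using p by (simp add: pathin_def)
  show "continuous_on {0..1} f" unfolding f_def
    by (intro continuous_on_if_le) (auto intro!: continuous_intros)
  show "f t \<in> {0..1}" if "t \<in> {0..1}" for t
    unfolding f_def using that assms segment_parameter_bounds[of a b "2 * t"]
      segment_parameter_bounds[of b c "2 * t - 1"] by auto
  show "\<And>t. t \<in> {0..1} \<Longrightarrow> a + (c - a) * t \<in> {0..1}"
    using assms segment_parameter_bounds by blast
  show "path_join (path_segment a b p) (path_segment b c p) t = p (f t)" for t
    by (auto simp: f_def path_join_def path_segment_def)
  show "path_segment a c p t = p (a + (c - a) * t)" for t
    by (simp add: path_segment_def)
  show "f 0 = a + (c - a) * 0" "f 1 = a + (c - a) * 1" by (auto simp: f_def)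
qed (auto intro!: continuous_intros)

text \<open>Only the paths are confined to \<open>D\<close>; the homotopy may use all of
  \<open>X\<close>. This is the form of semilocal simple connectedness that lets one side of a
  square be traded for the other three, with no base point prescribed.\<close>

definition paths_homotopic_within :: "'a topology \<Rightarrow> 'a set \<Rightarrow> bool" where
  "paths_homotopic_within X D \<longleftrightarrow>
     (\<forall>p q. pathin X p \<and> pathin X q \<and> p ` {0..1} \<subseteq> D \<and> q ` {0..1} \<subseteq> D \<and> p 0 = q 0 \<and> p 1 = q 1
        \<longrightarrow> path_homotopic X p q)"

lemma paths_homotopic_withinD:
  assumes "paths_homotopic_within X D" "pathin X p" "pathin X q" "p ` {0..1} \<subseteq> D" "q ` {0..1} \<subseteq> D"
    "p 0 = q 0" "p 1 = q 1"
  shows "path_homotopic X p q"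
  using assms unfolding paths_homotopic_within_def by blast

lemma path_join_image_subset:
  assumes "p ` {0..1} \<subseteq> D" "q ` {0..1} \<subseteq> D"
  shows "path_join p q ` {0..1} \<subseteq> D"
  using assms by (auto simp: path_join_def image_subset_iff)

lemma path_rev_image_subset: "p ` {0..1} \<subseteq> D \<Longrightarrow> path_rev p ` {0..1} \<subseteq> D"
  by (auto simp: path_rev_def image_subset_iff)

text \<open>A path \<open>k\<close> inside \<open>D\<close> from \<open>x\<close> to the common
  start of \<open>p\<close> and \<open>q\<close> turns them into a loop at \<open>x\<close>, out
  along \<open>k\<close> and \<open>p\<close> and back along \<open>q\<close> and \<open>k\<close>.
  This loop stays in \<open>D\<close>, so it is null-homotopic, and \<open>k\<close> can be
  cancelled.\<close>

lemma paths_homotopic_within_if_loops_null: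
  assumes D: "path_connectedin X D" and x: "x \<in> D"
    and null: "\<And>\<alpha>. \<alpha> \<in> loops (subtopology X D) x \<Longrightarrow> path_homotopic X \<alpha> (\<lambda>t. x)"
  shows "paths_homotopic_within X D"
  unfolding paths_homotopic_within_def
proof (intro allI impI, elim conjE)
  fix p q
  assume p: "pathin X p" "p ` {0..1} \<subseteq> D" and q: "pathin X q" "q ` {0..1} \<subseteq> D"
    and pq: "p 0 = q 0" "p 1 = q 1"
  have "p 0 \<in> D" using p(2) by auto
  then obtain k where k: "pathin X k" "k ` {0..1} \<subseteq> D" "k 0 = x" "k 1 = p 0"
    using D x unfolding path_connectedin image_subset_iff_funcset by blast
  let ?l = "path_join (path_join k p) (path_rev (path_join k q))"
  have l: "pathin X ?l" using p q k pq by (intro pathin_join pathin_rev) auto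
  have lD: "?l ` {0..1} \<subseteq> D"
    using p q k by (intro path_join_image_subset path_rev_image_subset) auto
  have "pathin X (restrict ?l {0..1})"
    using l unfolding pathin_def by (rule continuous_map_eq) auto
  then have "restrict ?l {0..1} \<in> loops (subtopology X D) x"
    using lD k unfolding loops_def pathin_subtopology by (simp add: image_subset_iff)
  then have "path_homotopic X (restrict ?l {0..1}) (\<lambda>t. x)" by (rule null)
  then have "path_homotopic X ?l (\<lambda>t. path_join k p 0)"
    using path_homotopic_cong[of "restrict ?l {0..1}" ?l "\<lambda>t. x" "\<lambda>t. x" X] k by simp
  then have kpq: "path_homotopic X (path_join k p) (path_join k q)"
    by (rule path_homotopic_if_join_rev_null[rotated 4])
      (use p q k pq in \<open>auto intro!: pathin_join\<close>)
  have "path_homotopic X p (path_join (path_rev k) (path_join k p))"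
    using p k by (intro path_homotopic_sym[OF path_homotopic_cancel_left]) auto
  also have "path_homotopic X \<dots> (path_join (path_rev k) (path_join k q))"
    using p k by (intro path_homotopic_join kpq path_homotopic_refl pathin_rev) auto
  also have "path_homotopic X \<dots> q"
    using q k pq by (intro path_homotopic_cancel_left) auto
  finally show "path_homotopic X p q" .
qed

text \<open>The induction step replaces one side of a square in \<open>D i\<close> by the three others.\<close>

lemma path_homotopic_ladder:
  fixes \<kappa> :: "nat \<Rightarrow> real \<Rightarrow> 'a"
  assumes a: "pathin X a" and b: "pathin X b"
    and s: "\<And>i. i \<le> n \<Longrightarrow> s i \<in> {0..1}" "s 0 = 0" "\<And>i. i < n \<Longrightarrow> s i \<le> s (Suc i)"
    and aD: "\<And>i. i < n \<Longrightarrow> a ` {s i..s (Suc i)} \<subseteq> D i"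
    and bD: "\<And>i. i < n \<Longrightarrow> b ` {s i..s (Suc i)} \<subseteq> D i"
    and D: "\<And>i. i < n \<Longrightarrow> paths_homotopic_within X (D i)"
    and k: "\<And>i. i \<le> n \<Longrightarrow> pathin X (\<kappa> i)" "\<And>i. i \<le> n \<Longrightarrow> \<kappa> i 0 = a (s i)"
      "\<And>i. i \<le> n \<Longrightarrow> \<kappa> i 1 = b (s i)"
    and kD: "\<And>i. i < n \<Longrightarrow> \<kappa> i ` {0..1} \<subseteq> D i" "\<And>i. i < n \<Longrightarrow> \<kappa> (Suc i) ` {0..1} \<subseteq> D i"
  shows "path_homotopic X (path_join (path_segment 0 (s n) a) (\<kappa> n))
           (path_join (\<kappa> 0) (path_segment 0 (s n) b))"
proof -
  have "path_homotopic X (path_join (path_segment 0 (s i) a) (\<kappa> i))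
           (path_join (\<kappa> 0) (path_segment 0 (s i) b))" if "i \<le> n" for i
    using that
  proof (induction i)
    case 0
    have "path_homotopic X (path_join (path_segment 0 0 a) (\<kappa> 0)) (\<kappa> 0)"
      using k[of 0] s by (intro path_homotopic_const_join) (auto simp: path_segment_def)
    also have "path_homotopic X \<dots> (path_join (\<kappa> 0) (path_segment 0 0 b))"
      using k[of 0] s
      by (intro path_homotopic_sym[OF path_homotopic_join_const]) (auto simp: path_segment_def)
    finally show ?case using s by simp
  next
    case (Suc i)
    let ?a = "path_segment 0 (s i) a" and ?a' = "path_segment (s i) (s (Suc i)) a"
    let ?b = "path_segment 0 (s i) b" and ?b' = "path_segment (s i) (s (Suc i)) b"
    note I = s(1)[of i] s(1)[of "Suc i"] s(1)[of 0] s(2) k[of i] k[of "Suc i"] k[of 0]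
    have P: "pathin X ?a" "pathin X ?a'" "pathin X ?b" "pathin X ?b'"
      using Suc.prems I by (auto intro!: pathin_segment a b)
    have seg: "path_segment (s i) (s (Suc i)) c ` {0..1} \<subseteq> D i" if "c ` {s i..s (Suc i)} \<subseteq> D i" for c
    proof -
      have "s i + (s (Suc i) - s i) * t \<in> {s i..s (Suc i)}" if "t \<in> {0..1}" for t
        using s(3)[of i] Suc.prems that mult_left_le[of t "s (Suc i) - s i"] by auto
      then show ?thesis using that by (auto simp: path_segment_def)
    qed
    have "path_homotopic X (path_join (path_segment 0 (s (Suc i)) a) (\<kappa> (Suc i)))
        (path_join (path_join ?a ?a') (\<kappa> (Suc i)))"
      using Suc.prems I
      by (intro path_homotopic_join path_homotopic_sym[OF path_homotopic_join_segments] a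
          path_homotopic_refl) auto
    also have "path_homotopic X \<dots> (path_join ?a (path_join ?a' (\<kappa> (Suc i))))"
      using Suc.prems I P by (intro path_homotopic_sym[OF path_homotopic_assoc]) auto
    also have "path_homotopic X \<dots> (path_join ?a (path_join (\<kappa> i) ?b'))"
    proof (rule path_homotopic_join[OF path_homotopic_refl[OF P(1)]])
      show "path_homotopic X (path_join ?a' (\<kappa> (Suc i))) (path_join (\<kappa> i) ?b')"
        using Suc.prems I P seg aD[of i] bD[of i] kD[of i]
        by (intro paths_homotopic_withinD[OF D[of i]] path_join_image_subset pathin_join) auto
    qed (use Suc.prems I in simp)
    also have "path_homotopic X \<dots> (path_join (path_join ?a (\<kappa> i)) ?b')"
      using Suc.prems I P by (intro path_homotopic_assoc) auto
    also have "path_homotopic X \<dots> (path_join (path_join (\<kappa> 0) ?b) ?b')"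
      using Suc.prems I P by (intro path_homotopic_join path_homotopic_refl Suc.IH) auto
    also have "path_homotopic X \<dots> (path_join (\<kappa> 0) (path_join ?b ?b'))"
      using Suc.prems I P by (intro path_homotopic_sym[OF path_homotopic_assoc]) auto
    also have "path_homotopic X \<dots> (path_join (\<kappa> 0) (path_segment 0 (s (Suc i)) b))"
      using Suc.prems I P
      by (intro path_homotopic_join path_homotopic_join_segments b path_homotopic_refl) auto
    finally show ?case .
  qed
  then show ?thesis by simp
qed

text \<open>The path is built on \<open>{0..real n}\<close>, spending one unit interval on each set
  of the chain, so that pasting happens at integers; it is rescaled to the unit interval only at the
  end.\<close>

lemma ex_path_through_chain:
  fixes z :: "nat \<Rightarrow> 'a"
  assumes "0 < n" and C: "\<And>i. i < n \<Longrightarrow> path_connectedin X (C i)"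
    and z: "\<And>i. i < n \<Longrightarrow> z i \<in> C i" "\<And>i. i < n \<Longrightarrow> z (Suc i) \<in> C i"
  obtains p where "pathin X p" "p 0 = z 0" "p 1 = z n"
    "\<And>i. i < n \<Longrightarrow> p ` {real i / real n..real (Suc i) / real n} \<subseteq> C i"
proof -
  have "\<exists>p. continuous_map (top_of_set {0..real k}) X p \<and> p 0 = z 0 \<and> p (real k) = z k \<and>
      (\<forall>i<k. p ` {real i..real (Suc i)} \<subseteq> C i)" if "k \<le> n" for k
    using that
  proof (induction k)
    case 0
    have "z 0 \<in> topspace X"
      using C z(1) \<open>0 < n\<close> path_connectedin_subset_topspace by blast
    then show ?case by (intro exI[of _ "\<lambda>t. z 0"]) auto
  next
    case (Suc k)
    then obtain p where p: "continuous_map (top_of_set {0..real k}) X p" "p 0 = z 0" "p (real k) = z k"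
      "\<forall>i<k. p ` {real i..real (Suc i)} \<subseteq> C i" by auto
    have "k < n" using Suc.prems by simp
    then obtain g where g: "pathin X g" "g ` {0..1} \<subseteq> C k" "g 0 = z k" "g 1 = z (Suc k)"
      using C[of k] z[of k] unfolding path_connectedin image_subset_iff_funcset by blast
    define q where "q = (\<lambda>t. if t \<le> real k then p t else (g \<circ> (\<lambda>t. t - real k)) t)"
    have q: "q t = g (t - real k)" if "real k \<le> t" for t
      using that g(3) p(3) by (cases "t = real k") (auto simp: q_def)
    have "continuous_map (top_of_set {0..real (Suc k)}) X q"
      unfolding q_def
    proof (rule continuous_map_cases_le)
      have "{0..real (Suc k)} \<inter> {x \<in> topspace (top_of_set {0..real (Suc k)}). x \<le> real k} = {0..real k}"
        by auto
      then show "continuous_map (subtopology (top_of_set {0..real (Suc k)})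
          {x \<in> topspace (top_of_set {0..real (Suc k)}). x \<le> real k}) X p"
        using p(1) by (metis subtopology_subtopology)
      show "continuous_map (subtopology (top_of_set {0..real (Suc k)})
          {x \<in> topspace (top_of_set {0..real (Suc k)}). real k \<le> x}) X (g \<circ> (\<lambda>t. t - real k))"
        by (rule continuous_map_compose[OF _ g(1)[unfolded pathin_def]])
          (auto simp: subtopology_subtopology intro!: continuous_intros)
    qed (use p(3) g(3) in \<open>auto intro!: continuous_intros\<close>)
    moreover have "q ` {real i..real (Suc i)} \<subseteq> C i" if "i < Suc k" for i
    proof (cases "i = k")
      case True
      then show ?thesis using q g(2) by (auto simp: image_subset_iff)
    next
      case False
      then have "i < k" using that by simp
      then have "q t = p t" if "t \<le> real (Suc i)" for t
        using that by (simp add: q_def)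
      then show ?thesis using p(4) \<open>i < k\<close> by (auto simp: image_subset_iff)
    qed
    ultimately show ?case
      using p(2) q[of "real (Suc k)"] g(4) by (intro exI[of _ q]) (auto simp: q_def)
  qed
  from this[of n] obtain p where p: "continuous_map (top_of_set {0..real n}) X p" "p 0 = z 0"
    "p (real n) = z n" "\<forall>i<n. p ` {real i..real (Suc i)} \<subseteq> C i" by auto
  have "continuous_map (top_of_set {0..1}) X (p \<circ> (\<lambda>t. real n * t))"
    by (rule continuous_map_compose[OF _ p(1)]) (auto intro!: continuous_intros mult_left_le)
  moreover have "(p \<circ> (\<lambda>t. real n * t)) ` {real i / real n..real (Suc i) / real n} \<subseteq> C i" if "i < n" for i
    using p(4) that \<open>0 < n\<close> by (force simp: image_subset_iff field_simps)
  ultimately show ?thesis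
    using p(2,3) by (intro that[of "p \<circ> (\<lambda>t. real n * t)"]) (auto simp: pathin_def)
qed

section \<open>The fundamental group\<close>

lemma loop_homotopy_iff:
  "(\<alpha>, \<beta>) \<in> loop_homotopy X x \<longleftrightarrow> \<alpha> \<in> loops X x \<and> \<beta> \<in> loops X x \<and> path_homotopic X \<alpha> \<beta>"
  by (auto simp: loop_homotopy_def path_homotopic_def loops_def)

lemma equiv_loop_homotopy: "equiv (loops X x) (loop_homotopy X x)"
proof (rule equivI)
  show "refl_on (loops X x) (loop_homotopy X x)"
    by (auto simp: refl_on_def loop_homotopy_iff loops_def intro: path_homotopic_refl)
  show "sym (loop_homotopy X x)"
    by (auto simp: sym_def loop_homotopy_iff path_homotopic_sym)
  show "trans (loop_homotopy X x)"
    by (auto simp: trans_def loop_homotopy_iff intro: path_homotopic_trans)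
qed (auto simp: loop_homotopy_iff)

lemma loop_class_eq_iff:
  "\<alpha> \<in> loops X x \<Longrightarrow> \<beta> \<in> loops X x \<Longrightarrow> loop_class X x \<alpha> = loop_class X x \<beta> \<longleftrightarrow> path_homotopic X \<alpha> \<beta>"
  unfolding loop_class_def using eq_equiv_class_iff[OF equiv_loop_homotopy] loop_homotopy_iff by metis

lemma mem_loop_class_iff:
  "\<beta> \<in> loop_class X x \<alpha> \<longleftrightarrow> \<alpha> \<in> loops X x \<and> \<beta> \<in> loops X x \<and> path_homotopic X \<alpha> \<beta>"
  by (simp add: loop_class_def loop_homotopy_iff)

lemma carrier_fundamental_group: "carrier (fundamental_group X x) = loop_class X x ` loops X x"
  by (auto simp: fundamental_group_def quotient_def loop_class_def)

lemma loops_pathin: "\<alpha> \<in> loops X x \<Longrightarrow> pathin X \<alpha>"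
  and loops_endpoints: "\<alpha> \<in> loops X x \<Longrightarrow> \<alpha> 0 = x" "\<alpha> \<in> loops X x \<Longrightarrow> \<alpha> 1 = x"
  by (auto simp: loops_def)

lemma pathin_restrict_iff: "pathin X (restrict p {0..1}) \<longleftrightarrow> pathin X p"
  unfolding pathin_def by (rule iffI; erule continuous_map_eq) auto

lemma restrict_in_loops: "pathin X p \<Longrightarrow> p 0 = x \<Longrightarrow> p 1 = x \<Longrightarrow> restrict p {0..1} \<in> loops X x"
  by (auto simp: loops_def pathin_restrict_iff)

lemma path_homotopic_restrict_iff:
  "path_homotopic X (restrict p {0..1}) (restrict q {0..1}) \<longleftrightarrow> path_homotopic X p q"
  by (rule path_homotopic_cong) auto

lemma loop_join_eq: "loop_join \<alpha> \<beta> = restrict (path_join \<alpha> \<beta>) {0..1}"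
  by (simp add: loop_join_def path_join_def)

lemma loop_join_in_loops:
  "\<alpha> \<in> loops X x \<Longrightarrow> \<beta> \<in> loops X x \<Longrightarrow> loop_join \<alpha> \<beta> \<in> loops X x"
  unfolding loop_join_eq by (intro restrict_in_loops pathin_join) (auto simp: loops_def)

lemma const_in_loops: "x \<in> topspace X \<Longrightarrow> (\<lambda>t\<in>{0..1}. x) \<in> loops X x"
  by (rule restrict_in_loops) auto

text \<open>The product is a union over all pairs of representatives; it collapses to a single class
  because concatenation respects homotopy.\<close>

lemma mult_fundamental_group:
  assumes a: "\<alpha> \<in> loops X x" and b: "\<beta> \<in> loops X x"
  shows "loop_class X x \<alpha> \<otimes>\<^bsub>fundamental_group X x\<^esub> loop_class X x \<beta> = loop_class X x (loop_join \<alpha> \<beta>)"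
proof -
  have "loop_class X x (loop_join \<alpha>' \<beta>') = loop_class X x (loop_join \<alpha> \<beta>)"
    if "\<alpha>' \<in> loop_class X x \<alpha>" "\<beta>' \<in> loop_class X x \<beta>" for \<alpha>' \<beta>'
  proof -
    have "path_homotopic X (path_join \<alpha> \<beta>) (path_join \<alpha>' \<beta>')"
      using that by (intro path_homotopic_join) (auto simp: mem_loop_class_iff loops_def)
    moreover have "loop_join \<alpha>' \<beta>' \<in> loops X x"
      using that by (intro loop_join_in_loops) (auto simp: mem_loop_class_iff)
    ultimately show ?thesis
      using loop_join_in_loops[OF a b]
      by (auto simp: loop_class_eq_iff loop_join_eq path_homotopic_restrict_iff path_homotopic_sym)
  qed
  moreover have "\<alpha> \<in> loop_class X x \<alpha>" "\<beta> \<in> loop_class X x \<beta>"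
    using a b by (auto simp: mem_loop_class_iff loops_pathin path_homotopic_refl)
  ultimately have "(\<Union>\<alpha>'\<in>loop_class X x \<alpha>. \<Union>\<beta>'\<in>loop_class X x \<beta>. loop_class X x (loop_join \<alpha>' \<beta>')) =
      loop_class X x (loop_join \<alpha> \<beta>)"
    by blast
  then show ?thesis
    by (simp add: fundamental_group_def)
qed

section \<open>Induced homomorphisms\<close>

lemma compose_in_loops:
  assumes "\<alpha> \<in> loops X x" "continuous_map X Y f" "f x = y"
  shows "compose {0..1} f \<alpha> \<in> loops Y y"
proof -
  have "pathin Y (f \<circ> \<alpha>)" by (rule pathin_compose[OF loops_pathin[OF assms(1)] assms(2)])
  then show ?thesis
    using restrict_in_loops[of Y "f \<circ> \<alpha>" y] assms by (simp add: compose_def loops_def o_def)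
qed

lemma path_homotopic_compose_iff:
  "path_homotopic Y (compose {0..1} f \<alpha>) (compose {0..1} g \<beta>) \<longleftrightarrow> path_homotopic Y (f \<circ> \<alpha>) (g \<circ> \<beta>)"
  by (rule path_homotopic_cong) (auto simp: compose_def)

lemma induced_hom_loop_class:
  assumes a: "\<alpha> \<in> loops X x" and f: "continuous_map X Y f" "f x = y"
  shows "induced_hom Y y f (loop_class X x \<alpha>) = loop_class Y y (compose {0..1} f \<alpha>)"
proof -
  have "loop_class Y y (compose {0..1} f \<beta>) = loop_class Y y (compose {0..1} f \<alpha>)"
    if "\<beta> \<in> loop_class X x \<alpha>" for \<beta>
  proof -
    have b: "\<beta> \<in> loops X x" "path_homotopic X \<beta> \<alpha>"
      using that path_homotopic_sym by (auto simp: mem_loop_class_iff)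
    then show ?thesis
      using path_homotopic_compose[OF b(2) f(1)] compose_in_loops[OF _ f] a
      by (simp add: loop_class_eq_iff path_homotopic_compose_iff)
  qed
  moreover have "\<alpha> \<in> loop_class X x \<alpha>"
    using a by (auto simp: mem_loop_class_iff loops_pathin path_homotopic_refl)
  ultimately show ?thesis
    unfolding induced_hom_def by blast
qed

lemma induced_hom_in_hom:
  assumes f: "continuous_map X Y f" "f x = y"
  shows "induced_hom Y y f \<in> hom (fundamental_group X x) (fundamental_group Y y)"
proof (rule homI)
  fix A assume "A \<in> carrier (fundamental_group X x)"
  then show "induced_hom Y y f A \<in> carrier (fundamental_group Y y)"
    using induced_hom_loop_class[OF _ f] compose_in_loops[OF _ f]
    by (auto simp: carrier_fundamental_group)
next
  fix A B assume "A \<in> carrier (fundamental_group X x)" "B \<in> carrier (fundamental_group X x)"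
  then obtain \<alpha> \<beta> where ab: "\<alpha> \<in> loops X x" "\<beta> \<in> loops X x" "A = loop_class X x \<alpha>" "B = loop_class X x \<beta>"
    by (auto simp: carrier_fundamental_group)
  have "compose {0..1} f (loop_join \<alpha> \<beta>) = loop_join (compose {0..1} f \<alpha>) (compose {0..1} f \<beta>)"
    by (rule ext) (auto simp: compose_def loop_join_def)
  then show "induced_hom Y y f (A \<otimes>\<^bsub>fundamental_group X x\<^esub> B) =
      induced_hom Y y f A \<otimes>\<^bsub>fundamental_group Y y\<^esub> induced_hom Y y f B"
    using ab induced_hom_loop_class[OF _ f] compose_in_loops[OF _ f] loop_join_in_loops[OF ab(1,2)]
    by (simp add: mult_fundamental_group)
qed

text \<open>The definition speaks only of loops at \<open>x\<close>. Shrinking \<open>U\<close> to a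
  path connected open \<open>D\<close> makes every point of \<open>D\<close> reachable from
  \<open>x\<close> inside \<open>D\<close>, which extends control to all paths in
  \<open>D\<close>.\<close>

lemma semilocally_simply_connected_imp_paths_homotopic_within:
  assumes "semilocally_simply_connected_space X" "locally_path_connected_space X" "x \<in> topspace X"
  obtains D where "openin X D" "x \<in> D" "paths_homotopic_within X D"
proof -
  obtain U where U: "openin X U" "x \<in> U"
    "\<forall>\<alpha>\<in>loops (subtopology X U) x. (\<alpha>, \<lambda>t\<in>{0..1}. x) \<in> loop_homotopy X x"
    using assms unfolding semilocally_simply_connected_space_def by blast
  obtain D where D: "openin X D" "path_connectedin X D" "x \<in> D" "D \<subseteq> U"
    using assms(2) U(1,2) unfolding locally_path_connected_space_alt neighbourhood_base_of
    by (meson subsetD)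
  have "paths_homotopic_within X D"
  proof (rule paths_homotopic_within_if_loops_null[OF D(2,3)])
    fix \<alpha> assume "\<alpha> \<in> loops (subtopology X D) x"
    then have "\<alpha> \<in> loops (subtopology X U) x"
      using D(4) by (auto simp: loops_def pathin_subtopology)
    then have "path_homotopic X \<alpha> (\<lambda>t\<in>{0..1}. x)"
      using U(3) by (simp add: loop_homotopy_iff)
    then show "path_homotopic X \<alpha> (\<lambda>t. x)"
      by (subst (asm) path_homotopic_cong[of \<alpha> \<alpha> _ "\<lambda>t. x"]) auto
  qed
  then show ?thesis using that D by blast
qed

section \<open>Maps into realizations\<close>

lemma continuous_map_locally:
  assumes "\<And>x. x \<in> topspace X \<Longrightarrow> \<exists>N g. openin X N \<and> x \<in> N \<and> continuous_map X Y g \<and> (\<forall>z\<in>N. f z = g z)"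
  shows "continuous_map X Y f"
proof -
  obtain N g where Ng: "\<And>x. x \<in> topspace X \<Longrightarrow>
      openin X (N x) \<and> x \<in> N x \<and> continuous_map X Y (g x) \<and> (\<forall>z\<in>N x. f z = g x z)"
    using assms by metis
  show ?thesis
  proof (rule pasting_lemma[where I = "topspace X" and T = N and f = g])
    show "\<And>i. i \<in> topspace X \<Longrightarrow> continuous_map (subtopology X (N i)) Y (g i)"
      using Ng continuous_map_from_subtopology by blast
  qed (use Ng in \<open>auto, metis+\<close>)
qed

definition simplicial_complex :: "'v set set \<Rightarrow> bool" where
  "simplicial_complex K \<longleftrightarrow>
     (\<forall>\<sigma>\<in>K. finite \<sigma> \<and> \<sigma> \<noteq> {} \<and> (\<forall>\<tau>. \<tau> \<subseteq> \<sigma> \<and> \<tau> \<noteq> {} \<longrightarrow> \<tau> \<in> K))"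

lemma simplicial_complex_finite: "simplicial_complex K \<Longrightarrow> \<sigma> \<in> K \<Longrightarrow> finite \<sigma>"
  unfolding simplicial_complex_def by blast

lemma simplicial_complex_nerve: "simplicial_complex (nerve \<U>)"
  unfolding simplicial_complex_def nerve_def
proof (intro ballI conjI allI impI)
  fix \<sigma> \<tau> assume s: "\<sigma> \<in> {\<sigma>. finite \<sigma> \<and> \<sigma> \<noteq> {} \<and> \<sigma> \<subseteq> \<U> \<and> \<Inter>\<sigma> \<noteq> {}}" and t: "\<tau> \<subseteq> \<sigma> \<and> \<tau> \<noteq> {}"
  then have "\<Inter>\<sigma> \<subseteq> \<Inter>\<tau>" by blast
  then show "\<tau> \<in> {\<sigma>. finite \<sigma> \<and> \<sigma> \<noteq> {} \<and> \<sigma> \<subseteq> \<U> \<and> \<Inter>\<sigma> \<noteq> {}}"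
    using s t finite_subset by blast
qed auto

section \<open>Points of a realization and their supports\<close>

lemma powertop_real_eq_euclidean: "powertop_real UNIV = euclidean"
  by (rule euclidean_product_topology)

text \<open>Closedness allows a neighbourhood of a point to avoid the finitely many simplices, on a
  given finite set of vertices, that do not contain it.\<close>

lemma closed_closed_simplex: "closed (closed_simplex \<sigma>)"
proof -
  have "closed_simplex \<sigma> = {t. \<forall>v. 0 \<le> t v} \<inter> {t. \<forall>v\<in>-\<sigma>. t v = 0} \<inter> {t. sum t \<sigma> = 1}"
    by (auto simp: closed_simplex_def)
  moreover have "closed {t :: 'a \<Rightarrow> real. \<forall>v. 0 \<le> t v}"
    by (intro closed_Collect_all closed_Collect_le continuous_intros continuous_on_product_coordinates)
  moreover have "closed {t :: 'a \<Rightarrow> real. \<forall>v\<in>-\<sigma>. t v = 0}"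
    unfolding Ball_def
    by (intro closed_Collect_all closed_Collect_imp closed_Collect_eq open_Collect_const continuous_intros
        continuous_on_product_coordinates)
  moreover have "closed {t :: 'a \<Rightarrow> real. sum t \<sigma> = 1}"
    by (intro closed_Collect_eq continuous_intros continuous_on_product_coordinates)
  ultimately show ?thesis by auto
qed

lemma topspace_realization: "topspace (realization K) = (\<Union>\<sigma>\<in>K. closed_simplex \<sigma>)"
proof -
  have "openin (realization K) (\<Union>\<sigma>\<in>K. closed_simplex \<sigma>)"
    unfolding openin_realization powertop_real_eq_euclidean
  proof (intro conjI ballI)
    fix \<sigma> assume "\<sigma> \<in> K"
    then have "(\<Union>\<sigma>\<in>K. closed_simplex \<sigma>) \<inter> closed_simplex \<sigma> = closed_simplex \<sigma>" by blast
    then show "openin (top_of_set (closed_simplex \<sigma>)) ((\<Union>\<sigma>\<in>K. closed_simplex \<sigma>) \<inter> closed_simplex \<sigma>)"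
      by simp
  qed simp
  then show ?thesis
    using openin_realization openin_subset openin_topspace by (metis subset_antisym)
qed

lemma closed_simplex_iff_support:
  assumes "finite \<sigma>"
  shows "t \<in> closed_simplex \<sigma> \<longleftrightarrow>
    (\<forall>v. 0 \<le> t v) \<and> {v. t v \<noteq> 0} \<subseteq> \<sigma> \<and> sum t {v. t v \<noteq> 0} = 1"
proof -
  have "sum t {v. t v \<noteq> 0} = sum t \<sigma>" if "{v. t v \<noteq> 0} \<subseteq> \<sigma>"
    by (rule sum.mono_neutral_left[OF assms that]) auto
  then show ?thesis
    unfolding closed_simplex_def by (auto simp: subset_iff) (metis (mono_tags, lifting))+
qed

text \<open>The support of a point is the smallest simplex containing it, and it belongs to
  \<open>K\<close> because \<open>K\<close> is closed under nonempty faces. This removes the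
  existential choice of a simplex.\<close>

lemma mem_realization_iff_support:
  assumes "simplicial_complex K"
  shows "t \<in> topspace (realization K) \<longleftrightarrow>
    (\<forall>v. 0 \<le> t v) \<and> {v. t v \<noteq> 0} \<in> K \<and> sum t {v. t v \<noteq> 0} = 1"
proof
  assume "t \<in> topspace (realization K)"
  then obtain \<sigma> where s: "\<sigma> \<in> K" "t \<in> closed_simplex \<sigma>"
    by (auto simp: topspace_realization)
  then have t: "\<forall>v. 0 \<le> t v" "{v. t v \<noteq> 0} \<subseteq> \<sigma>" "sum t {v. t v \<noteq> 0} = 1"
    using closed_simplex_iff_support[of \<sigma> t] assms unfolding simplicial_complex_def by metis+
  then have "{v. t v \<noteq> 0} \<noteq> {}" by (metis sum.empty zero_neq_one)
  then show "(\<forall>v. 0 \<le> t v) \<and> {v. t v \<noteq> 0} \<in> K \<and> sum t {v. t v \<noteq> 0} = 1"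
    using assms s(1) t unfolding simplicial_complex_def by blast
next
  assume t: "(\<forall>v. 0 \<le> t v) \<and> {v. t v \<noteq> 0} \<in> K \<and> sum t {v. t v \<noteq> 0} = 1"
  then have "t \<in> closed_simplex {v. t v \<noteq> 0}"
    using assms closed_simplex_iff_support[of "{v. t v \<noteq> 0}" t] simplicial_complex_finite by blast
  then show "t \<in> topspace (realization K)"
    using t by (auto simp: topspace_realization)
qed

text \<open>The maps into a realization that occur below have continuous barycentric coordinates, and
  locally only finitely many of these are nonzero; this makes them continuous for the weak topology.\<close>

definition barycentric_map :: "'a topology \<Rightarrow> 'v set set \<Rightarrow> ('a \<Rightarrow> 'v \<Rightarrow> real) \<Rightarrow> bool" where
  "barycentric_map X K f \<longleftrightarrow>
     (\<forall>v. continuous_map X euclideanreal (\<lambda>x. f x v)) \<and>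
     (\<forall>x\<in>topspace X. f x \<in> topspace (realization K)) \<and>
     (\<forall>x\<in>topspace X. \<exists>N F. openin X N \<and> x \<in> N \<and> finite F \<and> (\<forall>z\<in>N. {v. f z v \<noteq> 0} \<subseteq> F))"

lemma barycentric_map_support:
  assumes "simplicial_complex K" "barycentric_map X K f" "x \<in> topspace X"
  shows "{v. f x v \<noteq> 0} \<in> K"
  using assms(2,3) mem_realization_iff_support[OF assms(1)] unfolding barycentric_map_def by blast

lemma barycentric_map_compose:
  assumes f: "barycentric_map Y K f" and g: "continuous_map X Y g"
  shows "barycentric_map X K (f \<circ> g)"
  unfolding barycentric_map_def
proof (intro conjI allI ballI)
  show "continuous_map X euclideanreal (\<lambda>x. (f \<circ> g) x v)" for v
    using continuous_map_compose[OF g, of euclideanreal "\<lambda>y. f y v"] f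
    by (simp add: barycentric_map_def o_def)
  fix x assume x: "x \<in> topspace X"
  then have gx: "g x \<in> topspace Y"
    using g by (auto simp: continuous_map_def)
  then show "(f \<circ> g) x \<in> topspace (realization K)"
    using f by (simp add: barycentric_map_def)
  obtain N F where "openin Y N" "g x \<in> N" "finite F" "\<forall>z\<in>N. {v. f z v \<noteq> 0} \<subseteq> F"
    using f gx unfolding barycentric_map_def by blast
  then show "\<exists>N F. openin X N \<and> x \<in> N \<and> finite F \<and> (\<forall>z\<in>N. {v. (f \<circ> g) z v \<noteq> 0} \<subseteq> F)"
    using openin_continuous_map_preimage[OF g] x
    by (intro exI[of _ "{x \<in> topspace X. g x \<in> N}"] exI[of _ F]) auto
qed

lemma barycentric_map_imp_continuous:
  assumes K: "simplicial_complex K" and f: "barycentric_map X K f"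
  shows "continuous_map X (realization K) f"
  unfolding continuous_map_def
proof (intro conjI allI impI)
  show "f \<in> topspace X \<rightarrow> topspace (realization K)"
    using f by (auto simp: barycentric_map_def)
  have cf: "continuous_map X euclidean f"
    using f unfolding barycentric_map_def powertop_real_eq_euclidean[symmetric]
      continuous_map_componentwise_UNIV by blast
  fix W assume W: "openin (realization K) W"
  show "openin X {x \<in> topspace X. f x \<in> W}"
  proof (subst openin_subopen, intro ballI)
    fix x assume "x \<in> {x \<in> topspace X. f x \<in> W}"
    then have x: "x \<in> topspace X" "f x \<in> W" by auto
    then obtain N F where N: "openin X N" "x \<in> N" "finite F" "\<forall>z\<in>N. {v. f z v \<noteq> 0} \<subseteq> F"
      using f unfolding barycentric_map_def by blast
    have "\<exists>V. open V \<and> W \<inter> closed_simplex \<sigma> = V \<inter> closed_simplex \<sigma>" if "\<sigma> \<in> K" for \<sigma>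
    proof -
      have "openin (top_of_set (closed_simplex \<sigma>)) (W \<inter> closed_simplex \<sigma>)"
        using W that by (simp add: openin_realization powertop_real_eq_euclidean)
      then show ?thesis by (metis Int_commute openin_open)
    qed
    then obtain O' where O': "\<And>\<sigma>. \<sigma> \<in> K \<Longrightarrow> open (O' \<sigma>)"
        "\<And>\<sigma>. \<sigma> \<in> K \<Longrightarrow> W \<inter> closed_simplex \<sigma> = O' \<sigma> \<inter> closed_simplex \<sigma>"
      by metis
    \<comment> \<open>Near \<open>x\<close> the supports lie in the finite set \<open>F\<close>, so
      only finitely many simplices matter. Those containing \<open>f x\<close> contribute a
      neighbourhood that cuts out \<open>W\<close> on them, the others are avoided. A point
      \<open>f z\<close> in \<open>V\<close> lies in its own support simplex, which therefore must
      be of the first kind.\<close>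
    define V where "V = (\<Inter>\<sigma>\<in>Pow F \<inter> K. if f x \<in> closed_simplex \<sigma> then O' \<sigma> else - closed_simplex \<sigma>)"
    have "open V"
      unfolding V_def using N(3) O'(1) by (intro open_INT) (auto simp: closed_closed_simplex open_Compl)
    have fxV: "f x \<in> V"
      using O'(2) x(2) by (auto simp: V_def)
    let ?M = "N \<inter> {z \<in> topspace X. f z \<in> V}"
    have "openin X ?M"
      using N(1) openin_continuous_map_preimage[OF cf, of V] \<open>open V\<close> by (intro openin_Int) auto
    moreover have "x \<in> ?M" using N(2) x fxV by blast
    moreover have "?M \<subseteq> {x \<in> topspace X. f x \<in> W}"
    proof
      fix z assume z: "z \<in> ?M"
      let ?s = "{v. f z v \<noteq> 0}"
      have "f z \<in> topspace (realization K)"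
        using f z by (auto simp: barycentric_map_def)
      then have s: "?s \<in> K" "f z \<in> closed_simplex ?s"
        using mem_realization_iff_support[OF K, of "f z"] closed_simplex_iff_support[of ?s "f z"]
          simplicial_complex_finite[OF K] by blast+
      moreover have "?s \<in> Pow F" using N(4) z by auto
      ultimately have "f z \<in> (if f x \<in> closed_simplex ?s then O' ?s else - closed_simplex ?s)"
        using z unfolding V_def by blast
      then have "f z \<in> O' ?s" using s(2) by (auto split: if_splits)
      then show "z \<in> {x \<in> topspace X. f x \<in> W}"
        using O'(2)[OF s(1)] s(2) z by blast
    qed
    ultimately show "\<exists>T. openin X T \<and> x \<in> T \<and> T \<subseteq> {x \<in> topspace X. f x \<in> W}"
      by blast
  qed
qed

lemma convex_combination_in_closed_simplex:
  assumes "t \<in> closed_simplex \<sigma>" "u \<in> closed_simplex \<sigma>" "s \<in> {0..1}"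
  shows "(\<lambda>v. (1 - s) * t v + s * u v) \<in> closed_simplex \<sigma>"
  using assms by (auto simp: closed_simplex_def sum.distrib simp flip: sum_distrib_left)

text \<open>Contiguity: at each point both values lie in the simplex spanned by the union of their
  supports, so the straight-line homotopy stays in the realization. It is stationary where
  \<open>f\<close> and \<open>g\<close> agree, which later keeps endpoints fixed.\<close>

lemma homotopic_barycentric_maps:
  assumes K: "simplicial_complex K" and f: "barycentric_map X K f" and g: "barycentric_map X K g"
    and union: "\<And>x. x \<in> topspace X \<Longrightarrow> {v. f x v \<noteq> 0} \<union> {v. g x v \<noteq> 0} \<in> K"
  shows "homotopic_with (\<lambda>h. \<forall>x. f x = g x \<longrightarrow> h x = f x) X (realization K) f g"
  unfolding homotopic_with_def
proof (intro exI conjI allI ballI impI)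
  define h where "h = (\<lambda>(s::real, x). \<lambda>v. (1 - s) * f x v + s * g x v)"
  let ?P = "prod_topology (top_of_set {0..1::real}) X"
  have cont: "continuous_map X euclideanreal (\<lambda>x. f x v)" "continuous_map X euclideanreal (\<lambda>x. g x v)" for v
    using f g by (auto simp: barycentric_map_def)
  have "barycentric_map ?P K h"
    unfolding barycentric_map_def
  proof (intro conjI allI ballI)
    fix v
    have "continuous_map ?P euclideanreal fst"
      using continuous_map_fst continuous_map_in_subtopology by blast
    moreover have "continuous_map ?P euclideanreal (\<lambda>y. f (snd y) v)"
      "continuous_map ?P euclideanreal (\<lambda>y. g (snd y) v)"
      using continuous_map_compose[OF continuous_map_snd cont(1)]
        continuous_map_compose[OF continuous_map_snd cont(2)] by (simp_all add: o_def)
    ultimately show "continuous_map ?P euclideanreal (\<lambda>y. h y v)"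
      unfolding h_def case_prod_unfold by (intro continuous_intros)
  next
    fix y assume "y \<in> topspace ?P"
    then obtain s x where y: "y = (s, x)" "s \<in> {0..1}" "x \<in> topspace X" by auto
    let ?s = "{v. f x v \<noteq> 0} \<union> {v. g x v \<noteq> 0}"
    have "finite ?s" by (rule simplicial_complex_finite[OF K union[OF y(3)]])
    moreover have "f x \<in> topspace (realization K)" "g x \<in> topspace (realization K)"
      using f g y by (auto simp: barycentric_map_def)
    ultimately have "f x \<in> closed_simplex ?s" "g x \<in> closed_simplex ?s"
      unfolding closed_simplex_iff_support[OF \<open>finite ?s\<close>] mem_realization_iff_support[OF K] by blast+
    then have "h y \<in> closed_simplex ?s"
      using convex_combination_in_closed_simplex y by (simp add: h_def)
    then show "h y \<in> topspace (realization K)"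
      using union[OF y(3)] by (auto simp: topspace_realization)
    obtain N F where N: "openin X N" "x \<in> N" "finite F" "\<forall>z\<in>N. {v. f z v \<noteq> 0} \<subseteq> F"
      using f y(3) unfolding barycentric_map_def by blast
    obtain N' F' where N': "openin X N'" "x \<in> N'" "finite F'" "\<forall>z\<in>N'. {v. g z v \<noteq> 0} \<subseteq> F'"
      using g y(3) unfolding barycentric_map_def by blast
    have "openin ?P ({0..1::real} \<times> (N \<inter> N'))"
      unfolding openin_prod_Times_iff using N N' openin_topspace[of "top_of_set {0..1::real}"]
      by auto
    moreover have "{v. h z v \<noteq> 0} \<subseteq> F \<union> F'" if "z \<in> {0..1} \<times> (N \<inter> N')" for z
    proof -
      have "h z v = 0" if "f (snd z) v = 0" "g (snd z) v = 0" for v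
        using that by (simp add: h_def case_prod_unfold)
      then show ?thesis using N(4) N'(4) that by fastforce
    qed
    ultimately show "\<exists>N F. openin ?P N \<and> y \<in> N \<and> finite F \<and> (\<forall>z\<in>N. {v. h z v \<noteq> 0} \<subseteq> F)"
      using N N' y by (intro exI[of _ "{0..1} \<times> (N \<inter> N')"] exI[of _ "F \<union> F'"]) blast
  qed
  then show "continuous_map ?P (realization K) h"
    by (rule barycentric_map_imp_continuous[OF K])
  show "h (0, x) = f x" "h (1, x) = g x" for x
    by (auto simp: h_def)
  show "h (s, x) = f x" if "f x = g x" for s x
    using that by (auto simp: h_def algebra_simps)
qed

lemma path_homotopic_barycentric_maps:
  assumes K: "simplicial_complex K"
    and p: "barycentric_map (top_of_set {0..1}) K p" and q: "barycentric_map (top_of_set {0..1}) K q"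
    and union: "\<And>t. t \<in> {0..1} \<Longrightarrow> {v. p t v \<noteq> 0} \<union> {v. q t v \<noteq> 0} \<in> K"
    and ends: "p 0 = q 0" "p 1 = q 1"
  shows "path_homotopic (realization K) p q"
  unfolding path_homotopic_def
  by (rule homotopic_with_mono[OF homotopic_barycentric_maps[OF K p q]]) (use union ends in auto)

section \<open>Open stars and simplicial maps\<close>

lemma openin_open_star: "openin (realization K) {t \<in> topspace (realization K). t v \<noteq> 0}"
  unfolding openin_realization powertop_real_eq_euclidean
proof (intro conjI ballI)
  fix \<sigma> assume "\<sigma> \<in> K"
  then have "{t \<in> topspace (realization K). t v \<noteq> 0} \<inter> closed_simplex \<sigma> =
      closed_simplex \<sigma> \<inter> {t. t v \<noteq> 0}"
    by (auto simp: topspace_realization)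
  moreover have "open {t :: 'a \<Rightarrow> real. t v \<noteq> 0}"
    by (intro open_Collect_neq continuous_intros continuous_on_product_coordinates)
  ultimately show "openin (top_of_set (closed_simplex \<sigma>))
      ({t \<in> topspace (realization K). t v \<noteq> 0} \<inter> closed_simplex \<sigma>)"
    using openin_open by blast
qed (auto simp: topspace_realization)

lemma linear_extension_vertex: "linear_extension f (vertex v) = vertex (f v)"
proof
  fix w
  have "{u. vertex v u \<noteq> 0 \<and> f u = w} = (if f v = w then {v} else {})"
    by (auto simp: vertex_def)
  then show "linear_extension f (vertex v) w = vertex (f v) w"
    by (auto simp: linear_extension_def vertex_def)
qed

text \<open>The index set in the definition varies with \<open>t\<close>; a fixed finite one makes
  continuity a matter of finite sums.\<close>

lemma linear_extension_eq_sum: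
  assumes "finite F" "{v. t v \<noteq> 0} \<subseteq> F"
  shows "linear_extension f t w = (\<Sum>v | v \<in> F \<and> f v = w. t v)"
  unfolding linear_extension_def by (rule sum.mono_neutral_left) (use assms in auto)

lemma linear_extension_in_closed_simplex:
  assumes "finite \<sigma>" "t \<in> closed_simplex \<sigma>"
  shows "linear_extension f t \<in> closed_simplex (f ` \<sigma>)"
proof -
  have t: "\<And>v. 0 \<le> t v" "{v. t v \<noteq> 0} \<subseteq> \<sigma>" "sum t \<sigma> = 1"
    using assms(2) by (auto simp: closed_simplex_def)
  note eq = linear_extension_eq_sum[OF assms(1) t(2), of f]
  have "sum (linear_extension f t) (f ` \<sigma>) = 1"
    using sum.image_gen[OF assms(1), of t f] t(3) by (simp add: eq)
  moreover have "linear_extension f t w = 0" if "w \<notin> f ` \<sigma>" for w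
  proof -
    have none: "{v. v \<in> \<sigma> \<and> f v = w} = {}" using that by blast
    show ?thesis unfolding eq none by simp
  qed
  ultimately show ?thesis
    by (auto simp: closed_simplex_def linear_extension_def intro: sum_nonneg t(1))
qed

lemma barycentric_map_linear_extension:
  assumes K: "simplicial_complex K" and f: "barycentric_map X K f"
    and g: "\<And>\<sigma>. \<sigma> \<in> K \<Longrightarrow> g ` \<sigma> \<in> L"
  shows "barycentric_map X L (linear_extension g \<circ> f)"
  unfolding barycentric_map_def
proof (intro conjI allI ballI)
  fix w
  show "continuous_map X euclideanreal (\<lambda>x. (linear_extension g \<circ> f) x w)"
  proof (rule continuous_map_locally)
    fix x assume "x \<in> topspace X"
    then obtain N F where N: "openin X N" "x \<in> N" "finite F" "\<forall>z\<in>N. {v. f z v \<noteq> 0} \<subseteq> F"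
      using f unfolding barycentric_map_def by blast
    have "continuous_map X euclideanreal (\<lambda>x. \<Sum>v | v \<in> F \<and> g v = w. f x v)"
      using N(3) f by (intro continuous_map_sum) (auto simp: barycentric_map_def)
    then show "\<exists>N h. openin X N \<and> x \<in> N \<and> continuous_map X euclideanreal h \<and>
        (\<forall>z\<in>N. (linear_extension g \<circ> f) z w = h z)"
      using N by (intro exI[of _ N] exI[of _ "\<lambda>x. \<Sum>v | v \<in> F \<and> g v = w. f x v"])
        (auto simp: linear_extension_eq_sum)
  qed
next
  fix x assume x: "x \<in> topspace X"
  then have "f x \<in> topspace (realization K)" using f by (simp add: barycentric_map_def)
  then obtain \<sigma> where "\<sigma> \<in> K" "f x \<in> closed_simplex \<sigma>"
    by (auto simp: topspace_realization)
  moreover have "finite \<sigma>" by (rule simplicial_complex_finite[OF K \<open>\<sigma> \<in> K\<close>])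
  ultimately show "(linear_extension g \<circ> f) x \<in> topspace (realization L)"
    using linear_extension_in_closed_simplex[of \<sigma> "f x" g] g by (auto simp: topspace_realization)
  obtain N F where N: "openin X N" "x \<in> N" "finite F" "\<forall>z\<in>N. {v. f z v \<noteq> 0} \<subseteq> F"
    using f x unfolding barycentric_map_def by blast
  have "{w. linear_extension g (f z) w \<noteq> 0} \<subseteq> g ` F" if "z \<in> N" for z
  proof
    fix w assume "w \<in> {w. linear_extension g (f z) w \<noteq> 0}"
    then have "{v. f z v \<noteq> 0 \<and> g v = w} \<noteq> {}"
      by (auto simp: linear_extension_def elim: sum.not_neutral_contains_not_neutral)
    then show "w \<in> g ` F" using N(4) that by blast
  qed
  then show "\<exists>N F. openin X N \<and> x \<in> N \<and> finite F \<and> (\<forall>z\<in>N. {v. (linear_extension g \<circ> f) z v \<noteq> 0} \<subseteq> F)"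
    using N by (intro exI[of _ N] exI[of _ "g ` F"]) auto
qed

text \<open>The identity of a whole realization need not have locally finite coordinates, so the
  criterion for barycentric maps is applied to the identity of one closed simplex at a time; the
  weak topology then combines the pieces.\<close>

lemma continuous_map_linear_extension:
  assumes K: "simplicial_complex K" and L: "simplicial_complex L"
    and g: "\<And>\<sigma>. \<sigma> \<in> K \<Longrightarrow> g ` \<sigma> \<in> L"
  shows "continuous_map (realization K) (realization L) (linear_extension g)"
proof -
  have c: "continuous_map (top_of_set (closed_simplex \<sigma>)) (realization L) (linear_extension g)"
    if s: "\<sigma> \<in> K" for \<sigma>
  proof -
    have "finite \<sigma>" by (rule simplicial_complex_finite[OF K s])
    have "barycentric_map (top_of_set (closed_simplex \<sigma>)) K id"
      unfolding barycentric_map_def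
    proof (intro conjI allI ballI)
      show "continuous_map (top_of_set (closed_simplex \<sigma>)) euclideanreal (\<lambda>x. id x v)" for v
        by (auto intro: continuous_on_subset[OF continuous_on_product_coordinates])
      fix x assume x: "x \<in> topspace (top_of_set (closed_simplex \<sigma>))"
      then show "id x \<in> topspace (realization K)" using s by (auto simp: topspace_realization)
      show "\<exists>N F. openin (top_of_set (closed_simplex \<sigma>)) N \<and> x \<in> N \<and> finite F \<and>
          (\<forall>z\<in>N. {v. id z v \<noteq> 0} \<subseteq> F)"
        using x \<open>finite \<sigma>\<close>
        by (intro exI[of _ "closed_simplex \<sigma>"] exI[of _ \<sigma>]) (auto simp: closed_simplex_def)
    qed
    then have "barycentric_map (top_of_set (closed_simplex \<sigma>)) L (linear_extension g \<circ> id)"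
      using g by (rule barycentric_map_linear_extension[OF K])
    then show ?thesis using barycentric_map_imp_continuous[OF L] by simp
  qed
  show ?thesis
    unfolding continuous_map_def
  proof (intro conjI allI impI)
    show "linear_extension g \<in> topspace (realization K) \<rightarrow> topspace (realization L)"
      using continuous_map_funspace[OF c] by (auto simp: topspace_realization)
    fix W assume W: "openin (realization L) W"
    show "openin (realization K) {t \<in> topspace (realization K). linear_extension g t \<in> W}"
      unfolding openin_realization powertop_real_eq_euclidean
    proof (intro conjI ballI)
      fix \<sigma> assume s: "\<sigma> \<in> K"
      then have "{t \<in> topspace (realization K). linear_extension g t \<in> W} \<inter> closed_simplex \<sigma> =
          {t \<in> topspace (top_of_set (closed_simplex \<sigma>)). linear_extension g t \<in> W}"
        by (auto simp: topspace_realization)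
      then show "openin (top_of_set (closed_simplex \<sigma>))
          ({t \<in> topspace (realization K). linear_extension g t \<in> W} \<inter> closed_simplex \<sigma>)"
        using openin_continuous_map_preimage[OF c[OF s] W] by simp
    qed (auto simp: topspace_realization)
  qed
qed

section \<open>Lifting null-homotopies from the nerve\<close>

text \<open>This compares the loops of two rows of squares. On the \<open>j\<close>-th interval both
  paths run in \<open>C (V j)\<close>, so rungs between them exist there; a rung also borders the
  preceding square, hence the requirement that \<open>C (V (Suc j))\<close> lie in
  \<open>D (V j)\<close>.\<close>

lemma path_homotopic_of_chains:
  fixes V W :: "nat \<Rightarrow> 'b set"
  assumes "0 < n" and a: "pathin Y a" and b: "pathin Y b" and ends: "a 0 = b 0" "a 1 = b 1"
    and aV: "\<And>j. j < n \<Longrightarrow> a ` {real j / real n..real (Suc j) / real n} \<subseteq> P (V j)"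
    and bW: "\<And>j. j < n \<Longrightarrow> b ` {real j / real n..real (Suc j) / real n} \<subseteq> P (W j)"
    and PC: "\<And>j. j < n \<Longrightarrow> P (V j) \<subseteq> C (V j)" "\<And>j. j < n \<Longrightarrow> P (W j) \<subseteq> C (V j)"
    and C: "\<And>j. j < n \<Longrightarrow> path_connectedin Y (C (V j))"
    and CD: "\<And>j. j < n \<Longrightarrow> C (V j) \<subseteq> D (V j)" "\<And>j. Suc j < n \<Longrightarrow> C (V (Suc j)) \<subseteq> D (V j)"
    and D: "\<And>j. j < n \<Longrightarrow> paths_homotopic_within Y (D (V j))"
  shows "path_homotopic Y a b"
proof -
  let ?s = "\<lambda>j. real j / real n"
  \<comment> \<open>A rung is a side of two squares, hence two containments; at either end of the
    ladder one of them is void.\<close>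
  define Q where "Q j k \<longleftrightarrow> pathin Y k \<and> k 0 = a (?s j) \<and> k 1 = b (?s j) \<and>
      (j < n \<longrightarrow> k ` {0..1} \<subseteq> D (V j)) \<and> (0 < j \<longrightarrow> k ` {0..1} \<subseteq> D (V (j - 1)))" for j k
  have "\<exists>k. Q j k" if "j \<le> n" for j
  proof -
    consider "j = 0" | "j = n" | "0 < j" "j < n" using \<open>j \<le> n\<close> by linarith
    then show ?thesis
    proof cases
      case 1
      have "a 0 \<in> D (V 0)"
        using aV[of 0] PC(1)[of 0] CD(1)[of 0] \<open>0 < n\<close> by (force simp: image_subset_iff)
      then show ?thesis
        using 1 ends path_start_in_topspace[OF a] by (intro exI[of _ "\<lambda>t. a 0"]) (auto simp: Q_def)
    next
      case 2
      have "a 1 \<in> a ` {real (n - 1) / real n..real (Suc (n - 1)) / real n}"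
        using \<open>0 < n\<close> by (intro imageI) auto
      moreover have "n - 1 < n" using \<open>0 < n\<close> by simp
      ultimately have "a 1 \<in> D (V (n - 1))"
        using aV PC(1) CD(1) by blast
      then show ?thesis
        using 2 ends path_finish_in_topspace[OF a] \<open>0 < n\<close> by (intro exI[of _ "\<lambda>t. a 1"]) (auto simp: Q_def)
    next
      case 3
      have "?s j \<in> {real j / real n..real (Suc j) / real n}"
        using 3 by (simp add: divide_right_mono)
      then have "a (?s j) \<in> C (V j)" "b (?s j) \<in> C (V j)"
        using aV[OF 3(2)] bW[OF 3(2)] PC[OF 3(2)] by blast+
      then obtain k where "pathin Y k" "k 0 = a (?s j)" "k 1 = b (?s j)" "k ` {0..1} \<subseteq> C (V j)"
        using C[OF 3(2)] unfolding path_connectedin image_subset_iff_funcset by blast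
      then show ?thesis
        using CD(1)[of j] CD(2)[of "j - 1"] 3 by (intro exI[of _ k]) (auto simp: Q_def)
    qed
  qed
  then obtain k0 where "\<And>j. j \<le> n \<Longrightarrow> Q j (k0 j)" by metis
  then have k0: "\<forall>j\<le>n. pathin Y (k0 j) \<and> k0 j 0 = a (?s j) \<and> k0 j 1 = b (?s j) \<and>
      (j < n \<longrightarrow> k0 j ` {0..1} \<subseteq> D (V j)) \<and> (0 < j \<longrightarrow> k0 j ` {0..1} \<subseteq> D (V (j - 1)))"
    unfolding Q_def by blast
  \<comment> \<open>The rungs chosen at the two ends need not be constant. They are replaced by
    constant paths, which lets the ladder close up to a homotopy from \<open>a\<close> to
    \<open>b\<close>; the old ones still show that the endpoints lie in the right sets
    \<open>D\<close>.\<close>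
  define \<kappa> where "\<kappa> j = (if j = 0 then \<lambda>t. a 0 else if j = n then \<lambda>t. a 1 else k0 j)" for j
  have ends': "a 0 \<in> D (V 0)" "a 1 \<in> D (V (n - 1))"
  proof -
    show "a 0 \<in> D (V 0)" using k0[rule_format, of 0] \<open>0 < n\<close> by (force simp: image_subset_iff)
    show "a 1 \<in> D (V (n - 1))" using k0[rule_format, of n] \<open>0 < n\<close> by (force simp: image_subset_iff)
  qed
  have top: "a 0 \<in> topspace Y" "a 1 \<in> topspace Y"
    using path_start_in_topspace[OF a] path_finish_in_topspace[OF a] .
  have "path_homotopic Y (path_join (path_segment 0 (?s n) a) (\<kappa> n)) (path_join (\<kappa> 0) (path_segment 0 (?s n) b))"
  proof (rule path_homotopic_ladder[where D = "\<lambda>j. D (V j)" and n = n and s = ?s])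
    show "?s i \<in> {0..1}" if "i \<le> n" for i using that by (auto simp: divide_simps)
    show "?s i \<le> ?s (Suc i)" for i by (simp add: divide_right_mono)
    show "a ` {?s i..?s (Suc i)} \<subseteq> D (V i)" if "i < n" for i
      using aV[OF that] PC(1)[OF that] CD(1)[OF that] by (rule order_trans[OF order_trans])
    show "b ` {?s i..?s (Suc i)} \<subseteq> D (V i)" if "i < n" for i
      using bW[OF that] PC(2)[OF that] CD(1)[OF that] by (rule order_trans[OF order_trans])
    show "pathin Y (\<kappa> i)" if "i \<le> n" for i
      using k0 that top by (simp add: \<kappa>_def)
    show "\<kappa> i 0 = a (?s i)" "\<kappa> i 1 = b (?s i)" if "i \<le> n" for i
      using k0 that ends \<open>0 < n\<close> by (simp_all add: \<kappa>_def)
    show "\<kappa> i ` {0..1} \<subseteq> D (V i)" if "i < n" for i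
      using k0 that ends' by (auto simp: \<kappa>_def)
    show "\<kappa> (Suc i) ` {0..1} \<subseteq> D (V i)" if "i < n" for i
      using k0[rule_format, of "Suc i"] that ends' by (auto simp: \<kappa>_def)
  qed (use a b D in auto)
  then have h: "path_homotopic Y (path_join a (\<lambda>t. a 1)) (path_join (\<lambda>t. a 0) b)"
    using \<open>0 < n\<close> by (simp add: \<kappa>_def path_segment_def)
  have "path_homotopic Y a (path_join a (\<lambda>t. a 1))"
    by (rule path_homotopic_sym[OF path_homotopic_join_const[OF a]]) simp
  also note h
  also have "path_homotopic Y (path_join (\<lambda>t. a 0) b) b"
    using ends by (intro path_homotopic_const_join b) simp
  finally show ?thesis .
qed

text \<open>A null-homotopy in the nerve is cut into small squares, each inside the open star of a vertex.
  The vertices of a row of squares are a chain of sets, and every such chain carries a loop in \<open>Y\<close>;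
  the loops of consecutive rows are homotopic.\<close>

proposition path_homotopic_null_if_null_in_nerve:
  fixes \<U> :: "'a set set" and U0 :: "'a set"
  defines "N \<equiv> realization (nerve \<U>)"
  assumes \<phi>: "continuous_map X N \<phi>" "\<And>x U. x \<in> topspace X \<Longrightarrow> \<phi> x U \<noteq> 0 \<Longrightarrow> x \<in> U"
    and q: "continuous_map X Y q" and U0: "\<phi> x = vertex U0"
    and P: "\<And>U. U \<in> \<U> \<Longrightarrow> path_connectedin Y (P U)" "\<And>U. U \<in> \<U> \<Longrightarrow> q ` (U \<inter> topspace X) \<subseteq> P U"
    and C: "\<And>U. U \<in> \<U> \<Longrightarrow> path_connectedin Y (C U)"
      "\<And>U V. U \<in> \<U> \<Longrightarrow> V \<in> \<U> \<Longrightarrow> U \<inter> V \<noteq> {} \<Longrightarrow> P V \<subseteq> C U"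
    and D: "\<And>U. U \<in> \<U> \<Longrightarrow> paths_homotopic_within Y (D U)"
      "\<And>U V. U \<in> \<U> \<Longrightarrow> V \<in> \<U> \<Longrightarrow> U \<inter> V \<noteq> {} \<Longrightarrow> C V \<subseteq> D U"
    and covers: "\<Union>\<U> \<subseteq> topspace X"
    and \<alpha>: "pathin X \<alpha>" "\<alpha> 0 = x" "\<alpha> 1 = x"
    and null: "path_homotopic N (\<phi> \<circ> \<alpha>) (\<lambda>t. vertex U0)"
  shows "path_homotopic Y (q \<circ> \<alpha>) (\<lambda>t. q x)"
proof -
  let ?I = "{0..1::real} \<times> {0..1::real}"
  obtain h where h: "continuous_map (top_of_set ?I) N h"
    "\<And>t. t \<in> {0..1} \<Longrightarrow> h (0, t) = \<phi> (\<alpha> t)" "\<And>t. t \<in> {0..1} \<Longrightarrow> h (1, t) = vertex U0"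
    "\<And>s. s \<in> {0..1} \<Longrightarrow> h (s, 0) = vertex U0" "\<And>s. s \<in> {0..1} \<Longrightarrow> h (s, 1) = vertex U0"
    using null U0 \<alpha>(2,3) unfolding path_homotopic_iff o_def by force
  have supp: "{U. h y U \<noteq> 0} \<in> nerve \<U>" if "y \<in> ?I" for y
    using continuous_map_funspace[OF h(1)] that mem_realization_iff_support[OF simplicial_complex_nerve]
    unfolding N_def by fastforce
  have supp_in: "U \<in> \<U>" if "y \<in> ?I" "h y U \<noteq> 0" for y U
    using supp[OF that(1)] that(2) by (auto simp: nerve_def)
  have meet: "U \<inter> V \<noteq> {}" if y: "y \<in> ?I" "h y U \<noteq> 0" "h y V \<noteq> 0" for y U V
  proof -
    have "\<Inter>{U. h y U \<noteq> 0} \<subseteq> U \<inter> V" using y by blast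
    moreover have "\<Inter>{U. h y U \<noteq> 0} \<noteq> {}" using supp[OF y(1)] by (simp add: nerve_def)
    ultimately show ?thesis by blast
  qed
  have "\<exists>B. open B \<and> {y \<in> ?I. h y U \<noteq> 0} = ?I \<inter> B" for U
  proof -
    have "{y \<in> topspace (top_of_set ?I). h y \<in> {t \<in> topspace N. t U \<noteq> 0}} = {y \<in> ?I. h y U \<noteq> 0}"
      using continuous_map_funspace[OF h(1)] by auto
    then have "openin (top_of_set ?I) {y \<in> ?I. h y U \<noteq> 0}"
      using openin_continuous_map_preimage[OF h(1) openin_open_star[of "nerve \<U>" U, folded N_def]] by simp
    then show ?thesis by (simp add: openin_open)
  qed
  then obtain B where B: "\<And>U. open (B U)" "\<And>U. {y \<in> ?I. h y U \<noteq> 0} = ?I \<inter> B U"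
    by metis
  have cover: "\<exists>U\<in>\<U>. y \<in> B U" if y: "y \<in> ?I" for y
  proof -
    have "{U. h y U \<noteq> 0} \<noteq> {}" using supp[OF y] by (simp add: nerve_def)
    then show ?thesis using supp_in[OF y] B(2) y by blast
  qed
  obtain \<delta> where \<delta>: "0 < \<delta>" "\<And>T. T \<subseteq> ?I \<Longrightarrow> diameter T < \<delta> \<Longrightarrow> \<exists>b\<in>B ` \<U>. T \<subseteq> b"
  proof (rule Lebesgue_number_lemma[of ?I "B ` \<U>"])
    show "compact ?I" by (intro compact_Times) auto
    show "?I \<subseteq> \<Union>(B ` \<U>)" using cover by blast
    show "B ` \<U> \<noteq> {}" using cover[of "(0, 0)"] by auto
  qed (use B(1) in auto)
  \<comment> \<open>The 2 comes from bounding the diameter of a square cell of side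
    \<open>1 / n\<close> by the sum of its two sides.\<close>
  obtain m :: nat where m: "2 / \<delta> < real m" using reals_Archimedean2 by blast
  define n where "n = Suc m"
  have n: "0 < n" "2 / real n < \<delta>"
    using m \<open>0 < \<delta>\<close> by (auto simp: n_def field_simps)
  define cell where "cell i = {real i / real n..real (Suc i) / real n}" for i
  have cell_sub: "cell i \<subseteq> {0..1}" if "i < n" for i
    using that by (auto simp: cell_def divide_simps)
  have cell_dist: "\<bar>s - s'\<bar> \<le> 1 / real n" if "s \<in> cell i" "s' \<in> cell i" for i s s'
  proof -
    have "real (Suc i) / real n = real i / real n + 1 / real n" by (simp add: add_divide_distrib)
    then show ?thesis using that unfolding cell_def atLeastAtMost_iff by linarith
  qed
  have "\<exists>U\<in>\<U>. \<forall>y\<in>cell i \<times> cell j. h y U \<noteq> 0" if ij: "i < n" "j < n" for i j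
  proof -
    have "dist y y' \<le> 2 / real n" if "y \<in> cell i \<times> cell j" "y' \<in> cell i \<times> cell j" for y y'
    proof -
      have "dist y y' \<le> dist (fst y) (fst y') + dist (snd y) (snd y')"
        unfolding dist_prod_def by (rule sqrt_sum_squares_le_sum) auto
      also have "\<dots> \<le> 1 / real n + 1 / real n"
        using that cell_dist unfolding dist_real_def by (intro add_mono) auto
      finally show ?thesis by simp
    qed
    then have "diameter (cell i \<times> cell j) \<le> 2 / real n"
      by (intro diameter_le) (auto simp: dist_norm)
    then have "\<exists>b\<in>B ` \<U>. cell i \<times> cell j \<subseteq> b"
      using n(2) cell_sub ij by (intro \<delta>(2)) (auto simp: subset_iff)
    then obtain U where "U \<in> \<U>" "cell i \<times> cell j \<subseteq> B U" by blast
    moreover have "cell i \<times> cell j \<subseteq> ?I" using cell_sub ij by blast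
    ultimately show ?thesis using B(2) by blast
  qed
  then have "\<forall>i j. \<exists>U. i < n \<and> j < n \<longrightarrow> U \<in> \<U> \<and> (\<forall>y\<in>cell i \<times> cell j. h y U \<noteq> 0)"
    by blast
  then obtain V where V: "\<And>i j. i < n \<Longrightarrow> j < n \<Longrightarrow> V i j \<in> \<U>"
      "\<And>i j s t. i < n \<Longrightarrow> j < n \<Longrightarrow> s \<in> cell i \<Longrightarrow> t \<in> cell j \<Longrightarrow> h (s, t) (V i j) \<noteq> 0"
    by (metis mem_Times_iff fst_conv snd_conv)
  have left: "real i / real n \<in> cell i" and right: "real (Suc i) / real n \<in> cell i" for i
    by (auto simp: cell_def divide_right_mono)
  have in01: "s \<in> {0..1}" if "s \<in> cell i" "i < n" for s i
    using cell_sub that by blast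
  have vertex: "U = U0" if "vertex U0 U \<noteq> 0" for U
    using that by (auto simp: vertex_def split: if_splits)
  have last: "1 \<in> cell (n - 1)" and first: "0 \<in> cell 0"
    using right[of "n - 1"] left[of 0] n(1) by auto
  \<comment> \<open>On three sides of the square \<open>h\<close> is constantly the vertex of
    \<open>U0\<close>, whose only nonzero coordinate is \<open>U0\<close>. Cells touching these
    sides can therefore only be labelled \<open>U0\<close>.\<close>
  have V_first: "V i 0 = U0" and V_last: "V i (n - 1) = U0" if i: "i < n" for i
  proof -
    have j: "n - 1 < n" using n(1) by simp
    show "V i 0 = U0" "V i (n - 1) = U0"
      using V(2)[OF i n(1) left first] V(2)[OF i j left last] h(4,5)[OF in01[OF left i]]
      by (simp_all add: vertex)
  qed
  have V_top: "V (n - 1) j = U0" if j: "j < n" for j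
  proof -
    have "n - 1 < n" using n(1) by simp
    from V(2)[OF this j last left] show ?thesis
      using h(3)[OF in01[OF left j]] by (simp add: vertex)
  qed
  \<comment> \<open>Adjacent cells share a corner, where the coordinates of both labels are nonzero;
    both labels then belong to one simplex of the nerve and so intersect.\<close>
  have V_row: "V i j \<inter> V i (Suc j) \<noteq> {}" if "i < n" "Suc j < n" for i j
    using that left[of i] left[of "Suc j"] right[of j] in01
    by (intro meet[of "(real i / real n, real (Suc j) / real n)"] V(2)) auto
  have V_col: "V i j \<inter> V (Suc i) j \<noteq> {}" if "Suc i < n" "j < n" for i j
    using that left[of j] left[of "Suc i"] right[of i] in01
    by (intro meet[of "(real (Suc i) / real n, real j / real n)"] V(2)) auto
  have V_ne: "V i j \<inter> V i j \<noteq> {}" if "i < n" "j < n" for i j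
    using that left in01 by (intro meet[of "(real i / real n, real j / real n)"] V(2)) auto
  have U0_in: "U0 \<in> \<U>" using V(1)[of 0 0] V_first[of 0] n(1) by simp
  have x: "x \<in> topspace X" using path_start_in_topspace[OF \<alpha>(1)] \<alpha>(2) by simp
  have "x \<in> U0" using \<phi>(2)[OF x, of U0] U0 by (simp add: vertex_def)
  then have qx: "q x \<in> P U0" using P(2)[OF U0_in] x by blast
  define carried where "carried i a \<longleftrightarrow> pathin Y a \<and> a 0 = q x \<and> a 1 = q x \<and>
      (\<forall>j<n. a ` cell j \<subseteq> P (V i j))" for i a
  have carried_homotopic: "path_homotopic Y a b"
    if a: "carried i a" "i < n" and b: "carried i' b" "i' < n"
      and ii': "\<And>j. j < n \<Longrightarrow> V i j \<inter> V i' j \<noteq> {}" for i i' a b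
  proof (rule path_homotopic_of_chains[where V = "V i" and W = "V i'" and P = P and C = C and D = D])
    show "P (V i j) \<subseteq> C (V i j)" "P (V i' j) \<subseteq> C (V i j)" "path_connectedin Y (C (V i j))"
      "C (V i j) \<subseteq> D (V i j)" "paths_homotopic_within Y (D (V i j))" if "j < n" for j
      using that C D V V_ne ii' a(2) b(2) by auto
    show "C (V i (Suc j)) \<subseteq> D (V i j)" if "Suc j < n" for j
      using that D(2) V V_row a(2) by auto
  qed (use a b n in \<open>auto simp: carried_def cell_def\<close>)
  have ex_carried: "\<exists>a. carried i a" if i: "i < n" for i
  proof -
    have "\<exists>z. Suc j < n \<longrightarrow> z \<in> V i j \<inter> V i (Suc j)" for j using V_row[OF i, of j] by blast
    then obtain w where w: "\<And>j. Suc j < n \<Longrightarrow> w j \<in> V i j \<inter> V i (Suc j)" by metis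
    \<comment> \<open>For \<open>0 < j < n\<close>, \<open>z j\<close> is where the path passes from
      the set with index \<open>j - 1\<close> to the one with index \<open>j\<close>; hence the
      shift in \<open>w\<close>. It is the image of a common point of the two labels, and both ends
      are the base point.\<close>
    define z where "z j = (if j = 0 \<or> j = n then q x else q (w (j - 1)))" for j
    have qw: "q (w j) \<in> P (V i j)" "q (w j) \<in> P (V i (Suc j))" if "Suc j < n" for j
    proof -
      have "w j \<in> topspace X" using w[OF that] V(1)[OF i, of j] that covers by auto
      then show "q (w j) \<in> P (V i j)" "q (w j) \<in> P (V i (Suc j))"
        using w[OF that] P(2)[OF V(1)[OF i, of j]] P(2)[OF V(1)[OF i, of "Suc j"]] that
        by (auto simp: image_subset_iff)
    qed
    obtain a where "pathin Y a" "a 0 = z 0" "a 1 = z n" "\<And>j. j < n \<Longrightarrow> a ` cell j \<subseteq> P (V i j)"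
      unfolding cell_def
    proof (rule ex_path_through_chain[OF n(1), of Y "\<lambda>j. P (V i j)" z])
      show "path_connectedin Y (P (V i j))" if "j < n" for j using P(1) V(1) i that by simp
      show "z j \<in> P (V i j)" if "j < n" for j
        using that qx V_first[OF i] qw(2)[of "j - 1"] by (auto simp: z_def)
      show "z (Suc j) \<in> P (V i j)" if "j < n" for j
      proof (cases "Suc j = n")
        case True
        then have "j = n - 1" by simp
        then show ?thesis using True qx V_last[OF i] by (simp add: z_def)
      next
        case False
        then show ?thesis using that qw(1)[of j] by (simp add: z_def)
      qed
    qed blast
    then show ?thesis by (auto simp: carried_def z_def)
  qed
  \<comment> \<open>On the first side of the square \<open>h\<close> is the nerve image of
    \<open>\<alpha>\<close>, so a nonzero coordinate at \<open>V 0 j\<close> forces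
    \<open>\<alpha> t\<close> into that member of the cover.\<close>
  have q\<alpha>: "carried 0 (q \<circ> \<alpha>)"
    unfolding carried_def
  proof (intro conjI allI impI)
    show "pathin Y (q \<circ> \<alpha>)" using pathin_compose[OF \<alpha>(1) q] .
    show "(q \<circ> \<alpha>) ` cell j \<subseteq> P (V 0 j)" if "j < n" for j
    proof
      fix y assume "y \<in> (q \<circ> \<alpha>) ` cell j"
      then obtain t where t: "t \<in> cell j" "y = q (\<alpha> t)" by auto
      have t01: "t \<in> {0..1}" using in01 t(1) that by blast
      have "\<alpha> t \<in> topspace X" using path_image_subset_topspace[OF \<alpha>(1)] t01 by blast
      moreover have "\<phi> (\<alpha> t) (V 0 j) \<noteq> 0"
        using V(2)[OF n(1) that first t(1)] h(2)[OF t01] by simp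
      ultimately show "y \<in> P (V 0 j)"
        using \<phi>(2) P(2)[OF V(1)[OF n(1) that]] t(2) by blast
    qed
  qed (use \<alpha> in auto)
  have "path_homotopic Y (q \<circ> \<alpha>) a" if "carried i a" "i < n" for i a
    using that
  proof (induction i arbitrary: a)
    case 0
    \<comment> \<open>Row 0 carries both \<open>q \<circ> \<alpha>\<close> and the given loop
      \<open>a\<close>, which may differ; the comparison of chains is applied with the two rows
      equal.\<close>
    then show ?case using carried_homotopic[OF q\<alpha> _ 0(1)] V_ne by blast
  next
    case (Suc i)
    then obtain b where b: "carried i b" using ex_carried[of i] by auto
    have "path_homotopic Y (q \<circ> \<alpha>) b"
      by (rule Suc.IH[OF b]) (use Suc.prems in simp)
    also have "path_homotopic Y b a" using carried_homotopic[OF b _ Suc.prems] V_col Suc.prems by simp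
    finally show ?case .
  qed
  \<comment> \<open>All labels of the last row are \<open>U0\<close>, so the constant loop is among
    the loops it carries.\<close>
  moreover have "carried (n - 1) (\<lambda>t. q x)"
    using qx V_top q x by (auto simp: carried_def continuous_map_def)
  ultimately show ?thesis using n(1) by simp
qed

section \<open>Covers of metrizable spaces\<close>

context Metric_space
begin

definition cover_radius :: "'a set set \<Rightarrow> 'a \<Rightarrow> real" where
  "cover_radius \<O> x = Sup {e. 0 \<le> e \<and> e \<le> 1 \<and> (\<exists>U\<in>\<O>. mball x e \<subseteq> U)}"

lemma cover_radius_ge:
  assumes "0 \<le> e" "e \<le> 1" "U \<in> \<O>" "mball x e \<subseteq> U"
  shows "e \<le> cover_radius \<O> x"
  unfolding cover_radius_def by (rule cSup_upper) (use assms in \<open>auto intro!: bdd_aboveI[of _ 1]\<close>)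

lemma cover_radius_nonneg:
  assumes "\<O> \<noteq> {}"
  shows "0 \<le> cover_radius \<O> x"
proof -
  obtain U where "U \<in> \<O>" using assms by blast
  then show ?thesis using mball_eq_empty[of x 0] by (intro cover_radius_ge) auto
qed

lemma less_cover_radius:
  assumes "e < cover_radius \<O> x" "\<O> \<noteq> {}"
  obtains U where "U \<in> \<O>" "mball x e \<subseteq> U"
proof -
  let ?S = "{e. 0 \<le> e \<and> e \<le> 1 \<and> (\<exists>U\<in>\<O>. mball x e \<subseteq> U)}"
  have "0 \<in> ?S" using \<open>\<O> \<noteq> {}\<close> mball_eq_empty[of x 0] by auto
  then obtain e' where "e' \<in> ?S" "e < e'"
    using assms(1) less_cSup_iff[of ?S e] unfolding cover_radius_def
    by (metis (no_types, lifting) bdd_above_def empty_iff mem_Collect_eq)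
  then show ?thesis
    using that mball_subset_concentric[of e e' x] by auto
qed

lemma cover_radius_le_one:
  assumes "\<O> \<noteq> {}"
  shows "cover_radius \<O> x \<le> 1"
  unfolding cover_radius_def
proof (rule cSup_least)
  have "0 \<in> {e. 0 \<le> e \<and> e \<le> 1 \<and> (\<exists>U\<in>\<O>. mball x e \<subseteq> U)}"
    using assms mball_eq_empty[of x 0] by auto
  then show "{e. 0 \<le> e \<and> e \<le> 1 \<and> (\<exists>U\<in>\<O>. mball x e \<subseteq> U)} \<noteq> {}" by blast
qed auto

text \<open>Moving the centre by \<open>d x y\<close> costs at most that much radius.\<close>

lemma cover_radius_lipschitz:
  assumes "\<O> \<noteq> {}" "x \<in> M" "y \<in> M"
  shows "cover_radius \<O> x \<le> cover_radius \<O> y + d x y"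
proof (rule ccontr)
  assume "\<not> ?thesis"
  then obtain e where e: "cover_radius \<O> y + d x y < e" "e < cover_radius \<O> x"
    using dense not_le by blast
  then obtain U where U: "U \<in> \<O>" "mball x e \<subseteq> U"
    using less_cover_radius assms(1) by blast
  have "mball y (e - d x y) \<subseteq> mball x e"
    using assms by (intro mball_subset) (auto simp: commute)
  then have sub: "mball y (e - d x y) \<subseteq> U" using U(2) by blast
  have "0 \<le> e - d x y" using e(1) cover_radius_nonneg[OF assms(1), of y] by linarith
  moreover have "e - d x y \<le> 1"
    using e(2) cover_radius_le_one[OF assms(1), of x] nonneg[of x y] by linarith
  ultimately have "e - d x y \<le> cover_radius \<O> y"
    using U(1) sub by (rule cover_radius_ge)
  then show False using e by simp
qed

lemma continuous_map_cover_radius: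
  assumes "\<O> \<noteq> {}"
  shows "continuous_map mtopology euclideanreal (cover_radius \<O>)"
proof -
  have "\<exists>\<delta>>0. \<forall>x. x \<in> M \<and> d a x < \<delta> \<longrightarrow> dist (cover_radius \<O> a) (cover_radius \<O> x) < \<epsilon>"
    if "a \<in> M" "0 < \<epsilon>" for a \<epsilon>
  proof (intro exI[of _ \<epsilon>] conjI allI impI)
    fix x assume "x \<in> M \<and> d a x < \<epsilon>"
    then show "dist (cover_radius \<O> a) (cover_radius \<O> x) < \<epsilon>"
      using cover_radius_lipschitz[OF assms, of a x] cover_radius_lipschitz[OF assms, of x a] that(1)
      by (auto simp: dist_real_def commute abs_less_iff)
  qed (use that in auto)
  then have "continuous_map mtopology Met_TC.mtopology (cover_radius \<O>)"
    unfolding metric_continuous_map[OF Met_TC.Metric_space_axioms] by auto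
  then show ?thesis by simp
qed

lemma cover_radius_pos_iff:
  assumes "\<And>U. U \<in> \<O> \<Longrightarrow> openin mtopology U" "\<O> \<noteq> {}" "x \<in> M"
  shows "0 < cover_radius \<O> x \<longleftrightarrow> x \<in> \<Union>\<O>"
proof
  assume r: "0 < cover_radius \<O> x"
  then obtain U where "U \<in> \<O>" "mball x (cover_radius \<O> x / 2) \<subseteq> U"
    using less_cover_radius[of "cover_radius \<O> x / 2" \<O> x] assms(2) by auto
  then show "x \<in> \<Union>\<O>" using r assms(3) centre_in_mball_iff by (metis UnionI half_gt_zero subsetD)
next
  assume "x \<in> \<Union>\<O>"
  then obtain U r where U: "U \<in> \<O>" "0 < r" "mball x r \<subseteq> U"
    using assms(1) unfolding openin_mtopology by blast
  have "mball x (min r 1) \<subseteq> U" using mball_subset_concentric[of "min r 1" r x] U(3) by auto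
  then have "min r 1 \<le> cover_radius \<O> x" using U by (intro cover_radius_ge) auto
  then show "0 < cover_radius \<O> x" using U(2) by auto
qed

text \<open>Let \<open>r\<close> be the radius function and let the balls of radius
  \<open>r / 5\<close> about \<open>y\<close> and \<open>y'\<close> meet. The Lipschitz bound gives
  \<open>d y y' < r y / 2\<close> and \<open>r y' < 3 / 2 * r y\<close>, so the second ball lies in
  the ball about \<open>y\<close> of radius \<open>(1/2 + 3/10) * r y\<close>, that is
  \<open>4/5 * r y\<close>. As 4/5 is less than 1, this ball is inside a member of the cover, which
  serves for all \<open>y'\<close> at once.\<close>

lemma star_refinement_mtopology:
  assumes op: "\<And>U. U \<in> \<O> \<Longrightarrow> openin mtopology U" and cov: "\<Union>\<O> = M"
  shows "\<exists>\<W>. (\<forall>W\<in>\<W>. openin mtopology W) \<and> \<Union>\<W> = M \<and>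
    (\<forall>W\<in>\<W>. \<exists>U\<in>\<O>. \<forall>W'\<in>\<W>. W \<inter> W' \<noteq> {} \<longrightarrow> W' \<subseteq> U)"
proof (cases "\<O> = {}")
  case True
  then show ?thesis using cov by (intro exI[of _ "{}"]) auto
next
  case False
  let ?r = "cover_radius \<O>"
  let ?b = "\<lambda>y. mball y (?r y / 5)"
  have pos: "0 < ?r y" if "y \<in> M" for y
    using cover_radius_pos_iff[OF op False that] that cov by blast
  show ?thesis
  proof (intro exI[of _ "?b ` M"] conjI ballI)
    show "\<Union>(?b ` M) = M" using pos by (auto simp: mball_def)
    fix W assume "W \<in> ?b ` M"
    then obtain y where y: "y \<in> M" "W = ?b y" by blast
    show "openin mtopology W" using y by simp
    obtain U where U: "U \<in> \<O>" "mball y (4 / 5 * ?r y) \<subseteq> U"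
      using less_cover_radius[of "4 / 5 * ?r y" \<O> y] pos[OF y(1)] False by auto
    have "?b y' \<subseteq> U" if y': "y' \<in> M" "?b y \<inter> ?b y' \<noteq> {}" for y'
    proof -
      obtain z where z: "z \<in> M" "d y z < ?r y / 5" "d y' z < ?r y' / 5" using y'(2) by auto
      have "d y y' < ?r y / 5 + ?r y' / 5"
        using z y(1) y'(1) triangle[of y z y'] by (simp add: commute)
      moreover have "?r y' \<le> ?r y + d y y'"
        using cover_radius_lipschitz[OF False y'(1) y(1)] by (simp add: commute)
      ultimately have "d y' y + ?r y' / 5 \<le> 4 / 5 * ?r y"
        using pos[OF y(1)] by (simp add: commute)
      then have "?b y' \<subseteq> mball y (4 / 5 * ?r y)"
        using y(1) by (intro mball_subset) auto
      then show ?thesis using U(2) by blast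
    qed
    then show "\<exists>U\<in>\<O>. \<forall>W'\<in>?b ` M. W \<inter> W' \<noteq> {} \<longrightarrow> W' \<subseteq> U"
      using U(1) y(2) by blast
  qed
qed

text \<open>M. E. Rudin's proof of Stone's theorem: \<open>E n\<close> is the part of the space covered at the
  stages before \<open>n\<close>, and \<open>D U n\<close> is the union of the balls of radius \<open>1 / 2 ^ n\<close> added at
  stage \<open>n\<close> whose centres have \<open>U\<close> as the least member of the cover that contains them.\<close>

lemma locally_finite_refinement_mtopology:
  assumes op: "\<And>U. U \<in> \<O> \<Longrightarrow> openin mtopology U" and cov: "\<Union>\<O> = M"
  shows "\<exists>\<V>. (\<forall>V\<in>\<V>. openin mtopology V \<and> (\<exists>U\<in>\<O>. V \<subseteq> U)) \<and> \<Union>\<V> = M \<and> locally_finite_in mtopology \<V>"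
proof -
  obtain r where r: "well_order_on (UNIV :: 'a set set) r" using well_order_on by blast
  then have wf: "wf (r - Id)" and total: "total r" and antisym: "antisym r"
    by (auto simp: well_order_on_def linear_order_on_def partial_order_on_def)
  have "\<exists>U. U \<in> \<O> \<and> x \<in> U \<and> (\<forall>V\<in>\<O>. x \<in> V \<longrightarrow> V = U \<or> (U, V) \<in> r)" if "x \<in> M" for x
  proof -
    obtain U0 where "U0 \<in> {U \<in> \<O>. x \<in> U}" using cov \<open>x \<in> M\<close> by blast
    then obtain U where U: "U \<in> {U \<in> \<O>. x \<in> U}" "\<And>V. (V, U) \<in> r - Id \<Longrightarrow> V \<notin> {U \<in> \<O>. x \<in> U}"
      by (rule wfE_min[OF wf]) blast
    then show ?thesis using total unfolding total_on_def by blast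
  qed
  then obtain least where least: "\<And>x. x \<in> M \<Longrightarrow> least x \<in> \<O>" "\<And>x. x \<in> M \<Longrightarrow> x \<in> least x"
      "\<And>x V. x \<in> M \<Longrightarrow> V \<in> \<O> \<Longrightarrow> x \<in> V \<Longrightarrow> V = least x \<or> (least x, V) \<in> r"
    by metis
  \<comment> \<open>The factor 3 creates gaps: centres of one stage with different least members are
    at distance at least \<open>3 / 2 ^ n\<close>, and removing a radius \<open>1 / 2 ^ n\<close> at
    both ends leaves more than \<open>1 / 2 ^ n\<close>. The set \<open>A\<close> is a parameter
    because centres and covered parts are defined by a common recursion.\<close>
  define C where "C A n = {x \<in> M. x \<notin> A \<and> mball x (3 / 2 ^ n) \<subseteq> least x}" for A and n :: nat
  define E where "E = rec_nat {} (\<lambda>n A. A \<union> (\<Union>x\<in>C A n. mball x (1 / 2 ^ n)))"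
  define c where "c n = C (E n) n" for n
  have E_Suc: "E (Suc n) = E n \<union> (\<Union>x\<in>c n. mball x (1 / 2 ^ n))" for n
    by (simp add: E_def c_def)
  have E_eq: "E n = (\<Union>i<n. \<Union>x\<in>c i. mball x (1 / 2 ^ i))" for n
  proof (induction n)
    case 0
    show ?case by (simp add: E_def)
  next
    case (Suc n)
    then show ?case unfolding E_Suc lessThan_Suc by blast
  qed
  have c: "x \<in> c n \<longleftrightarrow> x \<in> M \<and> x \<notin> E n \<and> mball x (3 / 2 ^ n) \<subseteq> least x" for x n
    by (simp add: c_def C_def)
  define D where "D U n = (\<Union>x\<in>{x \<in> c n. least x = U}. mball x (1 / 2 ^ n))" for U n
  define \<V> where "\<V> = {D U n | U n. True}"
  have D_open: "openin mtopology (D U n)" for U n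
    unfolding D_def by (intro openin_Union) auto
  have D_sub: "D U n \<subseteq> E (Suc n)" for U n
    by (auto simp: D_def E_Suc)
  have \<V>_refines: "\<exists>U\<in>\<O>. V \<subseteq> U" if V: "V \<in> \<V>" "V \<noteq> {}" for V
  proof -
    obtain U n where D: "V = D U n" using V by (auto simp: \<V>_def)
    then obtain x where x: "x \<in> c n" "least x = U" using V(2) by (auto simp: D_def)
    have "mball y (1 / 2 ^ n) \<subseteq> U" if "y \<in> c n" "least y = U" for y
      using that c[of y n] mball_subset_concentric[of "1 / 2 ^ n" "3 / 2 ^ n" y]
      by (auto simp: divide_right_mono)
    then have "D U n \<subseteq> U" by (auto simp: D_def)
    moreover have "U \<in> \<O>" using x c least(1) by blast
    ultimately show ?thesis using D by blast
  qed
  have covered: "\<exists>U n. x \<in> D U n" if x: "x \<in> M" for x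
  proof -
    have "openin mtopology (least x)" using least(1)[OF x] op by blast
    then obtain e where e: "0 < e" "mball x e \<subseteq> least x"
      using least(2)[OF x] unfolding openin_mtopology by blast
    obtain n where n: "(1 / 2) ^ n < e / 3" using real_arch_pow_inv[of "e / 3" "1 / 2"] e(1) by auto
    have "mball x (3 / 2 ^ n) \<subseteq> least x"
      using mball_subset_concentric[of "3 / 2 ^ n" e x] e(2) n by (auto simp: power_divide)
    show ?thesis
    proof (cases "x \<in> E n")
      case True
      then obtain i y where "y \<in> c i" "x \<in> mball y (1 / 2 ^ i)" by (auto simp: E_eq)
      then have "x \<in> D (least y) i" by (auto simp: D_def)
      then show ?thesis by blast
    next
      case False
      then have "x \<in> c n" using x \<open>mball x (3 / 2 ^ n) \<subseteq> least x\<close> by (simp add: c)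
      then have "x \<in> D (least x) n" using x by (auto simp: D_def)
      then show ?thesis by blast
    qed
  qed
  have separated_le: "1 / 2 ^ i < d y z"
    if y: "y \<in> D U i" and z: "z \<in> D V i" and UV: "U \<noteq> V" "(U, V) \<in> r" for U V i y z
  proof -
    obtain y' where y': "y' \<in> c i" "least y' = U" "y \<in> mball y' (1 / 2 ^ i)" using y by (auto simp: D_def)
    obtain z' where z': "z' \<in> c i" "least z' = V" "z \<in> mball z' (1 / 2 ^ i)" using z by (auto simp: D_def)
    have M: "y' \<in> M" "z' \<in> M" "y \<in> M" "z \<in> M" using y' z' by auto
    \<comment> \<open>\<open>V\<close> is the least member containing \<open>z'\<close> and
      \<open>U\<close> precedes \<open>V\<close>, so \<open>U\<close> cannot contain
      \<open>z'\<close>; the ball of radius \<open>3 / 2 ^ i\<close> about \<open>y'\<close> does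
      lie in \<open>U\<close>.\<close>
    have "z' \<notin> U"
    proof
      assume "z' \<in> U"
      then have "(V, U) \<in> r" using least(1)[of y'] least(3)[of z' U] y' z' M UV(1) by auto
      then show False using UV antisym by (auto dest: antisymD)
    qed
    then have "z' \<notin> mball y' (3 / 2 ^ i)" using y' c by blast
    then have "3 / 2 ^ i \<le> d y' z'" using M by auto
    also have "\<dots> \<le> d y' y + d y z + d z z'"
      using triangle[of y' y z'] triangle[of y z z'] M by simp
    also have "\<dots> < 1 / 2 ^ i + d y z + 1 / 2 ^ i"
      using y' z' by (intro add_strict_mono add_strict_right_mono) (auto simp: commute)
    finally show ?thesis by simp
  qed
  have separated: "1 / 2 ^ i < d y z" if "y \<in> D U i" "z \<in> D V i" "U \<noteq> V" for U V i y z
  proof -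
    have "(U, V) \<in> r \<or> (V, U) \<in> r" using total that(3) by (auto simp: total_on_def)
    then show ?thesis
      using separated_le[OF that(1,2,3)] separated_le[OF that(2,1)] that(3) commute by metis
  qed
  have "\<exists>N. openin mtopology N \<and> x \<in> N \<and> finite {V \<in> \<V>. V \<inter> N \<noteq> {}}" if x: "x \<in> M" for x
  proof -
    obtain U n where "x \<in> D U n" using covered[OF x] by blast
    then obtain e where e: "0 < e" "mball x e \<subseteq> D U n"
      using D_open[of U n] unfolding openin_mtopology by blast
    obtain j where j: "(1 / 2) ^ j < e" using real_arch_pow_inv[of e "1 / 2"] e(1) by auto
    have j_sub: "mball x (1 / 2 ^ j) \<subseteq> E (Suc n)"
      using mball_subset_concentric[of "1 / 2 ^ j" e x] j e(2) D_sub[of U n] by (auto simp: power_divide)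
    \<comment> \<open>This radius serves two purposes. Centres of stages after \<open>n + j\<close>
      avoid the ball of radius \<open>1 / 2 ^ j\<close>, and two radii of at most
      \<open>1 / 2 ^ (j + 1)\<close> cannot bridge that distance. For the stages up to
      \<open>n + j\<close>, any two points of \<open>N\<close> are closer than the gap, so
      \<open>N\<close> meets at most one set per stage.\<close>
    define N where "N = mball x (1 / 2 ^ (n + j + 1))"
    have late: "D W i \<inter> N = {}" if i: "n + j < i" for W i
    proof (rule ccontr)
      assume "D W i \<inter> N \<noteq> {}"
      then obtain y z where y: "y \<in> c i" "z \<in> mball y (1 / 2 ^ i)" "z \<in> N"
        unfolding D_def by blast
      have "E (Suc n) \<subseteq> E i" using i by (fastforce simp: E_eq)
      then have "y \<notin> mball x (1 / 2 ^ j)" using y(1) c j_sub by blast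
      then have "1 / 2 ^ j \<le> d x y" using x y(2) by auto
      also have "\<dots> \<le> d x z + d z y" using x y by (intro triangle) auto
      also have "\<dots> < 1 / 2 ^ (n + j + 1) + 1 / 2 ^ i"
        using y by (intro add_strict_mono) (auto simp: N_def commute)
      also have "\<dots> \<le> 1 / 2 ^ (j + 1) + 1 / 2 ^ (j + 1)"
        using i by (intro add_mono divide_left_mono power_increasing) auto
      also have "\<dots> = 1 / 2 ^ j" by simp
      finally show False by simp
    qed
    have early: "W = W'" if i: "i \<le> n + j" and W: "D W i \<inter> N \<noteq> {}" "D W' i \<inter> N \<noteq> {}" for W W' i
    proof (rule ccontr)
      assume "W \<noteq> W'"
      obtain y z where yz: "y \<in> D W i" "y \<in> N" "z \<in> D W' i" "z \<in> N" using W by blast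
      have "1 / 2 ^ i < d y z" using separated[OF yz(1,3) \<open>W \<noteq> W'\<close>] .
      also have "\<dots> \<le> d y x + d x z" using yz by (intro triangle) (auto simp: N_def)
      also have "\<dots> < 1 / 2 ^ (n + j + 1) + 1 / 2 ^ (n + j + 1)"
        using yz by (intro add_strict_mono) (auto simp: N_def commute)
      also have "\<dots> = 1 / 2 ^ (n + j)" by simp
      also have "\<dots> \<le> 1 / 2 ^ i" using i by (intro divide_left_mono power_increasing) auto
      finally show False by simp
    qed
    have "finite {D W i | W. D W i \<inter> N \<noteq> {}}" if "i \<le> n + j" for i
    proof (cases "\<exists>W. D W i \<inter> N \<noteq> {}")
      case True
      then obtain W where "D W i \<inter> N \<noteq> {}" by blast
      then have "{D W i | W. D W i \<inter> N \<noteq> {}} \<subseteq> {D W i}" using early[OF that] by blast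
      then show ?thesis by (rule finite_subset) simp
    qed auto
    then have "finite (\<Union>i\<le>n + j. {D W i | W. D W i \<inter> N \<noteq> {}})" by simp
    moreover have "{V \<in> \<V>. V \<inter> N \<noteq> {}} \<subseteq> (\<Union>i\<le>n + j. {D W i | W. D W i \<inter> N \<noteq> {}})"
    proof
      fix V assume "V \<in> {V \<in> \<V>. V \<inter> N \<noteq> {}}"
      then obtain W i where "V = D W i" "D W i \<inter> N \<noteq> {}" by (auto simp: \<V>_def)
      then show "V \<in> (\<Union>i\<le>n + j. {D W i | W. D W i \<inter> N \<noteq> {}})"
        using late[of i W] by (intro UN_I[of i]) (auto simp: not_less)
    qed
    ultimately have "finite {V \<in> \<V>. V \<inter> N \<noteq> {}}" by (rule rev_finite_subset)
    then show ?thesis using x by (intro exI[of _ N]) (auto simp: N_def)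
  qed
  moreover have \<V>_open: "openin mtopology V" if "V \<in> \<V>" for V
    using that D_open by (auto simp: \<V>_def)
  moreover have \<V>_M: "\<Union>\<V> = M"
  proof
    show "\<Union>\<V> \<subseteq> M" using \<V>_open openin_subset by fastforce
    show "M \<subseteq> \<Union>\<V>" using covered by (fastforce simp: \<V>_def)
  qed
  ultimately have "locally_finite_in mtopology \<V>"
    unfolding locally_finite_in_def by simp
  \<comment> \<open>The sets \<open>D U n\<close> are indexed by arbitrary \<open>U\<close>, so many
    are empty; only the nonempty ones were shown to lie in a member of \<open>\<O>\<close>.\<close>
  then have "locally_finite_in mtopology (\<V> - {{}})"
    by (rule locally_finite_in_subset) auto
  then show ?thesis
    using \<V>_refines \<V>_open \<V>_M by (intro exI[of _ "\<V> - {{}}"]) auto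
qed

end

lemma metrizable_star_refinement:
  assumes "metrizable_space X" "\<And>U. U \<in> \<O> \<Longrightarrow> openin X U" "\<Union>\<O> = topspace X"
  obtains \<W> where "\<And>W. W \<in> \<W> \<Longrightarrow> openin X W" "\<Union>\<W> = topspace X"
    "\<And>W. W \<in> \<W> \<Longrightarrow> \<exists>U\<in>\<O>. \<forall>W'\<in>\<W>. W \<inter> W' \<noteq> {} \<longrightarrow> W' \<subseteq> U"
proof -
  obtain M d where Md: "Metric_space M d" "X = Metric_space.mtopology M d"
    using assms(1) unfolding metrizable_space_def by blast
  then interpret Metric_space M d by simp
  show ?thesis
    using star_refinement_mtopology[of \<O>] assms(2,3) that unfolding Md(2) topspace_mtopology by metis
qed

lemma metrizable_locally_finite_refinement:
  assumes "metrizable_space X" "\<And>U. U \<in> \<O> \<Longrightarrow> openin X U" "\<Union>\<O> = topspace X"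
  obtains \<V> where "\<And>V. V \<in> \<V> \<Longrightarrow> openin X V" "\<And>V. V \<in> \<V> \<Longrightarrow> \<exists>U\<in>\<O>. V \<subseteq> U"
    "\<Union>\<V> = topspace X" "locally_finite_in X \<V>"
proof -
  obtain M d where Md: "Metric_space M d" "X = Metric_space.mtopology M d"
    using assms(1) unfolding metrizable_space_def by blast
  then interpret Metric_space M d by simp
  show ?thesis
    using locally_finite_refinement_mtopology[of \<O>] assms(2,3) that unfolding Md(2) topspace_mtopology
    by metis
qed

section \<open>Partitions of unity and maps into nerves\<close>

lemma continuous_map_locally_finite_sum:
  fixes g :: "'a set \<Rightarrow> 'a \<Rightarrow> real"
  assumes fin: "locally_finite_in X \<U>"
    and cont: "\<And>U. U \<in> \<U> \<Longrightarrow> continuous_map X euclideanreal (g U)"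
    and supp: "\<And>U y. U \<in> \<U> \<Longrightarrow> y \<in> topspace X \<Longrightarrow> g U y \<noteq> 0 \<Longrightarrow> y \<in> U"
  shows "continuous_map X euclideanreal (\<lambda>y. \<Sum>U\<in>{U \<in> \<U>. g U y \<noteq> 0}. g U y)"
proof (rule continuous_map_locally)
  fix x assume "x \<in> topspace X"
  then obtain N where N: "openin X N" "x \<in> N" "finite {U \<in> \<U>. U \<inter> N \<noteq> {}}"
    using fin unfolding locally_finite_in_def by blast
  let ?F = "{U \<in> \<U>. U \<inter> N \<noteq> {}}"
  have "continuous_map X euclideanreal (\<lambda>y. \<Sum>U\<in>?F. g U y)"
    using N(3) cont by (intro continuous_map_sum) auto
  moreover have "(\<Sum>U\<in>{U \<in> \<U>. g U z \<noteq> 0}. g U z) = (\<Sum>U\<in>?F. g U z)" if "z \<in> N" for z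
  proof (rule sum.mono_neutral_left[OF N(3)])
    have "z \<in> topspace X" using N(1) that openin_subset by blast
    then show "{U \<in> \<U>. g U z \<noteq> 0} \<subseteq> ?F" using supp that by blast
  qed auto
  ultimately show "\<exists>N h. openin X N \<and> x \<in> N \<and> continuous_map X euclideanreal h \<and>
      (\<forall>z\<in>N. (\<Sum>U\<in>{U \<in> \<U>. g U z \<noteq> 0}. g U z) = h z)"
    using N by blast
qed

lemma locally_finite_in_finite_nonzero:
  fixes g :: "'a set \<Rightarrow> 'a \<Rightarrow> real"
  assumes "locally_finite_in X \<U>" "y \<in> topspace X" "\<And>U. U \<in> \<U> \<Longrightarrow> g U y \<noteq> 0 \<Longrightarrow> y \<in> U"
  shows "finite {U \<in> \<U>. g U y \<noteq> 0}"
proof -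
  obtain N where "y \<in> N" "finite {U \<in> \<U>. U \<inter> N \<noteq> {}}"
    using assms(1,2) unfolding locally_finite_in_def by blast
  then show ?thesis by (rule_tac finite_subset[rotated]) (use assms(3) in blast)+
qed

context Metric_space
begin

text \<open>The functions \<open>cover_radius {U}\<close> vanish outside \<open>U\<close>, but their supports may touch the boundary
  of \<open>U\<close>; subtracting half of their supremum \<open>cover_radius \<U>\<close> moves the supports inside.\<close>

lemma ex_subordinate_functions:
  assumes op: "\<And>U. U \<in> \<U> \<Longrightarrow> openin mtopology U" and cov: "\<Union>\<U> = M" and ne: "\<U> \<noteq> {}"
  obtains g :: "'a set \<Rightarrow> 'a \<Rightarrow> real"
  where "\<And>U. U \<in> \<U> \<Longrightarrow> continuous_map mtopology euclideanreal (g U)" "\<And>U y. 0 \<le> g U y"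
    "\<And>U. U \<in> \<U> \<Longrightarrow> mtopology closure_of {y \<in> M. g U y \<noteq> 0} \<subseteq> U"
    "\<And>y. y \<in> M \<Longrightarrow> \<exists>U\<in>\<U>. 0 < g U y"
proof -
  let ?m = "cover_radius \<U>"
  let ?g = "\<lambda>U y. max 0 (cover_radius {U} y - ?m y / 2)"
  have m: "0 < ?m y" if "y \<in> M" for y
    using cover_radius_pos_iff[OF op ne] that cov by blast
  show ?thesis
  proof (rule that[of ?g])
    fix U assume U: "U \<in> \<U>"
    have c: "continuous_map mtopology euclideanreal (\<lambda>y. cover_radius {U} y - ?m y / 2)"
      by (intro continuous_intros continuous_map_cover_radius ne) auto
    then show "continuous_map mtopology euclideanreal (?g U)"
      by (intro continuous_map_real_max) auto
    have "closedin mtopology {y \<in> topspace mtopology. cover_radius {U} y - ?m y / 2 \<in> {0..}}"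
      by (rule closedin_continuous_map_preimage[OF c]) auto
    then have "mtopology closure_of {y \<in> M. ?g U y \<noteq> 0} \<subseteq>
        {y \<in> topspace mtopology. cover_radius {U} y - ?m y / 2 \<in> {0..}}"
      by (intro closure_of_minimal) auto
    also have "\<dots> \<subseteq> U"
    proof
      fix y assume y: "y \<in> {y \<in> topspace mtopology. cover_radius {U} y - ?m y / 2 \<in> {0..}}"
      then have "0 < cover_radius {U} y" using m[of y] by auto
      then show "y \<in> U" using cover_radius_pos_iff[of "{U}" y] op[OF U] y by auto
    qed
    finally show "mtopology closure_of {y \<in> M. ?g U y \<noteq> 0} \<subseteq> U" .
  next
    fix y assume y: "y \<in> M"
    \<comment> \<open>Any factor strictly between 1/2 and 1 works: below 1 some member contains the
      ball, above 1/2 the function of that member is positive at \<open>y\<close>.\<close>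
    then have "3 / 4 * ?m y < ?m y" using m by simp
    then obtain U where U: "U \<in> \<U>" "mball y (3 / 4 * ?m y) \<subseteq> U"
      using less_cover_radius ne by blast
    have "3 / 4 * ?m y \<le> cover_radius {U} y"
      using U(2) m[OF y] cover_radius_le_one[OF ne, of y] by (intro cover_radius_ge[of _ U]) auto
    then show "\<exists>U\<in>\<U>. 0 < ?g U y" using U(1) m[OF y] by (intro bexI[of _ U]) auto
  qed auto
qed

lemma ex_bump_function:
  assumes "openin mtopology U" "x \<in> U"
  obtains h :: "'a \<Rightarrow> real" where "continuous_map mtopology euclideanreal h" "\<And>y. 0 \<le> h y"
    "\<And>y. y \<in> M \<Longrightarrow> h y \<le> 1" "h x = 1" "mtopology closure_of {y \<in> M. h y \<noteq> 0} \<subseteq> U"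
proof -
  obtain e where e: "0 < e" "mball x e \<subseteq> U" and x: "x \<in> M"
    using assms unfolding openin_mtopology by blast
  have d: "continuous_map mtopology euclideanreal (d x)"
  proof -
    have "\<exists>\<delta>>0. \<forall>y. y \<in> M \<and> d a y < \<delta> \<longrightarrow> dist (d x a) (d x y) < \<epsilon>" if "a \<in> M" "0 < \<epsilon>" for a \<epsilon>
      using that mdist_reverse_triangle[of a x] x
      by (intro exI[of _ \<epsilon>]) (fastforce simp: dist_real_def commute)
    then have "continuous_map mtopology Met_TC.mtopology (d x)"
      unfolding metric_continuous_map[OF Met_TC.Metric_space_axioms] by auto
    then show ?thesis by simp
  qed
  show ?thesis
  \<comment> \<open>The function vanishes from distance \<open>e / 2\<close> on, so its support lies
    in a closed ball inside the open ball of radius \<open>e\<close>.\<close>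
  proof (rule that[of "\<lambda>y. max 0 (1 - 2 * d x y / e)"])
    show "continuous_map mtopology euclideanreal (\<lambda>y. max 0 (1 - 2 * d x y / e))"
      by (intro continuous_intros d) (use e in auto)
    have "closedin mtopology {y \<in> topspace mtopology. d x y \<in> {..e / 2}}"
      by (rule closedin_continuous_map_preimage[OF d]) auto
    then have "mtopology closure_of {y \<in> M. max 0 (1 - 2 * d x y / e) \<noteq> 0} \<subseteq>
        {y \<in> topspace mtopology. d x y \<in> {..e / 2}}"
      using e(1) by (intro closure_of_minimal) (auto simp: field_simps max_def split: if_splits)
    also have "\<dots> \<subseteq> U" using e x by (auto intro!: subsetD[OF e(2)])
    finally show "mtopology closure_of {y \<in> M. max 0 (1 - 2 * d x y / e) \<noteq> 0} \<subseteq> U" .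
  qed (use e x in auto)
qed

text \<open>A normalized family \<open>g U / s\<close> need not take the value 1 at
  \<open>x\<close>, since \<open>x\<close> may lie in several members. It is blended with a bump
  function \<open>h\<close> at \<open>x\<close> supported in \<open>U0\<close>: with weights
  \<open>1 - h\<close> and \<open>h\<close> the sum remains 1, and at \<open>x\<close> everything is
  concentrated on \<open>U0\<close>.\<close>

lemma ex_pointed_partition_of_unity_mtopology:
  assumes "(\<U>, U0) \<in> pointed_covers mtopology x"
  shows "\<exists>\<phi>. pointed_partition_of_unity mtopology x (\<U>, U0) \<phi>"
proof -
  have fin: "locally_finite_in mtopology \<U>" and op: "\<And>U. U \<in> \<U> \<Longrightarrow> openin mtopology U"
    and cov: "\<Union>\<U> = M" and U0: "U0 \<in> \<U>" "x \<in> U0"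
    using assms by (auto simp: pointed_covers_def)
  obtain g :: "'a set \<Rightarrow> 'a \<Rightarrow> real" where g: "\<And>U. U \<in> \<U> \<Longrightarrow> continuous_map mtopology euclideanreal (g U)"
      "\<And>U y. 0 \<le> g U y" "\<And>U. U \<in> \<U> \<Longrightarrow> mtopology closure_of {y \<in> M. g U y \<noteq> 0} \<subseteq> U"
      "\<And>y. y \<in> M \<Longrightarrow> \<exists>U\<in>\<U>. 0 < g U y"
    using ex_subordinate_functions[OF op cov] U0(1) by blast
  obtain h :: "'a \<Rightarrow> real" where h: "continuous_map mtopology euclideanreal h" "\<And>y. 0 \<le> h y"
      "\<And>y. y \<in> M \<Longrightarrow> h y \<le> 1" "h x = 1" "mtopology closure_of {y \<in> M. h y \<noteq> 0} \<subseteq> U0"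
    using ex_bump_function[OF op[OF U0(1)] U0(2)] by blast
  have g_supp: "y \<in> U" if "U \<in> \<U>" "y \<in> M" "g U y \<noteq> 0" for U y
    using g(3)[OF that(1)] closure_of_subset[of "{y \<in> M. g U y \<noteq> 0}" mtopology] that by auto
  define s where "s y = (\<Sum>U\<in>{U \<in> \<U>. g U y \<noteq> 0}. g U y)" for y
  have s_cont: "continuous_map mtopology euclideanreal s"
    unfolding s_def by (rule continuous_map_locally_finite_sum[OF fin g(1)]) (use g_supp in auto)
  have g_fin: "finite {U \<in> \<U>. g U y \<noteq> 0}" if "y \<in> M" for y
    by (rule locally_finite_in_finite_nonzero[OF fin]) (use that g_supp in auto)
  have s_pos: "0 < s y" if "y \<in> M" for y
  proof -
    obtain U where "U \<in> \<U>" "0 < g U y" using g(4)[OF \<open>y \<in> M\<close>] by blast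
    then show ?thesis
      unfolding s_def by (intro sum_pos2[OF g_fin[OF that], of U]) (use g(2) in auto)
  qed
  define \<phi> where "\<phi> U y = (1 - h y) * (g U y / s y) + (if U = U0 then h y else 0)" for U y
  have "continuous_map mtopology euclideanreal (\<phi> U)" if "U \<in> \<U>" for U
  proof -
    have "continuous_map mtopology euclideanreal (\<lambda>y. if U = U0 then h y else 0)"
      using h(1) by (cases "U = U0") auto
    then show ?thesis
      unfolding \<phi>_def by (intro continuous_intros h(1) g(1)[OF that] s_cont) (use s_pos in force)+
  qed
  moreover have "0 \<le> \<phi> U y" if "y \<in> M" for U y
    using that h(2,3) g(2) s_pos[OF that] by (auto simp: \<phi>_def intro!: add_nonneg_nonneg mult_nonneg_nonneg divide_nonneg_pos)
  moreover have "mtopology closure_of {y \<in> M. \<phi> U y \<noteq> 0} \<subseteq> U" if "U \<in> \<U>" for U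
  proof -
    have "{y \<in> M. \<phi> U y \<noteq> 0} \<subseteq> {y \<in> M. g U y \<noteq> 0} \<union> (if U = U0 then {y \<in> M. h y \<noteq> 0} else {})"
      by (auto simp: \<phi>_def)
    then have "mtopology closure_of {y \<in> M. \<phi> U y \<noteq> 0} \<subseteq>
        mtopology closure_of ({y \<in> M. g U y \<noteq> 0} \<union> (if U = U0 then {y \<in> M. h y \<noteq> 0} else {}))"
      by (rule closure_of_mono)
    also have "\<dots> \<subseteq> U"
      using g(3)[OF that] h(5) unfolding closure_of_Un by (cases "U = U0") auto
    finally show ?thesis .
  qed
  moreover have "(\<Sum>U\<in>{U \<in> \<U>. \<phi> U y \<noteq> 0}. \<phi> U y) = 1" if y: "y \<in> M" for y
  proof -
    let ?F = "insert U0 {U \<in> \<U>. g U y \<noteq> 0}"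
    have F: "finite ?F" using g_fin[OF y] by simp
    have "(\<Sum>U\<in>{U \<in> \<U>. \<phi> U y \<noteq> 0}. \<phi> U y) = (\<Sum>U\<in>?F. \<phi> U y)"
      by (rule sum.mono_neutral_left[OF F]) (use U0(1) in \<open>auto simp: \<phi>_def\<close>)
    also have "\<dots> = (1 - h y) * ((\<Sum>U\<in>?F. g U y) / s y) + (\<Sum>U\<in>?F. if U = U0 then h y else 0)"
      unfolding \<phi>_def by (simp add: sum.distrib sum_distrib_left sum_divide_distrib del: sum.insert_remove)
    also have "(\<Sum>U\<in>?F. if U = U0 then h y else 0) = h y"
      using F by (subst sum.delta) auto
    also have "(\<Sum>U\<in>?F. g U y) = s y"
      unfolding s_def by (rule sum.mono_neutral_right[OF F]) (use U0(1) in auto)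
    finally show ?thesis using s_pos[OF y] by simp
  qed
  moreover have "\<phi> U0 x = 1" using h(4) by (simp add: \<phi>_def)
  ultimately show ?thesis
    unfolding pointed_partition_of_unity_def by (intro exI[of _ \<phi>]) simp
qed

end

lemma ex_pointed_partition_of_unity:
  assumes "metrizable_space X" "c \<in> pointed_covers X x"
  shows "\<exists>\<phi>. pointed_partition_of_unity X x c \<phi>"
proof -
  obtain M d where Md: "Metric_space M d" "X = Metric_space.mtopology M d"
    using assms(1) unfolding metrizable_space_def by blast
  then interpret Metric_space M d by simp
  show ?thesis
    using ex_pointed_partition_of_unity_mtopology assms(2) Md(2) by (cases c) auto
qed

lemma pointed_coversD:
  assumes "c \<in> pointed_covers X x"
  shows "locally_finite_in X (fst c)" "\<And>U. U \<in> fst c \<Longrightarrow> openin X U" "\<Union>(fst c) = topspace X"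
    "snd c \<in> fst c" "x \<in> snd c"
  using assms by (auto simp: pointed_covers_def)

lemma pointed_partition_of_unityD:
  assumes "pointed_partition_of_unity X x c \<phi>"
  shows "\<And>U. U \<in> fst c \<Longrightarrow> continuous_map X euclideanreal (\<phi> U)"
    "\<And>U y. U \<in> fst c \<Longrightarrow> y \<in> topspace X \<Longrightarrow> 0 \<le> \<phi> U y"
    "\<And>U. U \<in> fst c \<Longrightarrow> X closure_of {y \<in> topspace X. \<phi> U y \<noteq> 0} \<subseteq> U"
    "\<And>y. y \<in> topspace X \<Longrightarrow> (\<Sum>U\<in>{U \<in> fst c. \<phi> U y \<noteq> 0}. \<phi> U y) = 1"
    "\<phi> (snd c) x = 1"
  using assms unfolding pointed_partition_of_unity_def case_prod_unfold by blast+

section \<open>Maps into nerves\<close>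

lemma nerve_map_nonzero: "{U. nerve_map \<U> \<phi> y U \<noteq> 0} = {U \<in> \<U>. \<phi> U y \<noteq> 0}"
  by (auto simp: nerve_map_def)

lemma mem_if_nerve_map_nonzero:
  assumes "pointed_partition_of_unity X x c \<phi>" "y \<in> topspace X" "nerve_map (fst c) \<phi> y U \<noteq> 0"
  shows "y \<in> U"
proof -
  have U: "U \<in> fst c" "\<phi> U y \<noteq> 0" using assms(3) by (auto simp: nerve_map_def split: if_splits)
  have "y \<in> X closure_of {y \<in> topspace X. \<phi> U y \<noteq> 0}"
    using closure_of_subset[of "{y \<in> topspace X. \<phi> U y \<noteq> 0}" X] U(2) assms(2) by auto
  then show ?thesis using pointed_partition_of_unityD(3)[OF assms(1) U(1)] by blast
qed

lemma barycentric_map_nerve_map: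
  assumes c: "c \<in> pointed_covers X x" and \<phi>: "pointed_partition_of_unity X x c \<phi>"
  shows "barycentric_map X (nerve (fst c)) (nerve_map (fst c) \<phi>)"
  unfolding barycentric_map_def
proof (intro conjI allI ballI)
  show "continuous_map X euclideanreal (\<lambda>y. nerve_map (fst c) \<phi> y U)" for U
    unfolding nerve_map_def using pointed_partition_of_unityD(1)[OF \<phi>] by (cases "U \<in> fst c") auto
  fix y assume y: "y \<in> topspace X"
  obtain N where N: "openin X N" "y \<in> N" "finite {U \<in> fst c. U \<inter> N \<noteq> {}}"
    using pointed_coversD(1)[OF c] y unfolding locally_finite_in_def by blast
  have sub: "{U. nerve_map (fst c) \<phi> z U \<noteq> 0} \<subseteq> {U \<in> fst c. U \<inter> N \<noteq> {}}" if "z \<in> N" for z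
  proof -
    have "z \<in> topspace X" using that N(1) openin_subset by blast
    then show ?thesis
      using mem_if_nerve_map_nonzero[OF \<phi>] that nerve_map_nonzero by fastforce
  qed
  then show "\<exists>N F. openin X N \<and> y \<in> N \<and> finite F \<and> (\<forall>z\<in>N. {U. nerve_map (fst c) \<phi> z U \<noteq> 0} \<subseteq> F)"
    using N by blast
  let ?S = "{U. nerve_map (fst c) \<phi> y U \<noteq> 0}"
  have sum: "sum (nerve_map (fst c) \<phi> y) ?S = 1"
    using pointed_partition_of_unityD(4)[OF \<phi> y] unfolding nerve_map_nonzero
    by (simp add: nerve_map_def cong: sum.cong_simp)
  have "?S \<in> nerve (fst c)"
    unfolding nerve_def
  proof (intro CollectI conjI)
    show "finite ?S" using finite_subset[OF sub N(3)] N(2) by blast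
    show "?S \<noteq> {}" using sum by (metis sum.empty zero_neq_one)
    show "?S \<subseteq> fst c" by (auto simp: nerve_map_nonzero)
    have "y \<in> \<Inter>?S" using mem_if_nerve_map_nonzero[OF \<phi> y] by blast
    then show "\<Inter>?S \<noteq> {}" by blast
  qed
  moreover have "0 \<le> nerve_map (fst c) \<phi> y U" for U
    using pointed_partition_of_unityD(2)[OF \<phi>] y by (simp add: nerve_map_def)
  ultimately show "nerve_map (fst c) \<phi> y \<in> topspace (realization (nerve (fst c)))"
    using sum by (simp add: mem_realization_iff_support[OF simplicial_complex_nerve])
qed

text \<open>The coordinates are nonnegative with sum 1, and the one at the distinguished member is
  already 1.\<close>

lemma nerve_map_basepoint:
  assumes c: "c \<in> pointed_covers X x" and \<phi>: "pointed_partition_of_unity X x c \<phi>"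
  shows "nerve_map (fst c) \<phi> x = vertex (snd c)"
proof -
  have x: "x \<in> topspace X" using pointed_coversD[OF c] by blast
  let ?S = "{U \<in> fst c. \<phi> U x \<noteq> 0}"
  have "?S \<in> nerve (fst c)"
    using barycentric_map_nerve_map[OF c \<phi>] x mem_realization_iff_support[OF simplicial_complex_nerve]
    unfolding barycentric_map_def nerve_map_nonzero[symmetric] by blast
  then have fin: "finite ?S" by (simp add: nerve_def)
  have U0: "snd c \<in> ?S" using pointed_coversD(4)[OF c] pointed_partition_of_unityD(5)[OF \<phi>] by simp
  have "sum (\<lambda>U. \<phi> U x) (?S - {snd c}) = 0"
    using sum.remove[OF fin U0, of "\<lambda>U. \<phi> U x"] pointed_partition_of_unityD(4,5)[OF \<phi>] x by simp
  moreover have "\<And>U. U \<in> ?S - {snd c} \<Longrightarrow> 0 \<le> \<phi> U x"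
    using pointed_partition_of_unityD(2)[OF \<phi>] x by blast
  ultimately have "\<forall>U\<in>?S - {snd c}. \<phi> U x = 0"
    using sum_nonneg_eq_0_iff[of "?S - {snd c}" "\<lambda>U. \<phi> U x"] fin by simp
  then show ?thesis
    using U0 pointed_partition_of_unityD(5)[OF \<phi>] by (fastforce simp: nerve_map_def vertex_def)
qed

text \<open>The contiguity criterion for maps into nerves: a point common to all members of both
  simplices witnesses that together they span a simplex.\<close>

lemma nerve_Un:
  assumes "\<sigma> \<in> nerve \<U>" "\<tau> \<in> nerve \<U>" "y \<in> \<Inter>\<sigma>" "y \<in> \<Inter>\<tau>"
  shows "\<sigma> \<union> \<tau> \<in> nerve \<U>"
  using assms unfolding nerve_def by blast

section \<open>The canonical homomorphism to the first shape group\<close>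

text \<open>\<open>shape_hom\<close> picks its partition by \<open>SOME\<close>; the three facts
  concern this one choice, so they can be used together after naming it.\<close>

lemma shape_hom_loop_class:
  assumes X: "metrizable_space X" and c: "c \<in> pointed_covers X x" and \<alpha>: "\<alpha> \<in> loops X x"
  defines "\<phi> \<equiv> SOME \<phi>. pointed_partition_of_unity X x c \<phi>"
  shows "pointed_partition_of_unity X x c \<phi>"
    and "shape_hom X x (loop_class X x \<alpha>) c =
      loop_class (realization (nerve (fst c))) (vertex (snd c)) (compose {0..1} (nerve_map (fst c) \<phi>) \<alpha>)"
    and "compose {0..1} (nerve_map (fst c) \<phi>) \<alpha> \<in> loops (realization (nerve (fst c))) (vertex (snd c))"
proof -
  show \<phi>: "pointed_partition_of_unity X x c \<phi>"
    unfolding \<phi>_def using ex_pointed_partition_of_unity[OF X c] by (rule someI_ex)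
  have cont: "continuous_map X (realization (nerve (fst c))) (nerve_map (fst c) \<phi>)"
    by (intro barycentric_map_imp_continuous simplicial_complex_nerve barycentric_map_nerve_map[OF c \<phi>])
  then show "shape_hom X x (loop_class X x \<alpha>) c =
      loop_class (realization (nerve (fst c))) (vertex (snd c)) (compose {0..1} (nerve_map (fst c) \<phi>) \<alpha>)"
    using c induced_hom_loop_class[OF \<alpha> cont nerve_map_basepoint[OF c \<phi>]]
    by (simp add: shape_hom_def \<phi>_def)
  show "compose {0..1} (nerve_map (fst c) \<phi>) \<alpha> \<in> loops (realization (nerve (fst c))) (vertex (snd c))"
    by (rule compose_in_loops[OF \<alpha> cont nerve_map_basepoint[OF c \<phi>]])
qed

lemma ex_refinement_projection:
  assumes "refines d c" "snd c \<in> fst c"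
  shows "\<exists>f. refinement_projection d c f"
proof -
  have "\<forall>V\<in>fst d. \<exists>U\<in>fst c. V \<subseteq> U" and V0: "snd d \<subseteq> snd c"
    using assms(1) by (auto simp: refines_def case_prod_unfold)
  then obtain f where "\<forall>V\<in>fst d. f V \<in> fst c \<and> V \<subseteq> f V" by metis
  then show ?thesis
    using V0 assms(2) unfolding refinement_projection_def case_prod_unfold
    by (intro exI[of _ "f(snd d := snd c)"]) auto
qed

lemma refinement_projection_nerve:
  assumes f: "refinement_projection d c f" and \<sigma>: "\<sigma> \<in> nerve (fst d)"
  shows "f ` \<sigma> \<in> nerve (fst c)"
proof -
  have "\<Inter>\<sigma> \<subseteq> \<Inter>(f ` \<sigma>)"
    using f \<sigma> by (fastforce simp: refinement_projection_def nerve_def case_prod_unfold)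
  then show ?thesis
    using f \<sigma> by (auto simp: refinement_projection_def nerve_def case_prod_unfold)
qed

text \<open>The map into the coarse nerve and the projected map into the fine one are contiguous
  along \<open>\<alpha>\<close>: whenever one of their coordinates at \<open>U\<close> is nonzero at
  time \<open>t\<close>, \<open>U\<close> contains \<open>\<alpha> t\<close>.\<close>

lemma bonding_hom_shape_hom:
  assumes X: "metrizable_space X" and c: "c \<in> pointed_covers X x" and d: "d \<in> pointed_covers X x"
    and r: "refines d c" and \<alpha>: "\<alpha> \<in> loops X x"
  shows "bonding_hom c d (shape_hom X x (loop_class X x \<alpha>) d) = shape_hom X x (loop_class X x \<alpha>) c"
proof -
  define f where "f = (SOME f. refinement_projection d c f)"
  have f: "refinement_projection d c f"
    unfolding f_def using ex_refinement_projection[OF r pointed_coversD(4)[OF c]] by (rule someI_ex)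
  define \<phi> where "\<phi> = (SOME \<phi>. pointed_partition_of_unity X x c \<phi>)"
  define \<psi> where "\<psi> = (SOME \<psi>. pointed_partition_of_unity X x d \<psi>)"
  note \<phi> = shape_hom_loop_class[OF X c \<alpha>, folded \<phi>_def]
  note \<psi> = shape_hom_loop_class[OF X d \<alpha>, folded \<psi>_def]
  let ?p = "nerve_map (fst c) \<phi> \<circ> \<alpha>" and ?q = "linear_extension f \<circ> (nerve_map (fst d) \<psi> \<circ> \<alpha>)"
  note K = simplicial_complex_nerve
  have \<alpha>_cont: "continuous_map (top_of_set {0..1}) X \<alpha>"
    using loops_pathin[OF \<alpha>] by (simp add: pathin_def)
  have fV0: "f (snd d) = snd c"
    using f by (simp add: refinement_projection_def case_prod_unfold)
  have lin: "continuous_map (realization (nerve (fst d))) (realization (nerve (fst c))) (linear_extension f)"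
    by (rule continuous_map_linear_extension[OF K K refinement_projection_nerve[OF f]])
  have p: "barycentric_map (top_of_set {0..1}) (nerve (fst c)) ?p"
    by (rule barycentric_map_compose[OF barycentric_map_nerve_map[OF c \<phi>(1)] \<alpha>_cont])
  have q: "barycentric_map (top_of_set {0..1}) (nerve (fst c)) ?q"
    by (rule barycentric_map_linear_extension[OF K _ refinement_projection_nerve[OF f]],
        rule barycentric_map_compose[OF barycentric_map_nerve_map[OF d \<psi>(1)] \<alpha>_cont])
  have "path_homotopic (realization (nerve (fst c))) ?q ?p"
  proof (rule path_homotopic_barycentric_maps[OF K q p])
    fix t :: real assume t: "t \<in> {0..1}"
    have \<alpha>t: "\<alpha> t \<in> topspace X" using path_image_subset_topspace[OF loops_pathin[OF \<alpha>]] t by blast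
    have "{U. ?p t U \<noteq> 0} \<in> nerve (fst c)" "{U. ?q t U \<noteq> 0} \<in> nerve (fst c)"
      using barycentric_map_support[OF K p] barycentric_map_support[OF K q] t by auto
    moreover have "\<alpha> t \<in> \<Inter>{U. ?p t U \<noteq> 0}"
      using mem_if_nerve_map_nonzero[OF \<phi>(1) \<alpha>t] by auto
    moreover have "\<alpha> t \<in> \<Inter>{U. ?q t U \<noteq> 0}"
    proof
      fix U assume "U \<in> {U. ?q t U \<noteq> 0}"
      then have "{V. nerve_map (fst d) \<psi> (\<alpha> t) V \<noteq> 0 \<and> f V = U} \<noteq> {}"
        by (auto simp: linear_extension_def elim: sum.not_neutral_contains_not_neutral)
      then obtain V where V: "nerve_map (fst d) \<psi> (\<alpha> t) V \<noteq> 0" "f V = U" by blast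
      then have "\<alpha> t \<in> V" using mem_if_nerve_map_nonzero[OF \<psi>(1) \<alpha>t] by blast
      moreover have "V \<in> fst d" using V(1) by (auto simp: nerve_map_def split: if_splits)
      ultimately show "\<alpha> t \<in> U"
        using f V(2) by (auto simp: refinement_projection_def case_prod_unfold)
    qed
    ultimately show "{U. ?q t U \<noteq> 0} \<union> {U. ?p t U \<noteq> 0} \<in> nerve (fst c)"
      by (intro nerve_Un[of _ _ _ "\<alpha> t"])
  qed (use nerve_map_basepoint[OF c \<phi>(1)] nerve_map_basepoint[OF d \<psi>(1)] \<alpha> fV0
      in \<open>simp_all add: loops_def linear_extension_vertex\<close>)
  moreover have "compose {0..1} (linear_extension f) (compose {0..1} (nerve_map (fst d) \<psi>) \<alpha>) \<in>
      loops (realization (nerve (fst c))) (vertex (snd c))"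
    using lin by (rule compose_in_loops[OF \<psi>(3)]) (simp add: linear_extension_vertex fV0)
  moreover have "path_homotopic (realization (nerve (fst c)))
      (compose {0..1} (linear_extension f) (compose {0..1} (nerve_map (fst d) \<psi>) \<alpha>))
      (compose {0..1} (nerve_map (fst c) \<phi>) \<alpha>) \<longleftrightarrow> path_homotopic (realization (nerve (fst c))) ?q ?p"
    by (rule path_homotopic_cong) (auto simp: compose_def)
  ultimately have "loop_class (realization (nerve (fst c))) (vertex (snd c))
      (compose {0..1} (linear_extension f) (compose {0..1} (nerve_map (fst d) \<psi>) \<alpha>)) =
      loop_class (realization (nerve (fst c))) (vertex (snd c)) (compose {0..1} (nerve_map (fst c) \<phi>) \<alpha>)"
    using \<phi>(3) by (simp add: loop_class_eq_iff)
  then show ?thesis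
    unfolding bonding_hom_def f_def[symmetric] \<phi>(2) \<psi>(2)
    by (subst induced_hom_loop_class[OF \<psi>(3) lin]) (simp_all add: linear_extension_vertex fV0)
qed

lemma shape_hom_in_hom:
  assumes X: "metrizable_space X"
  shows "shape_hom X x \<in> hom (fundamental_group X x) (shape_group X x)"
proof (rule homI)
  fix A assume "A \<in> carrier (fundamental_group X x)"
  then obtain \<alpha> where \<alpha>: "\<alpha> \<in> loops X x" "A = loop_class X x \<alpha>"
    by (auto simp: carrier_fundamental_group)
  have "shape_hom X x A c \<in> carrier (nerve_group c)" if "c \<in> pointed_covers X x" for c
    using shape_hom_loop_class(2,3)[OF X that \<alpha>(1)] \<alpha>(2)
    by (simp add: nerve_group_def case_prod_unfold carrier_fundamental_group)
  moreover have "shape_hom X x A \<in> extensional (pointed_covers X x)"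
    by (simp add: shape_hom_def)
  ultimately show "shape_hom X x A \<in> carrier (shape_group X x)"
    using bonding_hom_shape_hom[OF X _ _ _ \<alpha>(1)] \<alpha>(2) by (auto simp: shape_group_def PiE_def)
next
  fix A B assume AB: "A \<in> carrier (fundamental_group X x)" "B \<in> carrier (fundamental_group X x)"
  show "shape_hom X x (A \<otimes>\<^bsub>fundamental_group X x\<^esub> B) =
      shape_hom X x A \<otimes>\<^bsub>shape_group X x\<^esub> shape_hom X x B"
  proof
    fix c
    show "shape_hom X x (A \<otimes>\<^bsub>fundamental_group X x\<^esub> B) c =
        (shape_hom X x A \<otimes>\<^bsub>shape_group X x\<^esub> shape_hom X x B) c"
    proof (cases "c \<in> pointed_covers X x")
      case c: True
      define \<phi> where "\<phi> = (SOME \<phi>. pointed_partition_of_unity X x c \<phi>)"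
      have \<phi>: "pointed_partition_of_unity X x c \<phi>"
        unfolding \<phi>_def using ex_pointed_partition_of_unity[OF X c] by (rule someI_ex)
      have "continuous_map X (realization (nerve (fst c))) (nerve_map (fst c) \<phi>)"
        by (intro barycentric_map_imp_continuous simplicial_complex_nerve barycentric_map_nerve_map[OF c \<phi>])
      then have "induced_hom (realization (nerve (fst c))) (vertex (snd c)) (nerve_map (fst c) \<phi>) \<in>
          hom (fundamental_group X x) (nerve_group c)"
        using induced_hom_in_hom nerve_map_basepoint[OF c \<phi>]
        by (simp add: nerve_group_def case_prod_unfold)
      then show ?thesis
        using c AB hom_mult[of _ "fundamental_group X x" "nerve_group c" A B]
        by (simp add: shape_hom_def shape_group_def \<phi>_def)
    qed (simp add: shape_hom_def shape_group_def)
  qed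
qed

section \<open>Detecting loops in nerves\<close>

text \<open>Passing to path connected open subsets of the members of a star refinement preserves the
  star property, as smaller sets meet less often; local path connectedness ensures that they still
  cover.\<close>

lemma ex_path_connected_star_refinement:
  assumes X: "metrizable_space X" "locally_path_connected_space X"
    and \<O>: "\<And>U. U \<in> \<O> \<Longrightarrow> openin X U" "\<Union>\<O> = topspace X"
  obtains \<W> where "\<And>W. W \<in> \<W> \<Longrightarrow> openin X W" "\<And>W. W \<in> \<W> \<Longrightarrow> path_connectedin X W" "\<Union>\<W> = topspace X"
    "\<And>W. W \<in> \<W> \<Longrightarrow> \<exists>U\<in>\<O>. \<forall>W'\<in>\<W>. W \<inter> W' \<noteq> {} \<longrightarrow> W' \<subseteq> U"
proof -
  obtain \<S> where \<S>: "\<And>S. S \<in> \<S> \<Longrightarrow> openin X S" "\<Union>\<S> = topspace X"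
    "\<And>S. S \<in> \<S> \<Longrightarrow> \<exists>U\<in>\<O>. \<forall>S'\<in>\<S>. S \<inter> S' \<noteq> {} \<longrightarrow> S' \<subseteq> U"
    by (rule metrizable_star_refinement[OF X(1) \<O>], assumption) (rule that)
  let ?W = "{W. openin X W \<and> path_connectedin X W \<and> (\<exists>S\<in>\<S>. W \<subseteq> S)}"
  show ?thesis
  proof (rule that[of ?W])
    show "\<Union>?W = topspace X"
    proof
      show "\<Union>?W \<subseteq> topspace X" using openin_subset by blast
      show "topspace X \<subseteq> \<Union>?W"
      proof
        fix x assume "x \<in> topspace X"
        then obtain S where S: "S \<in> \<S>" "x \<in> S" using \<S>(2) by blast
        then obtain W where "openin X W" "path_connectedin X W" "x \<in> W" "W \<subseteq> S"
          using X(2) \<S>(1)[OF S(1)] unfolding locally_path_connected_space_alt neighbourhood_base_of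
          by (meson subsetD)
        then show "x \<in> \<Union>?W" using S(1) by blast
      qed
    qed
    fix W assume "W \<in> ?W"
    then obtain S where S: "S \<in> \<S>" "W \<subseteq> S" by blast
    then obtain U where U: "U \<in> \<O>" "\<And>S'. S' \<in> \<S> \<Longrightarrow> S \<inter> S' \<noteq> {} \<Longrightarrow> S' \<subseteq> U"
      using \<S>(3)[OF S(1)] by auto
    have "W' \<subseteq> U" if W': "W' \<in> ?W" "W \<inter> W' \<noteq> {}" for W'
    proof -
      obtain S' where "S' \<in> \<S>" "W' \<subseteq> S'" using W'(1) by blast
      then show ?thesis using U(2)[of S'] S(2) W'(2) by blast
    qed
    then show "\<exists>U\<in>\<O>. \<forall>W'\<in>?W. W \<inter> W' \<noteq> {} \<longrightarrow> W' \<subseteq> U" using U(1) by blast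
  qed auto
qed

text \<open>Two star refinements are made in \<open>Y\<close>, and the finer cover is pulled back
  along \<open>q\<close> and made locally finite in \<open>X\<close>. If \<open>U\<close> and
  \<open>V\<close> meet, so do \<open>P U\<close> and \<open>P V\<close>, even though
  \<open>P U\<close> may be far larger than the image of \<open>U\<close>.\<close>

proposition ex_nerve_detecting_loops:
  assumes X: "metrizable_space X" "x \<in> topspace X"
    and Y: "metrizable_space Y" "locally_path_connected_space Y" "semilocally_simply_connected_space Y"
    and q: "continuous_map X Y q"
  obtains c where "c \<in> pointed_covers X x"
    "\<And>\<phi> \<alpha>. pointed_partition_of_unity X x c \<phi> \<Longrightarrow> pathin X \<alpha> \<Longrightarrow> \<alpha> 0 = x \<Longrightarrow> \<alpha> 1 = x \<Longrightarrow>
       path_homotopic (realization (nerve (fst c))) (nerve_map (fst c) \<phi> \<circ> \<alpha>) (\<lambda>t. vertex (snd c)) \<Longrightarrow>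
       path_homotopic Y (q \<circ> \<alpha>) (\<lambda>t. q x)"
proof -
  let ?D = "{D. openin Y D \<and> paths_homotopic_within Y D}"
  have D_open: "\<And>D. D \<in> ?D \<Longrightarrow> openin Y D" by blast
  have D_cover: "\<Union>?D = topspace Y"
  proof
    show "\<Union>?D \<subseteq> topspace Y" using openin_subset by blast
    show "topspace Y \<subseteq> \<Union>?D"
    proof
      fix y assume "y \<in> topspace Y"
      then obtain D where "openin Y D" "y \<in> D" "paths_homotopic_within Y D"
        by (rule semilocally_simply_connected_imp_paths_homotopic_within[OF Y(3,2)])
      then show "y \<in> \<Union>?D" by blast
    qed
  qed
  obtain \<C> where \<C>: "\<And>C. C \<in> \<C> \<Longrightarrow> openin Y C" "\<And>C. C \<in> \<C> \<Longrightarrow> path_connectedin Y C"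
    "\<Union>\<C> = topspace Y" "\<And>C. C \<in> \<C> \<Longrightarrow> \<exists>D\<in>?D. \<forall>C'\<in>\<C>. C \<inter> C' \<noteq> {} \<longrightarrow> C' \<subseteq> D"
    by (rule ex_path_connected_star_refinement[OF Y(1,2) D_open D_cover], assumption) (rule that)
  obtain \<P> where \<P>: "\<And>P. P \<in> \<P> \<Longrightarrow> openin Y P" "\<And>P. P \<in> \<P> \<Longrightarrow> path_connectedin Y P"
    "\<Union>\<P> = topspace Y" "\<And>P. P \<in> \<P> \<Longrightarrow> \<exists>C\<in>\<C>. \<forall>P'\<in>\<P>. P \<inter> P' \<noteq> {} \<longrightarrow> P' \<subseteq> C"
    by (rule ex_path_connected_star_refinement[OF Y(1,2) \<C>(1,3)], assumption) (rule that)
  let ?E = "(\<lambda>P. {z \<in> topspace X. q z \<in> P}) ` \<P>"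
  have E_open: "\<And>E. E \<in> ?E \<Longrightarrow> openin X E"
    by (auto intro: openin_continuous_map_preimage[OF q] \<P>(1))
  have "q z \<in> \<Union>\<P>" if "z \<in> topspace X" for z
    using \<P>(3) continuous_map_funspace[OF q] that by auto
  then have E_cover: "\<Union>?E = topspace X"
    by fastforce
  obtain \<U> where \<U>: "\<And>U. U \<in> \<U> \<Longrightarrow> openin X U" "\<And>U. U \<in> \<U> \<Longrightarrow> \<exists>E\<in>?E. U \<subseteq> E"
    "\<Union>\<U> = topspace X" "locally_finite_in X \<U>"
    by (rule metrizable_locally_finite_refinement[OF X(1) E_open E_cover], assumption) (rule that)
  have "\<forall>U\<in>\<U>. \<exists>P\<in>\<P>. U \<subseteq> {z \<in> topspace X. q z \<in> P}" using \<U>(2) by blast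
  then obtain P where P: "\<And>U. U \<in> \<U> \<Longrightarrow> P U \<in> \<P>" "\<And>U z. U \<in> \<U> \<Longrightarrow> z \<in> U \<Longrightarrow> q z \<in> P U"
    by (metis (mono_tags, lifting) mem_Collect_eq subsetD)
  have "\<forall>U\<in>\<U>. \<exists>C\<in>\<C>. \<forall>P'\<in>\<P>. P U \<inter> P' \<noteq> {} \<longrightarrow> P' \<subseteq> C" using P(1) \<P>(4) by blast
  then obtain C where C: "\<And>U. U \<in> \<U> \<Longrightarrow> C U \<in> \<C>"
    "\<And>U P'. U \<in> \<U> \<Longrightarrow> P' \<in> \<P> \<Longrightarrow> P U \<inter> P' \<noteq> {} \<Longrightarrow> P' \<subseteq> C U"
    by metis
  have "\<forall>U\<in>\<U>. \<exists>D\<in>?D. \<forall>C'\<in>\<C>. C U \<inter> C' \<noteq> {} \<longrightarrow> C' \<subseteq> D" using C(1) \<C>(4) by blast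
  then obtain D where D: "\<And>U. U \<in> \<U> \<Longrightarrow> D U \<in> ?D"
    "\<And>U C'. U \<in> \<U> \<Longrightarrow> C' \<in> \<C> \<Longrightarrow> C U \<inter> C' \<noteq> {} \<Longrightarrow> C' \<subseteq> D U"
    by metis
  have meet: "P U \<inter> P V \<noteq> {}" if "U \<in> \<U>" "V \<in> \<U>" "U \<inter> V \<noteq> {}" for U V
    using P(2) that by blast
  have PC: "P V \<subseteq> C U" if "U \<in> \<U>" "V \<in> \<U>" "U \<inter> V \<noteq> {}" for U V
    using C(2)[OF that(1) P(1)[OF that(2)]] meet[OF that] by blast
  \<comment> \<open>The star property of the coarser cover needs \<open>C U\<close> and
    \<open>C V\<close> to meet. They do: each contains both \<open>P U\<close> and
    \<open>P V\<close>, up to the roles of \<open>U\<close> and \<open>V\<close>, and these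
    meet.\<close>
  have CD: "C V \<subseteq> D U" if "U \<in> \<U>" "V \<in> \<U>" "U \<inter> V \<noteq> {}" for U V
  proof -
    have "P U \<inter> P V \<subseteq> C U \<inter> C V"
      using PC[OF that(1,2,3)] PC[OF that(2,1)] that(3) by blast
    then have "C U \<inter> C V \<noteq> {}" using meet[OF that] by blast
    then show ?thesis using D(2)[OF that(1) C(1)[OF that(2)]] by blast
  qed
  obtain U0 where U0: "U0 \<in> \<U>" "x \<in> U0" using \<U>(3) X(2) by blast
  have c: "(\<U>, U0) \<in> pointed_covers X x"
    using \<U> U0 by (simp add: pointed_covers_def)
  show ?thesis
  proof (rule that[OF c])
    fix \<phi> \<alpha>
    assume \<phi>: "pointed_partition_of_unity X x (\<U>, U0) \<phi>" and \<alpha>: "pathin X \<alpha>" "\<alpha> 0 = x" "\<alpha> 1 = x"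
      and null: "path_homotopic (realization (nerve (fst (\<U>, U0)))) (nerve_map (fst (\<U>, U0)) \<phi> \<circ> \<alpha>)
        (\<lambda>t. vertex (snd (\<U>, U0)))"
    show "path_homotopic Y (q \<circ> \<alpha>) (\<lambda>t. q x)"
    proof (rule path_homotopic_null_if_null_in_nerve[where \<U> = \<U> and \<phi> = "nerve_map \<U> \<phi>" and P = P and C = C
          and D = D and X = X and ?U0.0 = U0])
      show "continuous_map X (realization (nerve \<U>)) (nerve_map \<U> \<phi>)"
        using barycentric_map_imp_continuous[OF simplicial_complex_nerve barycentric_map_nerve_map[OF c \<phi>]]
        by simp
      show "\<And>y U. y \<in> topspace X \<Longrightarrow> nerve_map \<U> \<phi> y U \<noteq> 0 \<Longrightarrow> y \<in> U"
        using mem_if_nerve_map_nonzero[OF \<phi>] by simp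
      show "nerve_map \<U> \<phi> x = vertex U0"
        using nerve_map_basepoint[OF c \<phi>] by simp
      show "path_homotopic (realization (nerve \<U>)) (nerve_map \<U> \<phi> \<circ> \<alpha>) (\<lambda>t. vertex U0)"
        using null by simp
      show "\<And>U. U \<in> \<U> \<Longrightarrow> q ` (U \<inter> topspace X) \<subseteq> P U" using P(2) by blast
      show "\<And>U. U \<in> \<U> \<Longrightarrow> path_connectedin Y (P U)" using P(1) \<P>(2) by blast
      show "\<And>U. U \<in> \<U> \<Longrightarrow> path_connectedin Y (C U)" using C(1) \<C>(2) by blast
      show "\<And>U. U \<in> \<U> \<Longrightarrow> paths_homotopic_within Y (D U)" using D(1) by blast
    qed (use q PC CD \<alpha> \<U>(3) in auto)
  qed
qed

section \<open>The loop space\<close>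

lemma openin_compact_open_topology_iff:
  "openin (compact_open_topology X Y) = generate_topology_on
     {{f \<in> extensional (topspace X). continuous_map X Y f \<and> f ` K \<subseteq> U} | K U. compactin X K \<and> openin Y U}"
  unfolding compact_open_topology_def openin_topology_generated_by_iff ..

lemma loops_subset_compact_open_topology:
  "loops X x \<subseteq> topspace (compact_open_topology (top_of_set {0..1}) X)"
proof -
  \<comment> \<open>The subbasic set for empty \<open>K\<close> and empty \<open>U\<close> consists
    of all extensional continuous maps.\<close>
  have "loops X x \<subseteq> {f \<in> extensional (topspace (top_of_set {0..1})).
      continuous_map (top_of_set {0..1}) X f \<and> f ` {} \<subseteq> {}}"
    by (auto simp: loops_def pathin_def)
  also have "\<dots> \<subseteq> topspace (compact_open_topology (top_of_set {0..1}) X)"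
    unfolding compact_open_topology_def
    by (rule openin_subset, rule topology_generated_by_Basis) (use compactin_empty openin_empty in blast)
  finally show ?thesis .
qed

lemma topspace_loop_space: "topspace (loop_space X x) = loops X x"
  unfolding loop_space_def using loops_subset_compact_open_topology[of X x] by (simp add: topspace_subtopology Int_absorb1)

lemma openin_loop_space_subbasic:
  assumes "compact K" "K \<subseteq> {0..1}" "openin X U"
  shows "openin (loop_space X x) {\<beta> \<in> loops X x. \<beta> ` K \<subseteq> U}"
proof -
  let ?B = "{f \<in> extensional (topspace (top_of_set {0..1})).
      continuous_map (top_of_set {0..1}) X f \<and> f ` K \<subseteq> U}"
  have "compactin (top_of_set {0..1}) K"
    using assms by (simp add: compactin_subtopology)
  then have "openin (compact_open_topology (top_of_set {0..1}) X) ?B"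
    unfolding compact_open_topology_def using assms(3) by (intro topology_generated_by_Basis) blast
  moreover have "{\<beta> \<in> loops X x. \<beta> ` K \<subseteq> U} = ?B \<inter> loops X x"
    by (auto simp: loops_def pathin_def)
  ultimately show ?thesis
    unfolding loop_space_def openin_subtopology by blast
qed

lemma ex_uniform_subdivision:
  assumes \<beta>: "pathin X \<beta>" and \<W>: "\<And>W. W \<in> \<W> \<Longrightarrow> openin X W" "topspace X \<subseteq> \<Union>\<W>"
  obtains n :: nat where "0 < n" "\<And>i. i < n \<Longrightarrow> \<exists>W\<in>\<W>. \<beta> ` {real i / real n..real (Suc i) / real n} \<subseteq> W"
proof -
  have "\<exists>B. open B \<and> {t \<in> {0..1}. \<beta> t \<in> W} = {0..1} \<inter> B" if "W \<in> \<W>" for W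
    using openin_continuous_map_preimage[OF \<beta>[unfolded pathin_def] \<W>(1)[OF that]]
    by (simp add: openin_open)
  then obtain B where B: "\<And>W. W \<in> \<W> \<Longrightarrow> open (B W)" "\<And>W. W \<in> \<W> \<Longrightarrow> {t \<in> {0..1}. \<beta> t \<in> W} = {0..1} \<inter> B W"
    by metis
  have cover: "\<exists>W\<in>\<W>. t \<in> B W" if t: "t \<in> {0..1}" for t
  proof -
    have "\<beta> t \<in> topspace X" using path_image_subset_topspace[OF \<beta>] t by blast
    then show ?thesis using \<W>(2) B(2) t by blast
  qed
  obtain \<delta> where \<delta>: "0 < \<delta>" "\<And>T. T \<subseteq> {0..1} \<Longrightarrow> diameter T < \<delta> \<Longrightarrow> \<exists>b\<in>B ` \<W>. T \<subseteq> b"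
  proof (rule Lebesgue_number_lemma[of "{0..1::real}" "B ` \<W>"])
    show "{0..1} \<subseteq> \<Union>(B ` \<W>)" using cover by blast
    show "B ` \<W> \<noteq> {}" using cover[of 0] by auto
  qed (use B(1) in auto)
  obtain m :: nat where m: "1 / \<delta> < real m" using reals_Archimedean2 by blast
  define n where "n = Suc m"
  have n: "0 < n" "1 / real n < \<delta>"
    using m \<open>0 < \<delta>\<close> by (auto simp: n_def field_simps)
  show ?thesis
  proof (rule that[OF n(1)])
    fix i assume i: "i < n"
    let ?T = "{real i / real n..real (Suc i) / real n}"
    have T: "?T \<subseteq> {0..1}" using i by (auto simp: divide_simps)
    have "real i / real n \<le> real (Suc i) / real n" by (simp add: divide_right_mono)
    then have "diameter ?T = real (Suc i) / real n - real i / real n"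
      by (simp add: diameter_closed_interval)
    also have "\<dots> < \<delta>" using n by (simp add: add_divide_distrib)
    finally obtain W where "W \<in> \<W>" "?T \<subseteq> B W" using \<delta>(2)[OF T] by blast
    then show "\<exists>W\<in>\<W>. \<beta> ` ?T \<subseteq> W" using B(2) T by blast
  qed
qed

lemma ex_cell_containing:
  fixes t :: real
  assumes "0 < n" "t \<in> {0..1}"
  obtains i where "i < n" "t \<in> {real i / real n..real (Suc i) / real n}"
proof (cases "t = 1")
  case True
  \<comment> \<open>For \<open>t = 1\<close> the floor used in the other case would give
    \<open>n\<close>, one index too many.\<close>
  then show ?thesis using that[of "n - 1"] assms(1) by auto
next
  case False
  define i where "i = nat \<lfloor>t * real n\<rfloor>"
  have "0 \<le> t * real n" using assms(2) by simp
  then have "real i = of_int \<lfloor>t * real n\<rfloor>" by (simp add: i_def)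
  then have i: "real i \<le> t * real n" "t * real n < real i + 1" by linarith+
  have "t * real n < real n" using False assms by simp
  then have "i < n" using i(1) by linarith
  moreover have "t \<in> {real i / real n..real (Suc i) / real n}"
    using i assms(1) by (auto simp: field_simps)
  ultimately show ?thesis using that by blast
qed

text \<open>From a neighbourhood meeting finitely many members remove the closed supports belonging
  to members that miss \<open>y\<close>. The single point \<open>y\<close> is then common to all
  members active anywhere in \<open>W\<close>, as contiguity requires.\<close>

lemma nerve_map_neighbourhood:
  assumes c: "c \<in> pointed_covers X x" and \<phi>: "pointed_partition_of_unity X x c \<phi>" and y: "y \<in> topspace X"
  obtains W where "openin X W" "y \<in> W" "\<And>z U. z \<in> W \<Longrightarrow> nerve_map (fst c) \<phi> z U \<noteq> 0 \<Longrightarrow> y \<in> U"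
proof -
  obtain N where N: "openin X N" "y \<in> N" "finite {U \<in> fst c. U \<inter> N \<noteq> {}}"
    using pointed_coversD(1)[OF c] y unfolding locally_finite_in_def by blast
  let ?F = "{U \<in> fst c. U \<inter> N \<noteq> {} \<and> y \<notin> U}"
  let ?S = "\<lambda>U. X closure_of {z \<in> topspace X. \<phi> U z \<noteq> 0}"
  have "finite ?F" by (rule finite_subset[OF _ N(3)]) blast
  then have "closedin X (\<Union>U\<in>?F. ?S U)" by (intro closedin_Union) auto
  then have "openin X (N - (\<Union>U\<in>?F. ?S U))" using N(1) by (rule openin_diff[rotated])
  moreover have "y \<in> N - (\<Union>U\<in>?F. ?S U)"
    using N(2) pointed_partition_of_unityD(3)[OF \<phi>] by blast
  moreover have "y \<in> U" if z: "z \<in> N - (\<Union>U\<in>?F. ?S U)" and nz: "nerve_map (fst c) \<phi> z U \<noteq> 0" for z U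
  proof (rule ccontr)
    assume "y \<notin> U"
    have zX: "z \<in> topspace X" using z N(1) openin_subset by blast
    have U: "U \<in> fst c" "\<phi> U z \<noteq> 0" using nz by (auto simp: nerve_map_def split: if_splits)
    then have "z \<in> ?S U" using closure_of_subset[of "{z \<in> topspace X. \<phi> U z \<noteq> 0}" X] zX by auto
    moreover have "U \<in> ?F"
      using U(1) mem_if_nerve_map_nonzero[OF \<phi> zX nz] z \<open>y \<notin> U\<close> by blast
    ultimately show False using z by blast
  qed
  ultimately show ?thesis using that by blast
qed

text \<open>Cut \<open>\<beta>\<close> into cells mapped into such neighbourhoods. A loop
  \<open>\<gamma>\<close> with the same itinerary is contiguous to \<open>\<beta>\<close> in the
  nerve, the witness on each cell being the point \<open>y\<close> of its neighbourhood; finitely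
  many cells give an open condition.\<close>

lemma nerve_class_locally_constant:
  assumes c: "c \<in> pointed_covers X x" and \<phi>: "pointed_partition_of_unity X x c \<phi>" and \<beta>: "\<beta> \<in> loops X x"
  obtains W where "openin (loop_space X x) W" "\<beta> \<in> W"
    "\<And>\<gamma>. \<gamma> \<in> W \<Longrightarrow> path_homotopic (realization (nerve (fst c))) (nerve_map (fst c) \<phi> \<circ> \<gamma>) (nerve_map (fst c) \<phi> \<circ> \<beta>)"
proof -
  let ?good = "\<lambda>W. openin X W \<and> (\<exists>y. \<forall>z U. z \<in> W \<longrightarrow> nerve_map (fst c) \<phi> z U \<noteq> 0 \<longrightarrow> y \<in> U)"
  have "topspace X \<subseteq> \<Union>{W. ?good W}"
  proof
    fix y assume "y \<in> topspace X"
    then obtain W where W: "openin X W" "y \<in> W" "\<And>z U. z \<in> W \<Longrightarrow> nerve_map (fst c) \<phi> z U \<noteq> 0 \<Longrightarrow> y \<in> U"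
      by (rule nerve_map_neighbourhood[OF c \<phi>]) blast
    then have "?good W" by blast
    then show "y \<in> \<Union>{W. ?good W}" using W(2) by blast
  qed
  then obtain n :: nat where n: "0 < n"
    "\<And>i. i < n \<Longrightarrow> \<exists>W\<in>{W. ?good W}. \<beta> ` {real i / real n..real (Suc i) / real n} \<subseteq> W"
    using ex_uniform_subdivision[OF loops_pathin[OF \<beta>], of "{W. ?good W}"] by blast
  define cell where "cell i = {real i / real n..real (Suc i) / real n}" for i
  have "\<exists>W. i < n \<longrightarrow> ?good W \<and> \<beta> ` cell i \<subseteq> W" for i using n(2)[of i] unfolding cell_def by blast
  then obtain V where V: "\<And>i. i < n \<Longrightarrow> ?good (V i)" "\<And>i. i < n \<Longrightarrow> \<beta> ` cell i \<subseteq> V i" by metis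
  define W where "W = (\<Inter>i<n. {\<gamma> \<in> loops X x. \<gamma> ` cell i \<subseteq> V i})"
  have "openin (loop_space X x) {\<gamma> \<in> loops X x. \<gamma> ` cell i \<subseteq> V i}" if "i < n" for i
    using V(1)[OF that] that
    by (intro openin_loop_space_subbasic) (auto simp: cell_def divide_simps)
  then have "openin (loop_space X x) W"
    unfolding W_def using n(1) by (intro openin_Inter) auto
  moreover have "\<beta> \<in> W" using \<beta> V(2) by (auto simp: W_def)
  moreover have "path_homotopic (realization (nerve (fst c))) (nerve_map (fst c) \<phi> \<circ> \<gamma>) (nerve_map (fst c) \<phi> \<circ> \<beta>)"
    if \<gamma>W: "\<gamma> \<in> W" for \<gamma>
  proof -
    have \<gamma>: "\<gamma> \<in> loops X x" "\<And>i. i < n \<Longrightarrow> \<gamma> ` cell i \<subseteq> V i"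
      using \<gamma>W n(1) by (auto simp: W_def)
    have b: "barycentric_map (top_of_set {0..1}) (nerve (fst c)) (nerve_map (fst c) \<phi> \<circ> \<delta>)"
      if "\<delta> \<in> loops X x" for \<delta>
      using loops_pathin[OF that] unfolding pathin_def
      by (rule barycentric_map_compose[OF barycentric_map_nerve_map[OF c \<phi>]])
    show ?thesis
    proof (rule path_homotopic_barycentric_maps[OF simplicial_complex_nerve b[OF \<gamma>(1)] b[OF \<beta>]])
      fix t :: real assume t: "t \<in> {0..1}"
      obtain i where i: "i < n" "t \<in> cell i"
        using ex_cell_containing[OF n(1) t] unfolding cell_def by blast
      obtain y where y: "\<And>z U. z \<in> V i \<Longrightarrow> nerve_map (fst c) \<phi> z U \<noteq> 0 \<Longrightarrow> y \<in> U"
        using V(1)[OF i(1)] by blast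
      have "\<gamma> t \<in> V i" "\<beta> t \<in> V i" using \<gamma>(2)[OF i(1)] V(2)[OF i(1)] i(2) by blast+
      then show "{v. (nerve_map (fst c) \<phi> \<circ> \<gamma>) t v \<noteq> 0} \<union> {v. (nerve_map (fst c) \<phi> \<circ> \<beta>) t v \<noteq> 0} \<in> nerve (fst c)"
        using barycentric_map_support[OF simplicial_complex_nerve b[OF \<gamma>(1)], of t]
          barycentric_map_support[OF simplicial_complex_nerve b[OF \<beta>], of t] t y
        by (intro nerve_Un[of _ _ _ y]) auto
    qed (use \<gamma>(1) \<beta> in \<open>auto simp: loops_def\<close>)
  qed
  ultimately show ?thesis using that by blast
qed

text \<open>Two distinct classes differ already in one nerve, where the class of a loop is locally
  constant. So the loops outside the class \<open>A\<close> form an open set, which is what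
  closedness of \<open>{A}\<close> means in the quotient.\<close>

theorem t1_space_pi1_qtop_if_shape_injective:
  assumes X: "metrizable_space X" and inj: "inj_on (shape_hom X x) (carrier (fundamental_group X x))"
  shows "t1_space (pi1_qtop X x)"
  unfolding t1_space_closedin_singleton
proof
  fix A assume "A \<in> topspace (pi1_qtop X x)"
  then obtain \<alpha> where \<alpha>: "\<alpha> \<in> loops X x" "A = loop_class X x \<alpha>"
    by (auto simp: pi1_qtop_def topspace_quotient_topology topspace_loop_space)
  have "openin (loop_space X x) {\<beta> \<in> loops X x. loop_class X x \<beta> \<noteq> A}"
  proof (subst openin_subopen, intro ballI)
    fix \<beta> assume "\<beta> \<in> {\<beta> \<in> loops X x. loop_class X x \<beta> \<noteq> A}"
    then have \<beta>: "\<beta> \<in> loops X x" "loop_class X x \<beta> \<noteq> A" by auto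
    then have "shape_hom X x (loop_class X x \<beta>) \<noteq> shape_hom X x A"
      using inj \<alpha> by (auto simp: inj_on_def carrier_fundamental_group)
    then obtain c where c: "shape_hom X x (loop_class X x \<beta>) c \<noteq> shape_hom X x A c" by blast
    then have cov: "c \<in> pointed_covers X x" by (auto simp: shape_hom_def split: if_splits)
    define \<phi> where "\<phi> = (SOME \<phi>. pointed_partition_of_unity X x c \<phi>)"
    note sh = shape_hom_loop_class[OF X cov, folded \<phi>_def]
    obtain W where W: "openin (loop_space X x) W" "\<beta> \<in> W"
      "\<And>\<gamma>. \<gamma> \<in> W \<Longrightarrow> path_homotopic (realization (nerve (fst c))) (nerve_map (fst c) \<phi> \<circ> \<gamma>) (nerve_map (fst c) \<phi> \<circ> \<beta>)"
      using nerve_class_locally_constant[OF cov sh(1)[OF \<beta>(1)] \<beta>(1)] by blast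
    have "W \<subseteq> {\<beta> \<in> loops X x. loop_class X x \<beta> \<noteq> A}"
    proof
      fix \<gamma> assume "\<gamma> \<in> W"
      then have \<gamma>: "\<gamma> \<in> loops X x" using openin_subset[OF W(1)] by (auto simp: topspace_loop_space)
      have "shape_hom X x (loop_class X x \<gamma>) c = shape_hom X x (loop_class X x \<beta>) c"
        using W(3)[OF \<open>\<gamma> \<in> W\<close>] sh(2,3)[OF \<gamma>] sh(2,3)[OF \<beta>(1)]
        by (simp add: loop_class_eq_iff path_homotopic_compose_iff)
      then show "\<gamma> \<in> {\<beta> \<in> loops X x. loop_class X x \<beta> \<noteq> A}" using \<gamma> c by auto
    qed
    then show "\<exists>T. openin (loop_space X x) T \<and> \<beta> \<in> T \<and> T \<subseteq> {\<beta> \<in> loops X x. loop_class X x \<beta> \<noteq> A}"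
      using W(1,2) by blast
  qed
  moreover have "{\<beta> \<in> loops X x. loop_class X x \<beta> \<in> topspace (pi1_qtop X x) - {A}} =
      {\<beta> \<in> loops X x. loop_class X x \<beta> \<noteq> A}"
    by (auto simp: pi1_qtop_def topspace_quotient_topology topspace_loop_space)
  ultimately have "openin (pi1_qtop X x) (topspace (pi1_qtop X x) - {A})"
    unfolding pi1_qtop_def openin_quotient_topology topspace_loop_space topspace_quotient_topology by auto
  then show "closedin (pi1_qtop X x) {A}"
    using \<alpha> by (auto simp: closedin_def pi1_qtop_def topspace_quotient_topology topspace_loop_space)
qed

lemma openin_essential_loops:
  assumes "t1_space (pi1_qtop X x)" "x \<in> topspace X"
  shows "openin (loop_space X x) {\<beta> \<in> loops X x. \<not> path_homotopic X \<beta> (\<lambda>t. x)}"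
proof -
  define A where "A = loop_class X x (\<lambda>t\<in>{0..1}. x)"
  have "A \<in> topspace (pi1_qtop X x)"
    using const_in_loops[OF assms(2)] by (auto simp: A_def pi1_qtop_def topspace_quotient_topology topspace_loop_space)
  then have "openin (pi1_qtop X x) (topspace (pi1_qtop X x) - {A})"
    using assms(1) unfolding t1_space_closedin_singleton by blast
  then have "openin (loop_space X x) {\<beta> \<in> loops X x. loop_class X x \<beta> \<in> topspace (pi1_qtop X x) - {A}}"
    unfolding pi1_qtop_def openin_quotient_topology topspace_loop_space by blast
  moreover have "loop_class X x \<beta> = A \<longleftrightarrow> path_homotopic X \<beta> (\<lambda>t. x)" if "\<beta> \<in> loops X x" for \<beta>
    unfolding A_def loop_class_eq_iff[OF that const_in_loops[OF assms(2)]]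
    by (rule path_homotopic_cong) auto
  then have "{\<beta> \<in> loops X x. loop_class X x \<beta> \<in> topspace (pi1_qtop X x) - {A}} =
      {\<beta> \<in> loops X x. \<not> path_homotopic X \<beta> (\<lambda>t. x)}"
    by (auto simp: pi1_qtop_def topspace_quotient_topology topspace_loop_space)
  ultimately show ?thesis by simp
qed

section \<open>Inverse limits of nested retracts\<close>

lemma topspace_inverse_limit:
  "topspace (inverse_limit X r) = {z. (\<forall>k. z k \<in> topspace (X k)) \<and> (\<forall>j. r j (z (Suc j)) = z j)}"
  by (auto simp: inverse_limit_def PiE_def)

lemma metrizable_inverse_limit:
  assumes "\<And>j. metrizable_space (X j)"
  shows "metrizable_space (inverse_limit X r)"
  unfolding inverse_limit_def using assms
  by (intro metrizable_space_subtopology) (simp add: metrizable_space_product_topology)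

lemma continuous_map_inverse_limit_projection: "continuous_map (inverse_limit X r) (X j) (\<lambda>z. z j)"
  unfolding inverse_limit_def
  by (intro continuous_map_from_subtopology continuous_map_product_projection) simp

text \<open>The bound \<open>n\<close> holds for a whole neighbourhood \<open>V\<close> of
  \<open>z\<close>, not only for \<open>z\<close> itself, so that compactness can make it uniform
  along a loop.\<close>

lemma inverse_limit_neighbourhood:
  assumes U: "openin (inverse_limit X r) U" and z: "z \<in> U"
  obtains n V where "openin (inverse_limit X r) V" "z \<in> V"
    "\<forall>u\<in>V. \<forall>w\<in>topspace (inverse_limit X r). (\<forall>k\<le>n. w k = u k) \<longrightarrow> w \<in> U"
proof -
  let ?L = "{x. \<forall>j. r j (x (Suc j)) = x j}"
  obtain T where T: "openin (product_topology X UNIV) T" "U = T \<inter> ?L"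
    using U unfolding inverse_limit_def openin_subtopology by blast
  obtain W where W: "z \<in> Pi\<^sub>E UNIV W" "\<And>i. openin (X i) (W i)" "finite {i. W i \<noteq> topspace (X i)}"
    "Pi\<^sub>E UNIV W \<subseteq> T"
    using product_topology_open_contains_basis[OF T(1), of z] z T(2) by blast
  obtain n where n: "\<And>i. W i \<noteq> topspace (X i) \<Longrightarrow> i \<le> n"
    using W(3) unfolding finite_nat_set_iff_bounded_le by auto
  show ?thesis
  proof (rule that[of "Pi\<^sub>E UNIV W \<inter> ?L" n])
    have "openin (product_topology X UNIV) (Pi\<^sub>E UNIV W)"
      using W(2,3) by (simp add: openin_PiE_gen)
    then show "openin (inverse_limit X r) (Pi\<^sub>E UNIV W \<inter> ?L)"
      unfolding inverse_limit_def openin_subtopology by blast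
    show "z \<in> Pi\<^sub>E UNIV W \<inter> ?L" using W(1) z T(2) by blast
    have "w \<in> U" if u: "u \<in> Pi\<^sub>E UNIV W \<inter> ?L" and w: "w \<in> topspace (inverse_limit X r)"
      and eq: "\<forall>k\<le>n. w k = u k" for u w
    proof -
      have "w i \<in> W i" for i
      proof (cases "i \<le> n")
        case True
        then show ?thesis using eq u by auto
      next
        case False
        then have "W i = topspace (X i)" using n by blast
        then show ?thesis using w by (simp add: topspace_inverse_limit)
      qed
      then show ?thesis using w W(4) T(2) by (auto simp: topspace_inverse_limit PiE_def)
    qed
    then show "\<forall>u\<in>Pi\<^sub>E UNIV W \<inter> ?L. \<forall>w\<in>topspace (inverse_limit X r). (\<forall>k\<le>n. w k = u k) \<longrightarrow> w \<in> U"
      by blast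
  qed
qed

context
  fixes X :: "nat \<Rightarrow> 'a topology" and r :: "nat \<Rightarrow> 'a \<Rightarrow> 'a"
  assumes nested: "nested_retracts X r"
begin

lemma retract_continuous: "continuous_map (X (Suc j)) (X j) (r j)"
  and retract_fixes: "x \<in> topspace (X j) \<Longrightarrow> r j x = x"
  and inclusion_Suc_continuous: "continuous_map (X j) (X (Suc j)) id"
  using nested unfolding nested_retracts_def retraction_maps_def by auto

lemma inclusion_continuous: "j \<le> k \<Longrightarrow> continuous_map (X j) (X k) id"
proof (induction k rule: dec_induct)
  case base
  show ?case by (rule continuous_map_id)
next
  case (step k)
  then show ?case using continuous_map_compose[OF step.IH inclusion_Suc_continuous] by simp
qed

lemma topspace_mono: "j \<le> k \<Longrightarrow> topspace (X j) \<subseteq> topspace (X k)"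
  using continuous_map_image_subset_topspace[OF inclusion_continuous] by force

section \<open>Sections of the limit projections\<close>

lemma limit_section_ge: "j \<le> k \<Longrightarrow> limit_section r j x k = x"
  by (simp add: limit_section_def)

lemma limit_section_less: "k < j \<Longrightarrow> limit_section r j x k = r k (limit_section r j x (Suc k))"
  by (simp add: limit_section_def upt_conv_Cons)

lemma limit_section_coherent:
  assumes "x \<in> topspace (X j)"
  shows "r k (limit_section r j x (Suc k)) = limit_section r j x k"
proof (cases "k < j")
  case False
  then have "x \<in> topspace (X k)" using assms topspace_mono[of j k] by auto
  then show ?thesis using False retract_fixes by (simp add: limit_section_ge)
qed (simp add: limit_section_less)

lemma limit_section_coordinate_continuous: "continuous_map (X j) (X k) (\<lambda>x. limit_section r j x k)"
proof (cases "j \<le> k")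
  case True
  then show ?thesis using inclusion_continuous[OF True] by (simp add: limit_section_ge id_def)
next
  case False
  then have "k \<le> j" by simp
  then show ?thesis
  proof (induction k rule: inc_induct)
    case base
    show ?case using inclusion_continuous[of j j] by (simp add: limit_section_ge id_def)
  next
    case (step k)
    then show ?case
      using continuous_map_compose[OF step.IH retract_continuous] by (simp add: limit_section_less o_def)
  qed
qed

lemma limit_section_continuous: "continuous_map (X j) (inverse_limit X r) (limit_section r j)"
proof -
  have "continuous_map (X j) (product_topology X UNIV) (limit_section r j)"
    unfolding continuous_map_componentwise_UNIV using limit_section_coordinate_continuous by blast
  then show ?thesis
    unfolding inverse_limit_def continuous_map_in_subtopology using limit_section_coherent by auto
qed

lemma limit_section_projection:
  assumes "z \<in> topspace (inverse_limit X r)" "k \<le> j"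
  shows "limit_section r j (z j) k = z k"
  using assms(2)
proof (induction k rule: inc_induct)
  case base
  show ?case by (simp add: limit_section_ge)
next
  case (step k)
  then show ?case using assms(1) by (simp add: limit_section_less topspace_inverse_limit)
qed

lemma limit_section_base:
  assumes "x0 \<in> topspace (X 0)"
  shows "limit_section r j x0 = (\<lambda>k. x0)"
proof
  fix k
  show "limit_section r j x0 k = x0"
  proof (cases "j \<le> k")
    case False
    then have "k \<le> j" by simp
    then show ?thesis
    proof (induction k rule: inc_induct)
      case (step k)
      then show ?case
        using retract_fixes[of x0 k] topspace_mono[of 0 k] assms by (auto simp: limit_section_less)
    qed (simp add: limit_section_ge)
  qed (simp add: limit_section_ge)
qed

text \<open>\<open>\<sigma> j\<close> agrees with \<open>\<gamma>\<close> in all coordinates up to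
  \<open>j\<close>, and near each point of an open set finitely many coordinates decide membership.
  The image of a compact \<open>K\<close> is compact, so one bound serves all its points.\<close>

lemma sections_of_projections_converge:
  assumes \<gamma>: "\<gamma> \<in> loops (inverse_limit X r) (limit_section r 0 x0)" and x0: "x0 \<in> topspace (X 0)"
  defines "\<sigma> \<equiv> \<lambda>j. \<lambda>t\<in>{0..1}. limit_section r j (\<gamma> t j)"
  shows "\<sigma> j \<in> loops (inverse_limit X r) (limit_section r 0 x0)"
    and "openin (loop_space (inverse_limit X r) (limit_section r 0 x0)) W \<Longrightarrow> \<gamma> \<in> W \<Longrightarrow>
      \<exists>n. \<forall>j\<ge>n. \<sigma> j \<in> W"
proof -
  let ?L = "inverse_limit X r" and ?x = "limit_section r 0 x0"
  have \<gamma>_top: "\<gamma> t \<in> topspace ?L" if "t \<in> {0..1}" for t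
    using path_image_subset_topspace[OF loops_pathin[OF \<gamma>]] that by blast
  show \<sigma>: "\<sigma> j \<in> loops ?L ?x" for j
  proof -
    have "pathin ?L (limit_section r j \<circ> ((\<lambda>z. z j) \<circ> \<gamma>))"
      by (rule pathin_compose[OF pathin_compose[OF loops_pathin[OF \<gamma>]
            continuous_map_inverse_limit_projection] limit_section_continuous])
    then have "pathin ?L (\<lambda>t. limit_section r j (\<gamma> t j))" by (simp add: o_def)
    then show ?thesis
      unfolding \<sigma>_def using loops_endpoints[OF \<gamma>] limit_section_base[OF x0]
      by (intro restrict_in_loops) auto
  qed
  have basic: "\<exists>n. \<forall>j\<ge>n. \<sigma> j ` K \<subseteq> U"
    if K: "compactin (top_of_set {0..1}) K" and U: "openin ?L U" and sub: "\<gamma> ` K \<subseteq> U" for K U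
  proof -
    let ?good = "\<lambda>V n. openin ?L V \<and>
      (\<forall>u w. u \<in> V \<longrightarrow> w \<in> topspace ?L \<longrightarrow> (\<forall>k\<le>n. w k = u k) \<longrightarrow> w \<in> U)"
    have "\<exists>V n. ?good V n \<and> z \<in> V" if zU: "z \<in> U" for z
    proof -
      obtain n V where "openin ?L V" "z \<in> V"
        "\<forall>u\<in>V. \<forall>w\<in>topspace ?L. (\<forall>k\<le>n. w k = u k) \<longrightarrow> w \<in> U"
        by (rule inverse_limit_neighbourhood[OF U zU]) (rule that)
      then have "?good V n \<and> z \<in> V" by blast
      then show ?thesis by blast
    qed
    then obtain V0 n0 where V0: "\<And>z. z \<in> U \<Longrightarrow> ?good (V0 z) (n0 z) \<and> z \<in> V0 z"
      by metis
    define \<G> where "\<G> = V0 ` U"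
    have \<G>: "\<And>V. V \<in> \<G> \<Longrightarrow> openin ?L V" "\<And>V. V \<in> \<G> \<Longrightarrow> \<exists>n. ?good V n"
      unfolding \<G>_def using V0 by blast+
    have cover: "\<gamma> ` K \<subseteq> \<Union>\<G>" unfolding \<G>_def using V0 sub by blast
    have "compactin ?L (\<gamma> ` K)"
      by (rule image_compactin[OF K]) (use loops_pathin[OF \<gamma>] in \<open>simp add: pathin_def\<close>)
    then obtain \<F> where \<F>: "finite \<F>" "\<F> \<subseteq> \<G>" "\<gamma> ` K \<subseteq> \<Union>\<F>"
      using compactinD[OF _ \<G>(1) cover] by metis
    have "\<forall>V\<in>\<F>. \<exists>n. ?good V n" using \<F>(2) \<G>(2) by blast
    then obtain n where n: "\<And>V. V \<in> \<F> \<Longrightarrow> ?good V (n V)" by metis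
    \<comment> \<open>If \<open>\<F>\<close> is empty, \<open>Max\<close> is unspecified, but then
      \<open>K\<close> is empty as well and nothing is claimed.\<close>
    have "\<sigma> j ` K \<subseteq> U" if j: "Max (n ` \<F>) \<le> j" for j
    proof
      fix y assume "y \<in> \<sigma> j ` K"
      then obtain t where t: "t \<in> K" "y = \<sigma> j t" by blast
      have t01: "t \<in> {0..1}" using K t(1) compactin_subset_topspace by fastforce
      obtain V where V: "V \<in> \<F>" "\<gamma> t \<in> V" using \<F>(3) t(1) by blast
      have "n V \<le> j" by (rule order_trans[OF Max_ge j]) (use \<F>(1) V(1) in auto)
      then have "\<sigma> j t k = \<gamma> t k" if "k \<le> n V" for k
        using limit_section_projection[OF \<gamma>_top[OF t01], of k j] that t01 by (simp add: \<sigma>_def)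
      moreover have "\<sigma> j t \<in> topspace ?L"
        using path_image_subset_topspace[OF loops_pathin[OF \<sigma>]] t01 by blast
      ultimately show "y \<in> U" using n[OF V(1)] V(2) t(2) by blast
    qed
    then show ?thesis by blast
  qed
  assume W: "openin (loop_space ?L ?x) W" "\<gamma> \<in> W"
  then obtain T where T: "openin (compact_open_topology (top_of_set {0..1}) ?L) T" "W = T \<inter> loops ?L ?x"
    unfolding loop_space_def openin_subtopology by blast
  have "\<gamma> \<in> T" using T(2) W(2) by blast
  with T(1)[unfolded openin_compact_open_topology_iff] have "\<exists>n. \<forall>j\<ge>n. \<sigma> j \<in> T"
  proof (induction T rule: generate_topology_on.induct)
    case (Int a b)
    have "\<gamma> \<in> a" "\<gamma> \<in> b" using Int.prems by simp_all
    then obtain n m where "\<forall>j\<ge>n. \<sigma> j \<in> a" "\<forall>j\<ge>m. \<sigma> j \<in> b" using Int.IH by metis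
    then show ?case by (intro exI[of _ "max n m"]) auto
  next
    case (UN K)
    then obtain k where "k \<in> K" "\<gamma> \<in> k" by blast
    then show ?case using UN.IH[of k] by blast
  next
    case (Basis s)
    from Basis.hyps obtain K U where KU: "compactin (top_of_set {0..1}) K" "openin ?L U"
      "s = {f \<in> extensional (topspace (top_of_set {0..1})). continuous_map (top_of_set {0..1}) ?L f \<and> f ` K \<subseteq> U}"
      by blast
    have "\<gamma> ` K \<subseteq> U" using Basis.prems KU(3) by blast
    then obtain n where "\<forall>j\<ge>n. \<sigma> j ` K \<subseteq> U" using basic[OF KU(1,2)] by blast
    moreover have "\<sigma> j \<in> extensional {0..1}" "continuous_map (top_of_set {0..1}) ?L (\<sigma> j)" for j
      using \<sigma>[of j] by (auto simp: loops_def pathin_def)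
    ultimately show ?case using KU(3) by auto
  qed simp
  then show "\<exists>n. \<forall>j\<ge>n. \<sigma> j \<in> W" using T(2) \<sigma> by blast
qed

lemma null_if_projections_null:
  assumes x0: "x0 \<in> topspace (X 0)" and t1: "t1_space (pi1_qtop (inverse_limit X r) (limit_section r 0 x0))"
    and \<gamma>: "\<gamma> \<in> loops (inverse_limit X r) (limit_section r 0 x0)"
    and null: "\<And>j. path_homotopic (X j) ((\<lambda>z. z j) \<circ> \<gamma>) (\<lambda>t. x0)"
  shows "path_homotopic (inverse_limit X r) \<gamma> (\<lambda>t. limit_section r 0 x0)"
proof (rule ccontr)
  let ?L = "inverse_limit X r" and ?x = "limit_section r 0 x0"
  let ?W = "{\<beta> \<in> loops ?L ?x. \<not> path_homotopic ?L \<beta> (\<lambda>t. ?x)}"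
  assume "\<not> path_homotopic ?L \<gamma> (\<lambda>t. ?x)"
  then have "\<gamma> \<in> ?W" using \<gamma> by simp
  moreover have "?x \<in> topspace ?L"
    using path_start_in_topspace[OF loops_pathin[OF \<gamma>]] loops_endpoints[OF \<gamma>] by simp
  ultimately obtain n where "\<forall>j\<ge>n. (\<lambda>t\<in>{0..1}. limit_section r j (\<gamma> t j)) \<in> ?W"
    using sections_of_projections_converge(2)[OF \<gamma> x0 openin_essential_loops[OF t1]] by blast
  then have "\<not> path_homotopic ?L (\<lambda>t\<in>{0..1}. limit_section r n (\<gamma> t n)) (\<lambda>t. ?x)" by blast
  moreover have "path_homotopic ?L (limit_section r n \<circ> ((\<lambda>z. z n) \<circ> \<gamma>)) (limit_section r n \<circ> (\<lambda>t. x0))"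
    by (rule path_homotopic_compose[OF null limit_section_continuous])
  moreover have "path_homotopic ?L (\<lambda>t\<in>{0..1}. limit_section r n (\<gamma> t n)) (\<lambda>t. ?x) \<longleftrightarrow>
      path_homotopic ?L (limit_section r n \<circ> ((\<lambda>z. z n) \<circ> \<gamma>)) (limit_section r n \<circ> (\<lambda>t. x0))"
    by (rule path_homotopic_cong) (simp_all add: limit_section_base[OF x0])
  ultimately show False by blast
qed

end

theorem corollary33:
  fixes X :: "nat \<Rightarrow> 'a topology" and r :: "nat \<Rightarrow> 'a \<Rightarrow> 'a" and x0 :: 'a
  assumes "nested_retracts X r"
    and "\<And>j. metrizable_space (X j)"
    and "\<And>j. locally_path_connected_space (X j)"
    and "\<And>j. semilocally_simply_connected_space (X j)"
    and "path_connected_space (inverse_limit X r)"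
    and "locally_path_connected_space (inverse_limit X r)"
    and "x0 \<in> topspace (X 0)"
  shows "t1_space (pi1_qtop (inverse_limit X r) (limit_section r 0 x0)) \<longleftrightarrow>
         pi1_shape_injective (inverse_limit X r) (limit_section r 0 x0)"
proof
  let ?L = "inverse_limit X r" and ?x = "limit_section r 0 x0"
  have L: "metrizable_space ?L" by (rule metrizable_inverse_limit[OF assms(2)])
  show "t1_space (pi1_qtop ?L ?x)" if "pi1_shape_injective ?L ?x"
    using that t1_space_pi1_qtop_if_shape_injective[OF L]
    by (simp add: pi1_shape_injective_def mon_def)
  assume t1: "t1_space (pi1_qtop ?L ?x)"
  have x: "?x \<in> topspace ?L"
    using continuous_map_image_subset_topspace[OF limit_section_continuous[OF assms(1), of 0]] assms(7) by blast
  have "inj_on (shape_hom ?L ?x) (carrier (fundamental_group ?L ?x))"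
  proof (rule inj_onI)
    fix A B
    assume "A \<in> carrier (fundamental_group ?L ?x)" "B \<in> carrier (fundamental_group ?L ?x)"
      and eq: "shape_hom ?L ?x A = shape_hom ?L ?x B"
    then obtain \<alpha> \<beta> where \<alpha>: "\<alpha> \<in> loops ?L ?x" "A = loop_class ?L ?x \<alpha>"
      and \<beta>: "\<beta> \<in> loops ?L ?x" "B = loop_class ?L ?x \<beta>"
      by (auto simp: carrier_fundamental_group)
    note ends = loops_endpoints[OF \<alpha>(1)] loops_endpoints[OF \<beta>(1)]
    \<comment> \<open>No group laws are established for the fundamental groups, so injectivity is
      not reduced to a trivial kernel: equal images of two classes are converted by hand into a loop
      all of whose projections are null-homotopic.\<close>
    define \<gamma> where "\<gamma> = path_join \<alpha> (path_rev \<beta>)"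
    have \<gamma>: "pathin ?L \<gamma>" "\<gamma> 0 = ?x" "\<gamma> 1 = ?x"
      using pathin_join[OF loops_pathin[OF \<alpha>(1)] pathin_rev[OF loops_pathin[OF \<beta>(1)]]] ends
      by (simp_all add: \<gamma>_def)
    have "path_homotopic (X j) ((\<lambda>z. z j) \<circ> \<gamma>) (\<lambda>t. x0)" for j
    proof -
      \<comment> \<open>The cover depends on \<open>j\<close>. At this single \<open>c\<close> the
        two shape images agree, so the nerve images of \<open>\<alpha>\<close> and
        \<open>\<beta>\<close> are homotopic and that of \<open>\<gamma>\<close> is
        null-homotopic.\<close>
      obtain c where c: "c \<in> pointed_covers ?L ?x"
        "\<And>\<phi> \<alpha>. pointed_partition_of_unity ?L ?x c \<phi> \<Longrightarrow> pathin ?L \<alpha> \<Longrightarrow> \<alpha> 0 = ?x \<Longrightarrow> \<alpha> 1 = ?x \<Longrightarrow>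
           path_homotopic (realization (nerve (fst c))) (nerve_map (fst c) \<phi> \<circ> \<alpha>) (\<lambda>t. vertex (snd c)) \<Longrightarrow>
           path_homotopic (X j) ((\<lambda>z. z j) \<circ> \<alpha>) (\<lambda>t. ?x j)"
        by (rule ex_nerve_detecting_loops[OF L x assms(2,3,4) continuous_map_inverse_limit_projection[of X r j]])
          (rule that)
      define \<phi> where "\<phi> = (SOME \<phi>. pointed_partition_of_unity ?L ?x c \<phi>)"
      note sh = shape_hom_loop_class[OF L c(1), folded \<phi>_def]
      let ?N = "realization (nerve (fst c))" and ?p = "nerve_map (fst c) \<phi>"
      have p: "continuous_map ?L ?N ?p"
        by (intro barycentric_map_imp_continuous simplicial_complex_nerve
            barycentric_map_nerve_map[OF c(1) sh(1)[OF \<alpha>(1)]])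
      have "loop_class ?N (vertex (snd c)) (compose {0..1} ?p \<alpha>) =
          loop_class ?N (vertex (snd c)) (compose {0..1} ?p \<beta>)"
        using eq unfolding \<alpha>(2) \<beta>(2) by (simp flip: sh(2)[OF \<alpha>(1)] sh(2)[OF \<beta>(1)])
      then have "path_homotopic ?N (?p \<circ> \<alpha>) (?p \<circ> \<beta>)"
        using loop_class_eq_iff[OF sh(3)[OF \<alpha>(1)] sh(3)[OF \<beta>(1)]] path_homotopic_compose_iff by blast
      then have "path_homotopic ?N (path_join (?p \<circ> \<alpha>) (path_rev (?p \<circ> \<beta>))) (path_join (?p \<circ> \<beta>) (path_rev (?p \<circ> \<beta>)))"
        by (rule path_homotopic_join)
          (use ends pathin_compose[OF loops_pathin[OF \<beta>(1)] p] in \<open>auto intro!: path_homotopic_refl pathin_rev\<close>)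
      also have "path_homotopic ?N \<dots> (\<lambda>t. (?p \<circ> \<beta>) 0)"
        by (rule path_homotopic_join_rev[OF pathin_compose[OF loops_pathin[OF \<beta>(1)] p]])
      finally have "path_homotopic ?N (path_join (?p \<circ> \<alpha>) (path_rev (?p \<circ> \<beta>))) (\<lambda>t. vertex (snd c))"
        using ends nerve_map_basepoint[OF c(1) sh(1)[OF \<alpha>(1)]] by simp
      moreover have "?p \<circ> \<gamma> = path_join (?p \<circ> \<alpha>) (path_rev (?p \<circ> \<beta>))"
        by (auto simp: \<gamma>_def path_join_def path_rev_def)
      ultimately have "path_homotopic (X j) ((\<lambda>z. z j) \<circ> \<gamma>) (\<lambda>t. ?x j)"
        using c(2)[OF sh(1)[OF \<alpha>(1)] \<gamma>] by simp
      then show ?thesis by (simp add: limit_section_base[OF assms(1,7)])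
    qed
    then have "path_homotopic (X j) ((\<lambda>z. z j) \<circ> restrict \<gamma> {0..1}) (\<lambda>t. x0)" for j
      by (subst path_homotopic_cong[where p' = "(\<lambda>z. z j) \<circ> \<gamma>" and q' = "\<lambda>t. x0"]) auto
    then have "path_homotopic ?L (restrict \<gamma> {0..1}) (\<lambda>t. ?x)"
      using null_if_projections_null[OF assms(1,7) t1 restrict_in_loops[OF \<gamma>]] by blast
    then have "path_homotopic ?L (path_join \<alpha> (path_rev \<beta>)) (\<lambda>t. \<alpha> 0)"
      using path_homotopic_cong[of "restrict \<gamma> {0..1}" \<gamma> "\<lambda>t. ?x" "\<lambda>t. ?x" ?L] ends by (simp add: \<gamma>_def)
    then have "path_homotopic ?L \<alpha> \<beta>"
      by (rule path_homotopic_if_join_rev_null[OF loops_pathin[OF \<alpha>(1)] loops_pathin[OF \<beta>(1)], rotated 2])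
        (use ends in auto)
    then show "A = B" using \<alpha> \<beta> by (simp add: loop_class_eq_iff)
  qed
  then show "pi1_shape_injective ?L ?x"
    unfolding pi1_shape_injective_def mon_def using shape_hom_in_hom[OF L] by blast
qed

end
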